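(* Let $V$ be an $\mathrm{FI}$-module over a commutative ring $\Bbbk$. Then there is a long exact sequence of $\mathrm{FI}$-modules $$\cdots \longrightarrow SH_{a+1}(V) \longrightarrow H_a(V) \xrightarrow{\ \iota_*\ } H_a(SV) \longrightarrow SH_a(V) \longrightarrow H_{a-1}(V) \xrightarrow{\ \iota_*\ } \cdots \longrightarrow H_0(V) \xrightarrow{\ \iota_*\ } H_0(SV)\longrightarrow SH_0(V) \longrightarrow 0,$$ where $\iota_*: H_a(V)\to H_a(SV)$ is the map induced by the natural homomorphism $\iota: V\to SV$.
   Context: $\Bbbk$ is a commutative ring and $\mathbb{Z}_+$ is the set of non-negative integers. $\mathrm{FI}$ is the category whose objects are finite sets and whose morphisms are injective maps. An $\mathrm{FI}$-module is a functor $V$ from $\mathrm{FI}$ to the category of $\Bbbk$-modules; write $V_X$ for $V(X)$ and $f_*: V_X\to V_Y$ for the map induced by an injection $f:X\to Y$. FI-modules form an abelian category (kernels, cokernels, exactness computed objectwise). For an $\mathrm{FI}$-module $V$ and a finite set $X$, let $(JV)_X\subset V_X$ be the $\Bbbk$-submodule spanned by the images of $f_*: V_Y\to V_X$ for all injections $f:Y\to X$ with $|Y|<|X|$. Then $JV$ is an $\mathrm{FI}$-submodule of $V$, and $F(V):=V/JV$ defines a right exact functor from $\mathrm{FI}$-modules to $\mathrm{FI}$-modules. For $a\in\mathbb{Z}_+$, the FI-homology functor $H_a$ is the $a$-th left derived functor of $F$. Fix a one-element set $\{\star\}$ and let $\sigma:\mathrm{FI}\to\mathrm{FI}$ be $X\mapsto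 X\sqcup\{\star\}$, $f\mapsto f\sqcup \mathrm{id}_{\{\star\}}$. The shift functor is $SV:=V\circ\sigma$, so $(SV)_X=V_{X\sqcup\{\star\}}$. The natural homomorphism $\iota:V\to SV$ is given by the maps $\iota_X: V_X\to V_{X\sqcup\{\star\}}$ induced by the inclusions $X\hookrightarrow X\sqcup\{\star\}$. Here $SH_a(V)$ means $S(H_a(V))$. *)

theory Defs
  imports "HOL-Algebra.Module" "HOL-Algebra.AbelCoset"
begin

section \<open>Modules: linear maps, spans and quotients\<close>

definition linear_maps ::
  "('k, 'r) ring_scheme \<Rightarrow> ('k, 'm) module \<Rightarrow> ('k, 'n) module \<Rightarrow> ('m \<Rightarrow> 'n) set" where
  "linear_maps R M N = {f \<in> carrier M \<rightarrow> carrier N.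
     (\<forall>u \<in> carrier M. \<forall>v \<in> carrier M. f (u \<oplus>\<^bsub>M\<^esub> v) = f u \<oplus>\<^bsub>N\<^esub> f v) \<and>
     (\<forall>r \<in> carrier R. \<forall>v \<in> carrier M. f (r \<odot>\<^bsub>M\<^esub> v) = r \<odot>\<^bsub>N\<^esub> f v)}"

definition module_span :: "('k, 'r) ring_scheme \<Rightarrow> ('k, 'm) module \<Rightarrow> 'm set \<Rightarrow> 'm set" where
  "module_span R M A = \<Inter>{N. submodule N R M \<and> A \<subseteq> N}"

text \<open>
  For \<open>g : L \<rightarrow> M\<close> additive and \<open>N\<close> a submodule of \<open>M\<close> containing the image under \<open>g\<close> of a
  submodule \<open>K\<close> of \<open>L\<close>, \<open>coset_map M N g\<close> is the induced map \<open>L/K \<rightarrow> M/N\<close> on cosets: all members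
  of the union below are then equal.
\<close>

definition coset_map :: "('k, 'n) module \<Rightarrow> 'n set \<Rightarrow> ('m \<Rightarrow> 'n) \<Rightarrow> 'm set \<Rightarrow> 'n set" where
  "coset_map M N g A = (\<Union>a\<in>A. N +>\<^bsub>M\<^esub> g a)"

text \<open>
  The record type of modules inherits the fields \<^const>\<open>mult\<close> and \<^const>\<open>one\<close> from rings; they play
  no role for modules.
\<close>

definition quotient_module :: "('k, 'm) module \<Rightarrow> 'm set \<Rightarrow> ('k, 'm set) module" where
  "quotient_module M N =
     \<lparr>carrier = a_rcosets\<^bsub>M\<^esub> N, mult = undefined, one = undefined,
      zero = N, add = set_add M, smult = (\<lambda>r. coset_map M N (\<lambda>v. r \<odot>\<^bsub>M\<^esub> v))\<rparr>"


section \<open>FI-modules\<close>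

text \<open>
  The category FI is represented by the finite subsets of a type \<^typ>\<open>'x\<close>, which will be infinite
  wherever it matters (it is forced to be so by the existence of disjoint unions with a point, see
  below), so that every finite set is isomorphic to an object.  A morphism \<open>X \<rightarrow> Y\<close> is a function
  on \<^typ>\<open>'x\<close> considered only on \<open>X\<close>: the third condition of \<open>fi_module\<close> says that functions that
  agree on \<open>X\<close> induce the same map.
\<close>

definition injections :: "'x set \<Rightarrow> 'x set \<Rightarrow> ('x \<Rightarrow> 'x) set" where
  "injections X Y = {f \<in> X \<rightarrow> Y. inj_on f X}"

record ('x, 'k, 'm) fi_mod =
  obj :: "'x set \<Rightarrow> ('k, 'm) module"
  arr :: "'x set \<Rightarrow> 'x set \<Rightarrow> ('x \<Rightarrow> 'x) \<Rightarrow> 'm \<Rightarrow> 'm"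

definition fi_module :: "('k, 'r) ring_scheme \<Rightarrow> ('x, 'k, 'm) fi_mod \<Rightarrow> bool" where
  "fi_module R V \<longleftrightarrow>
     (\<forall>X. finite X \<longrightarrow> module R (obj V X)) \<and>
     (\<forall>X Y. finite X \<longrightarrow> finite Y \<longrightarrow>
        (\<forall>f \<in> injections X Y. arr V X Y f \<in> linear_maps R (obj V X) (obj V Y))) \<and>
     (\<forall>X Y. finite X \<longrightarrow> finite Y \<longrightarrow>
        (\<forall>f \<in> injections X Y. \<forall>g \<in> injections X Y. (\<forall>x\<in>X. f x = g x) \<longrightarrow>
           (\<forall>v \<in> carrier (obj V X). arr V X Y f v = arr V X Y g v))) \<and>
     (\<forall>X. finite X \<longrightarrow> (\<forall>v \<in> carrier (obj V X). arr V X X id v = v)) \<and>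
     (\<forall>X Y Z. finite X \<longrightarrow> finite Y \<longrightarrow> finite Z \<longrightarrow>
        (\<forall>f \<in> injections X Y. \<forall>g \<in> injections Y Z. \<forall>v \<in> carrier (obj V X).
           arr V X Z (g \<circ> f) v = arr V Y Z g (arr V X Y f v)))"

definition fi_hom ::
  "('k, 'r) ring_scheme \<Rightarrow> ('x, 'k, 'm) fi_mod \<Rightarrow> ('x, 'k, 'n) fi_mod \<Rightarrow> ('x set \<Rightarrow> 'm \<Rightarrow> 'n) \<Rightarrow> bool"
where
  "fi_hom R V W \<phi> \<longleftrightarrow>
     fi_module R V \<and> fi_module R W \<and>
     (\<forall>X. finite X \<longrightarrow> \<phi> X \<in> linear_maps R (obj V X) (obj W X)) \<and>
     (\<forall>X Y. finite X \<longrightarrow> finite Y \<longrightarrow>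
        (\<forall>f \<in> injections X Y. \<forall>v \<in> carrier (obj V X).
           \<phi> Y (arr V X Y f v) = arr W X Y f (\<phi> X v)))"

definition fi_epi ::
  "('k, 'r) ring_scheme \<Rightarrow> ('x, 'k, 'm) fi_mod \<Rightarrow> ('x, 'k, 'n) fi_mod \<Rightarrow> ('x set \<Rightarrow> 'm \<Rightarrow> 'n) \<Rightarrow> bool"
where
  "fi_epi R V W \<phi> \<longleftrightarrow>
     fi_hom R V W \<phi> \<and> (\<forall>X. finite X \<longrightarrow> \<phi> X ` carrier (obj V X) = carrier (obj W X))"

definition fi_image ::
  "('x, 'k, 'm) fi_mod \<Rightarrow> ('x set \<Rightarrow> 'm \<Rightarrow> 'n) \<Rightarrow> 'x set \<Rightarrow> 'n set" where
  "fi_image V \<phi> X = \<phi> X ` carrier (obj V X)"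

definition fi_kernel ::
  "('x, 'k, 'm) fi_mod \<Rightarrow> ('x, 'k, 'n) fi_mod \<Rightarrow> ('x set \<Rightarrow> 'm \<Rightarrow> 'n) \<Rightarrow> 'x set \<Rightarrow> 'm set" where
  "fi_kernel V W \<phi> X = {v \<in> carrier (obj V X). \<phi> X v = \<zero>\<^bsub>obj W X\<^esub>}"

text \<open>Exactness of \<open>U \<rightarrow> V \<rightarrow> W\<close> at \<open>V\<close>.\<close>

definition fi_exact ::
  "('k, 'r) ring_scheme \<Rightarrow> ('x, 'k, 'l) fi_mod \<Rightarrow> ('x, 'k, 'm) fi_mod \<Rightarrow> ('x, 'k, 'n) fi_mod \<Rightarrow>
   ('x set \<Rightarrow> 'l \<Rightarrow> 'm) \<Rightarrow> ('x set \<Rightarrow> 'm \<Rightarrow> 'n) \<Rightarrow> bool"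
where
  "fi_exact R U V W \<phi> \<psi> \<longleftrightarrow>
     fi_hom R U V \<phi> \<and> fi_hom R V W \<psi> \<and>
     (\<forall>X. finite X \<longrightarrow> fi_image U \<phi> X = fi_kernel V W \<psi> X)"

text \<open>
  An FI-submodule \<open>N\<close> of \<open>V\<close> is given by the family of carriers \<open>N X\<close>.
\<close>

definition fi_sub :: "('x, 'k, 'm) fi_mod \<Rightarrow> ('x set \<Rightarrow> 'm set) \<Rightarrow> ('x, 'k, 'm) fi_mod" where
  "fi_sub V N = \<lparr>obj = (\<lambda>X. (obj V X)\<lparr>carrier := N X\<rparr>), arr = arr V\<rparr>"

definition fi_quotient :: "('x, 'k, 'm) fi_mod \<Rightarrow> ('x set \<Rightarrow> 'm set) \<Rightarrow> ('x, 'k, 'm set) fi_mod" where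
  "fi_quotient V N =
     \<lparr>obj = (\<lambda>X. quotient_module (obj V X) (N X)),
      arr = (\<lambda>X Y f. coset_map (obj V Y) (N Y) (arr V X Y f))\<rparr>"

text \<open>The map \<open>V/M \<rightarrow> W/N\<close> induced by \<open>\<phi> : V \<rightarrow> W\<close> with \<open>\<phi> M \<subseteq> N\<close>.\<close>

definition fi_quotient_map ::
  "('x, 'k, 'n) fi_mod \<Rightarrow> ('x set \<Rightarrow> 'n set) \<Rightarrow> ('x set \<Rightarrow> 'm \<Rightarrow> 'n) \<Rightarrow> 'x set \<Rightarrow> 'm set \<Rightarrow> 'n set"
where
  "fi_quotient_map W N \<phi> X = coset_map (obj W X) (N X) (\<phi> X)"


section \<open>The shift functor\<close>

text \<open>
  The disjoint union of \<open>X\<close> with the one-element set is \<open>insert None (Some ` X)\<close>.  Its elements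
  have type \<^typ>\<open>'x option\<close>; an injection \<open>e : 'x option \<rightarrow> 'x\<close> turns it into a subset of \<^typ>\<open>'x\<close>
  again.  Such an \<open>e\<close> exists if and only if \<^typ>\<open>'x\<close> is infinite.
\<close>

definition add_point :: "('x option \<Rightarrow> 'x) \<Rightarrow> 'x set \<Rightarrow> 'x set" where
  "add_point e X = e ` insert None (Some ` X)"

definition add_point_map :: "('x option \<Rightarrow> 'x) \<Rightarrow> ('x \<Rightarrow> 'x) \<Rightarrow> 'x \<Rightarrow> 'x" where
  "add_point_map e f = e \<circ> map_option f \<circ> inv_into UNIV e"

definition shift :: "('x option \<Rightarrow> 'x) \<Rightarrow> ('x, 'k, 'm) fi_mod \<Rightarrow> ('x, 'k, 'm) fi_mod" where
  "shift e V =
     \<lparr>obj = (\<lambda>X. obj V (add_point e X)),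
      arr = (\<lambda>X Y f. arr V (add_point e X) (add_point e Y) (add_point_map e f))\<rparr>"

definition shift_incl :: "('x option \<Rightarrow> 'x) \<Rightarrow> ('x, 'k, 'm) fi_mod \<Rightarrow> 'x set \<Rightarrow> 'm \<Rightarrow> 'm" where
  "shift_incl e V X = arr V X (add_point e X) (e \<circ> Some)"


section \<open>The functor \<open>F\<close>\<close>

definition fi_J :: "('k, 'r) ring_scheme \<Rightarrow> ('x, 'k, 'm) fi_mod \<Rightarrow> 'x set \<Rightarrow> 'm set" where
  "fi_J R V X = module_span R (obj V X)
     (\<Union>Y \<in> {Y. finite Y \<and> card Y < card X}. \<Union>f \<in> injections Y X.
        arr V Y X f ` carrier (obj V Y))"

definition fi_F :: "('k, 'r) ring_scheme \<Rightarrow> ('x, 'k, 'm) fi_mod \<Rightarrow> ('x, 'k, 'm set) fi_mod" where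
  "fi_F R V = fi_quotient V (fi_J R V)"

definition fi_F_map ::
  "('k, 'r) ring_scheme \<Rightarrow> ('x, 'k, 'n) fi_mod \<Rightarrow> ('x set \<Rightarrow> 'm \<Rightarrow> 'n) \<Rightarrow> 'x set \<Rightarrow> 'm set \<Rightarrow> 'n set"
where
  "fi_F_map R W \<phi> = fi_quotient_map W (fi_J R W) \<phi>"


section \<open>Projective resolutions\<close>

text \<open>
  Projectivity in the category of FI-modules whose elements belong to the type \<^typ>\<open>'u\<close>.
  If \<^typ>\<open>'u\<close> is infinite and at least as large as \<^typ>\<open>'x\<close> and \<^typ>\<open>'k\<close>, then every FI-module in
  this category is a quotient of a direct sum of representable FI-modules that again belongs to it.
  A projective object of it is then a direct summand of such a direct sum, and hence has the
  lifting property with respect to epimorphisms of FI-modules with elements in any types.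
\<close>

definition fi_projective :: "('k, 'r) ring_scheme \<Rightarrow> ('x, 'k, 'u) fi_mod \<Rightarrow> bool" where
  "fi_projective R P \<longleftrightarrow> fi_module R P \<and>
     (\<forall>(A :: ('x, 'k, 'u) fi_mod) (B :: ('x, 'k, 'u) fi_mod) g h.
        fi_epi R A B g \<longrightarrow> fi_hom R P B h \<longrightarrow>
        (\<exists>l. fi_hom R P A l \<and>
             (\<forall>X. finite X \<longrightarrow> (\<forall>v \<in> carrier (obj P X). g X (l X v) = h X v))))"

text \<open>
  \<open>res_diff\<close> at \<open>n\<close> is the differential from degree \<open>n + 1\<close> to degree \<open>n\<close>.
\<close>

record ('x, 'k, 'm, 'u) resolution =
  res_term :: "nat \<Rightarrow> ('x, 'k, 'u) fi_mod"
  res_diff :: "nat \<Rightarrow> 'x set \<Rightarrow> 'u \<Rightarrow> 'u"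
  res_aug  :: "'x set \<Rightarrow> 'u \<Rightarrow> 'm"

definition projective_resolution ::
  "('k, 'r) ring_scheme \<Rightarrow> ('x, 'k, 'm) fi_mod \<Rightarrow> ('x, 'k, 'm, 'u) resolution \<Rightarrow> bool" where
  "projective_resolution R V P \<longleftrightarrow>
     (\<forall>n. fi_projective R (res_term P n)) \<and>
     (\<forall>n. fi_exact R (res_term P (Suc (Suc n))) (res_term P (Suc n)) (res_term P n)
            (res_diff P (Suc n)) (res_diff P n)) \<and>
     fi_exact R (res_term P 1) (res_term P 0) V (res_diff P 0) (res_aug P) \<and>
     fi_epi R (res_term P 0) V (res_aug P)"

definition is_lift ::
  "('k, 'r) ring_scheme \<Rightarrow> ('x, 'k, 'm, 'u) resolution \<Rightarrow> ('x, 'k, 'n, 'w) resolution \<Rightarrow>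
   ('x set \<Rightarrow> 'm \<Rightarrow> 'n) \<Rightarrow> (nat \<Rightarrow> 'x set \<Rightarrow> 'u \<Rightarrow> 'w) \<Rightarrow> bool"
where
  "is_lift R P Q \<phi> \<Phi> \<longleftrightarrow>
     (\<forall>n. fi_hom R (res_term P n) (res_term Q n) (\<Phi> n)) \<and>
     (\<forall>n X. finite X \<longrightarrow> (\<forall>v \<in> carrier (obj (res_term P (Suc n)) X).
        \<Phi> n X (res_diff P n X v) = res_diff Q n X (\<Phi> (Suc n) X v))) \<and>
     (\<forall>X. finite X \<longrightarrow> (\<forall>v \<in> carrier (obj (res_term P 0) X).
        res_aug Q X (\<Phi> 0 X v) = \<phi> X (res_aug P X v)))"


section \<open>FI-homology\<close>

text \<open>
  The left derived functors of \<open>F\<close>: choose a projective resolution of every FI-module, and a lift to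
  the chosen resolutions of every homomorphism; apply \<open>F\<close> and take homology.  The elements of the
  chosen resolutions of FI-modules with elements in \<^typ>\<open>'m\<close> are taken from the type
  \<^typ>\<open>('x + 'k + 'm) list\<close>.  It is infinite and at least as large as \<^typ>\<open>'x\<close>,
  \<^typ>\<open>'k\<close> and \<^typ>\<open>'m\<close>, so it has room for iterated covers by direct sums of representable
  FI-modules.
\<close>

definition chosen_resolution ::
  "('k, 'r) ring_scheme \<Rightarrow> ('x, 'k, 'm) fi_mod \<Rightarrow> ('x, 'k, 'm, ('x + 'k + 'm) list) resolution" where
  "chosen_resolution R V = (SOME P. projective_resolution R V P)"

definition chosen_lift ::
  "('k, 'r) ring_scheme \<Rightarrow> ('x, 'k, 'm) fi_mod \<Rightarrow> ('x, 'k, 'm) fi_mod \<Rightarrow> ('x set \<Rightarrow> 'm \<Rightarrow> 'm) \<Rightarrow>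
   nat \<Rightarrow> 'x set \<Rightarrow> ('x + 'k + 'm) list \<Rightarrow> ('x + 'k + 'm) list"
where
  "chosen_lift R V W \<phi> =
     (SOME \<Phi>. is_lift R (chosen_resolution R V) (chosen_resolution R W) \<phi> \<Phi>)"

text \<open>
  Cycles and boundaries of a complex \<open>\<cdots> \<rightarrow> C 1 \<rightarrow> C 0 \<rightarrow> 0\<close> with \<open>d n : C (n + 1) \<rightarrow> C n\<close>.
\<close>

definition cycles ::
  "(nat \<Rightarrow> ('x, 'k, 'm) fi_mod) \<Rightarrow> (nat \<Rightarrow> 'x set \<Rightarrow> 'm \<Rightarrow> 'm) \<Rightarrow> nat \<Rightarrow> 'x set \<Rightarrow> 'm set" where
  "cycles C d n =
     (case n of 0 \<Rightarrow> (\<lambda>X. carrier (obj (C 0) X)) | Suc m \<Rightarrow> fi_kernel (C (Suc m)) (C m) (d m))"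

definition boundaries ::
  "(nat \<Rightarrow> ('x, 'k, 'm) fi_mod) \<Rightarrow> (nat \<Rightarrow> 'x set \<Rightarrow> 'm \<Rightarrow> 'm) \<Rightarrow> nat \<Rightarrow> 'x set \<Rightarrow> 'm set" where
  "boundaries C d n = fi_image (C (Suc n)) (d n)"

definition homology ::
  "(nat \<Rightarrow> ('x, 'k, 'm) fi_mod) \<Rightarrow> (nat \<Rightarrow> 'x set \<Rightarrow> 'm \<Rightarrow> 'm) \<Rightarrow> nat \<Rightarrow> ('x, 'k, 'm set) fi_mod" where
  "homology C d n = fi_quotient (fi_sub (C n) (cycles C d n)) (boundaries C d n)"

definition homology_map ::
  "(nat \<Rightarrow> ('x, 'k, 'n) fi_mod) \<Rightarrow> (nat \<Rightarrow> 'x set \<Rightarrow> 'n \<Rightarrow> 'n) \<Rightarrow> nat \<Rightarrow> ('x set \<Rightarrow> 'm \<Rightarrow> 'n) \<Rightarrow>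
   'x set \<Rightarrow> 'm set \<Rightarrow> 'n set"
where
  "homology_map D d n \<phi> = fi_quotient_map (fi_sub (D n) (cycles D d n)) (boundaries D d n) \<phi>"

definition F_terms ::
  "('k, 'r) ring_scheme \<Rightarrow> ('x, 'k, 'm, 'u) resolution \<Rightarrow> nat \<Rightarrow> ('x, 'k, 'u set) fi_mod" where
  "F_terms R P n = fi_F R (res_term P n)"

definition F_diffs ::
  "('k, 'r) ring_scheme \<Rightarrow> ('x, 'k, 'm, 'u) resolution \<Rightarrow> nat \<Rightarrow> 'x set \<Rightarrow> 'u set \<Rightarrow> 'u set" where
  "F_diffs R P n = fi_F_map R (res_term P n) (res_diff P n)"

definition FI_homology ::
  "('k, 'r) ring_scheme \<Rightarrow> nat \<Rightarrow> ('x, 'k, 'm) fi_mod \<Rightarrow>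
   ('x, 'k, ('x + 'k + 'm) list set set) fi_mod"
where
  "FI_homology R a V =
     homology (F_terms R (chosen_resolution R V)) (F_diffs R (chosen_resolution R V)) a"

definition FI_homology_map ::
  "('k, 'r) ring_scheme \<Rightarrow> nat \<Rightarrow> ('x, 'k, 'm) fi_mod \<Rightarrow> ('x, 'k, 'm) fi_mod \<Rightarrow>
   ('x set \<Rightarrow> 'm \<Rightarrow> 'm) \<Rightarrow>
   'x set \<Rightarrow> ('x + 'k + 'm) list set set \<Rightarrow> ('x + 'k + 'm) list set set"
where
  "FI_homology_map R a V W \<phi> =
     homology_map (F_terms R (chosen_resolution R W)) (F_diffs R (chosen_resolution R W)) a
       (fi_F_map R (res_term (chosen_resolution R W) a) (chosen_lift R V W \<phi> a))"

end

theory Submission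
  imports Defs
begin

text \<open>
  Let \<open>P\<close> be a projective resolution of \<open>V\<close>.  Then \<open>S P\<close> is a projective resolution of \<open>S V\<close>: the shift
  \<open>S\<close> is exact and preserves projectives, because its right adjoint (coinduction) preserves
  epimorphisms.  The canonical epimorphism from the coinduction of \<open>A\<close> onto \<open>A\<close> is adjoint to
  \<open>\<iota>\<close>, so lifting the identity of \<open>P\<^sub>n\<close> through it gives a retraction \<open>\<rho>\<close> of \<open>\<iota> : P\<^sub>n \<rightarrow> S P\<^sub>n\<close>.  Together with
  \<open>S (J W) = J (S W) + \<iota> W\<close> this says that \<open>0 \<rightarrow> F P \<rightarrow> F (S P) \<rightarrow> S (F P) \<rightarrow> 0\<close> is an exact sequence of
  complexes.  Its long exact homology sequence is the asserted one; it is derived on representatives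
  in \<open>P\<^sub>n\<close>, and the homology of \<open>F (S P)\<close> is compared with that of the chosen resolution of \<open>S V\<close>.
\<close>

section \<open>Linear maps and submodules\<close>

text \<open>For every FI-module \<open>W\<close> the sequence \<open>F W \<rightarrow> F (S W)
  \<rightarrow> S (F W) \<rightarrow> 0\<close> is exact, but its left map can fail to be injective:
  if \<open>W\<close> is nonzero on the empty set only, then \<open>S W = 0\<close> while
  \<open>F W = W\<close>. Injectivity means that \<open>\<iota> w\<close> in \<open>J (S W)\<close>
  forces \<open>w\<close> in \<open>J W\<close>; a homomorphism \<rho> retracting \<iota> gives
  this, since homomorphisms preserve \<open>J\<close>. This is why the argument runs on projectives.
  The retractions in different degrees need not commute with the differentials, and the connecting
  map, \<rho> after the differential, measures that failure. Two obstacles come from the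
  definitions. Homology is built on resolutions and lifts picked by \<open>SOME\<close>, so both
  must be shown to exist over a prescribed element type; free FI-modules, made of finitely supported
  functions, are therefore encoded in lists. And \<open>fi_projective\<close> tests one element type
  only, so coinduced modules have to be encoded as well before anything is lifted. Finally,
  \<open>S P\<close> is not the chosen resolution of \<open>S V\<close>; lifts \<alpha> and \<beta>
  of the identity, inverse to each other up to homotopy, carry the result over.\<close>

lemma linear_mapsI:
  assumes "\<And>v. v \<in> carrier M \<Longrightarrow> f v \<in> carrier N"
    and "\<And>u v. u \<in> carrier M \<Longrightarrow> v \<in> carrier M \<Longrightarrow> f (u \<oplus>\<^bsub>M\<^esub> v) = f u \<oplus>\<^bsub>N\<^esub> f v"
    and "\<And>r v. r \<in> carrier R \<Longrightarrow> v \<in> carrier M \<Longrightarrow> f (r \<odot>\<^bsub>M\<^esub> v) = r \<odot>\<^bsub>N\<^esub> f v"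
  shows "f \<in> linear_maps R M N"
  using assms by (auto simp: linear_maps_def)

lemma linear_mapsD:
  assumes "f \<in> linear_maps R M N"
  shows linear_closed: "v \<in> carrier M \<Longrightarrow> f v \<in> carrier N"
    and linear_add: "u \<in> carrier M \<Longrightarrow> v \<in> carrier M \<Longrightarrow> f (u \<oplus>\<^bsub>M\<^esub> v) = f u \<oplus>\<^bsub>N\<^esub> f v"
    and linear_smult: "r \<in> carrier R \<Longrightarrow> v \<in> carrier M \<Longrightarrow> f (r \<odot>\<^bsub>M\<^esub> v) = r \<odot>\<^bsub>N\<^esub> f v"
  using assms by (auto simp: linear_maps_def)

lemma linear_zero:
  assumes "f \<in> linear_maps R M N" "module R M" "module R N"
  shows "f \<zero>\<^bsub>M\<^esub> = \<zero>\<^bsub>N\<^esub>"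
proof -
  interpret M: module R M by fact
  interpret N: module R N by fact
  have "f \<zero>\<^bsub>M\<^esub> = f (\<zero>\<^bsub>R\<^esub> \<odot>\<^bsub>M\<^esub> \<zero>\<^bsub>M\<^esub>)" by simp
  also have "\<dots> = \<zero>\<^bsub>R\<^esub> \<odot>\<^bsub>N\<^esub> f \<zero>\<^bsub>M\<^esub>"
    by (rule linear_smult[OF assms(1)]) auto
  also have "\<dots> = \<zero>\<^bsub>N\<^esub>" by (simp add: linear_closed[OF assms(1)])
  finally show ?thesis .
qed

lemma linear_neg:
  assumes "f \<in> linear_maps R M N" "module R M" "module R N" "v \<in> carrier M"
  shows "f (\<ominus>\<^bsub>M\<^esub> v) = \<ominus>\<^bsub>N\<^esub> f v"
proof -
  interpret M: module R M by fact
  interpret N: module R N by fact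
  have "f v \<in> carrier N" by (simp add: linear_closed[OF assms(1)] assms)
  moreover have "\<ominus>\<^bsub>M\<^esub> v = (\<ominus>\<^bsub>R\<^esub> \<one>\<^bsub>R\<^esub>) \<odot>\<^bsub>M\<^esub> v" by (simp add: M.smult_l_minus assms)
  ultimately show ?thesis
    using linear_smult[OF assms(1), of "\<ominus>\<^bsub>R\<^esub> \<one>\<^bsub>R\<^esub>" v] assms(4) by (simp add: N.smult_l_minus)
qed

lemma linear_minus:
  assumes "f \<in> linear_maps R M N" "module R M" "module R N" "u \<in> carrier M" "v \<in> carrier M"
  shows "f (u \<ominus>\<^bsub>M\<^esub> v) = f u \<ominus>\<^bsub>N\<^esub> f v"
proof -
  interpret M: module R M by fact
  show ?thesis using assms
    by (simp add: a_minus_def linear_add[OF assms(1)] linear_neg[OF assms(1-3)])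
qed

text \<open>Closure under negation comes from the scalar -1.\<close>

lemma submodule_intro:
  assumes "module R M" "H \<subseteq> carrier M" "\<zero>\<^bsub>M\<^esub> \<in> H"
    and "\<And>a b. a \<in> H \<Longrightarrow> b \<in> H \<Longrightarrow> a \<oplus>\<^bsub>M\<^esub> b \<in> H"
    and smult: "\<And>r a. r \<in> carrier R \<Longrightarrow> a \<in> H \<Longrightarrow> r \<odot>\<^bsub>M\<^esub> a \<in> H"
  shows "submodule H R M"
proof -
  interpret M: module R M by fact
  show ?thesis
  proof (rule M.submoduleI)
    fix a assume a: "a \<in> H"
    then have "\<ominus>\<^bsub>M\<^esub> a = (\<ominus>\<^bsub>R\<^esub> \<one>\<^bsub>R\<^esub>) \<odot>\<^bsub>M\<^esub> a" using assms(2) by (auto simp: M.smult_l_minus)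
    then show "\<ominus>\<^bsub>M\<^esub> a \<in> H" using smult[of "\<ominus>\<^bsub>R\<^esub> \<one>\<^bsub>R\<^esub>" a] a by simp
  qed (use assms in auto)
qed

lemma submodule_zero: "submodule H R M \<Longrightarrow> \<zero>\<^bsub>M\<^esub> \<in> H"
  using submodule.axioms(1) subgroup.one_closed by fastforce

lemma submodule_add: "submodule H R M \<Longrightarrow> a \<in> H \<Longrightarrow> b \<in> H \<Longrightarrow> a \<oplus>\<^bsub>M\<^esub> b \<in> H"
  using submodule.axioms(1) subgroup.m_closed by fastforce

lemma submodule_subset: "submodule H R M \<Longrightarrow> H \<subseteq> carrier M"
  using submodule.axioms(1) subgroup.subset by fastforce

lemma submodule_closed: "submodule H R M \<Longrightarrow> a \<in> H \<Longrightarrow> a \<in> carrier M"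
  using submodule_subset by blast

lemma submodule_neg: "submodule H R M \<Longrightarrow> a \<in> H \<Longrightarrow> \<ominus>\<^bsub>M\<^esub> a \<in> H"
  unfolding a_inv_def using submodule.axioms(1) subgroup.m_inv_closed by fastforce

lemma submodule_minus: "submodule H R M \<Longrightarrow> a \<in> H \<Longrightarrow> b \<in> H \<Longrightarrow> a \<ominus>\<^bsub>M\<^esub> b \<in> H"
  by (simp add: a_minus_def submodule_add submodule_neg)

lemma submodule_preimage:
  assumes "f \<in> linear_maps R M N" "module R M" "module R N" "submodule K R N"
  shows "submodule {v \<in> carrier M. f v \<in> K} R M"
proof -
  interpret M: module R M by fact
  show ?thesis
    by (rule submodule_intro[OF assms(2)])
      (auto simp: linear_zero[OF assms(1-3)] linear_add[OF assms(1)] linear_smult[OF assms(1)]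
         submodule_zero[OF assms(4)] submodule_add[OF assms(4)] submodule.smult_closed[OF assms(4)])
qed

lemma submodule_zero_set: "module R M \<Longrightarrow> submodule {\<zero>\<^bsub>M\<^esub>} R M"
proof -
  assume M: "module R M"
  interpret M: module R M by fact
  show ?thesis by (rule submodule_intro[OF M]) auto
qed

lemma submodule_image:
  assumes "f \<in> linear_maps R M N" "module R M" "module R N" "submodule K R M"
  shows "submodule (f ` K) R N"
proof -
  interpret M: module R M by fact
  note K = submodule_closed[OF assms(4)]
  show ?thesis
  proof (rule submodule_intro[OF assms(3)])
    show "f ` K \<subseteq> carrier N" using K linear_closed[OF assms(1)] by auto
    show "\<zero>\<^bsub>N\<^esub> \<in> f ` K"
      using linear_zero[OF assms(1-3)] submodule_zero[OF assms(4)] by (metis imageI)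
    fix a b assume "a \<in> f ` K" "b \<in> f ` K"
    then obtain u v where "a = f u" "b = f v" "u \<in> K" "v \<in> K" by auto
    then show "a \<oplus>\<^bsub>N\<^esub> b \<in> f ` K"
      using linear_add[OF assms(1), of u v] K submodule_add[OF assms(4), of u v] by (metis imageI)
  next
    fix r a assume "r \<in> carrier R" "a \<in> f ` K"
    then show "r \<odot>\<^bsub>N\<^esub> a \<in> f ` K"
      using linear_smult[OF assms(1), of r] K submodule.smult_closed[OF assms(4), of r] by force
  qed
qed

lemma submodule_sum:
  assumes M: "module R M" and A: "submodule A R M" and B: "submodule B R M"
  shows "submodule {a \<oplus>\<^bsub>M\<^esub> b | a b. a \<in> A \<and> b \<in> B} R M"
proof -
  interpret M: module R M by fact
  note cA = submodule_closed[OF A] and cB = submodule_closed[OF B]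
  show ?thesis
  proof (rule submodule_intro[OF M])
    show "{a \<oplus>\<^bsub>M\<^esub> b | a b. a \<in> A \<and> b \<in> B} \<subseteq> carrier M" using cA cB by auto
    have "\<zero>\<^bsub>M\<^esub> = \<zero>\<^bsub>M\<^esub> \<oplus>\<^bsub>M\<^esub> \<zero>\<^bsub>M\<^esub>" by simp
    then show "\<zero>\<^bsub>M\<^esub> \<in> {a \<oplus>\<^bsub>M\<^esub> b | a b. a \<in> A \<and> b \<in> B}"
      using submodule_zero[OF A] submodule_zero[OF B] by blast
    fix u v
    assume "u \<in> {a \<oplus>\<^bsub>M\<^esub> b | a b. a \<in> A \<and> b \<in> B}" "v \<in> {a \<oplus>\<^bsub>M\<^esub> b | a b. a \<in> A \<and> b \<in> B}"
    then obtain a b a' b' where *: "u = a \<oplus>\<^bsub>M\<^esub> b" "v = a' \<oplus>\<^bsub>M\<^esub> b'" "a \<in> A" "b \<in> B" "a' \<in> A" "b' \<in> B"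
      by blast
    then have "u \<oplus>\<^bsub>M\<^esub> v = (a \<oplus>\<^bsub>M\<^esub> a') \<oplus>\<^bsub>M\<^esub> (b \<oplus>\<^bsub>M\<^esub> b')"
      using cA cB by (simp add: M.a_ac)
    then show "u \<oplus>\<^bsub>M\<^esub> v \<in> {a \<oplus>\<^bsub>M\<^esub> b | a b. a \<in> A \<and> b \<in> B}"
      using * submodule_add[OF A] submodule_add[OF B] by blast
  next
    fix r u assume "r \<in> carrier R" "u \<in> {a \<oplus>\<^bsub>M\<^esub> b | a b. a \<in> A \<and> b \<in> B}"
    then obtain a b where *: "u = a \<oplus>\<^bsub>M\<^esub> b" "a \<in> A" "b \<in> B" "r \<in> carrier R" by blast
    then have "r \<odot>\<^bsub>M\<^esub> u = r \<odot>\<^bsub>M\<^esub> a \<oplus>\<^bsub>M\<^esub> r \<odot>\<^bsub>M\<^esub> b" using cA cB by (simp add: M.smult_r_distr)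
    then show "r \<odot>\<^bsub>M\<^esub> u \<in> {a \<oplus>\<^bsub>M\<^esub> b | a b. a \<in> A \<and> b \<in> B}"
      using * submodule.smult_closed[OF A] submodule.smult_closed[OF B] by blast
  qed
qed

text \<open>As \<open>A\<close> lies in the carrier, the carrier is one of the submodules
  intersected, so the span stays inside the module.\<close>

lemma submodule_span:
  assumes "module R M" "A \<subseteq> carrier M"
  shows "submodule (module_span R M A) R M"
proof -
  interpret M: module R M by fact
  have c: "module_span R M A \<subseteq> carrier M"
    using M.carrier_is_submodule assms(2) by (auto simp: module_span_def)
  show ?thesis
    by (rule submodule_intro[OF assms(1) c])
      (auto simp: module_span_def submodule_zero submodule_add submodule.smult_closed)
qed

lemma module_span_superset: "A \<subseteq> module_span R M A"
  by (auto simp: module_span_def)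

lemma module_span_least: "submodule N R M \<Longrightarrow> A \<subseteq> N \<Longrightarrow> module_span R M A \<subseteq> N"
  by (auto simp: module_span_def)

text \<open>The module laws are equations, so a surjection that respects the operations carries them
  from \<open>M\<close> to \<open>N\<close>, a bare record at the outset. Quotients and transported
  structures get their module structure this way.\<close>

lemma module_surj_image:
  assumes M: "module R M"
    and carr: "carrier N = \<pi> ` carrier M"
    and add: "\<And>u v. u \<in> carrier M \<Longrightarrow> v \<in> carrier M \<Longrightarrow> \<pi> u \<oplus>\<^bsub>N\<^esub> \<pi> v = \<pi> (u \<oplus>\<^bsub>M\<^esub> v)"
    and smult: "\<And>r v. r \<in> carrier R \<Longrightarrow> v \<in> carrier M \<Longrightarrow> r \<odot>\<^bsub>N\<^esub> \<pi> v = \<pi> (r \<odot>\<^bsub>M\<^esub> v)"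
    and zero: "\<zero>\<^bsub>N\<^esub> = \<pi> \<zero>\<^bsub>M\<^esub>"
  shows "module R N"
proof -
  interpret M: module R M by fact
  show ?thesis
  proof (rule moduleI)
    show "cring R" by (rule M.is_cring)
    show "abelian_group N"
    proof (rule abelian_groupI)
      fix x assume "x \<in> carrier N"
      then obtain v where v: "x = \<pi> v" "v \<in> carrier M" using carr by auto
      then have "\<pi> (\<ominus>\<^bsub>M\<^esub> v) \<oplus>\<^bsub>N\<^esub> x = \<zero>\<^bsub>N\<^esub>" by (simp add: add zero M.l_neg)
      then show "\<exists>y\<in>carrier N. y \<oplus>\<^bsub>N\<^esub> x = \<zero>\<^bsub>N\<^esub>" using v carr by auto
    next
      fix x y assume "x \<in> carrier N" "y \<in> carrier N"
      then show "x \<oplus>\<^bsub>N\<^esub> y = y \<oplus>\<^bsub>N\<^esub> x" by (auto simp: carr add M.a_comm)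
    qed (auto simp: carr add zero M.a_assoc)
  qed (auto simp: carr add smult M.smult_l_distr M.smult_r_distr M.smult_assoc1)
qed


section \<open>FI-modules\<close>

lemma fi_moduleI:
  assumes "\<And>X. finite X \<Longrightarrow> module R (obj V X)"
    and "\<And>X Y f. finite X \<Longrightarrow> finite Y \<Longrightarrow> f \<in> injections X Y \<Longrightarrow>
           arr V X Y f \<in> linear_maps R (obj V X) (obj V Y)"
    and "\<And>X Y f g v. finite X \<Longrightarrow> finite Y \<Longrightarrow> f \<in> injections X Y \<Longrightarrow> g \<in> injections X Y \<Longrightarrow>
           (\<And>x. x \<in> X \<Longrightarrow> f x = g x) \<Longrightarrow> v \<in> carrier (obj V X) \<Longrightarrow> arr V X Y f v = arr V X Y g v"
    and "\<And>X v. finite X \<Longrightarrow> v \<in> carrier (obj V X) \<Longrightarrow> arr V X X id v = v"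
    and "\<And>X Y Z f g v. finite X \<Longrightarrow> finite Y \<Longrightarrow> finite Z \<Longrightarrow> f \<in> injections X Y \<Longrightarrow>
           g \<in> injections Y Z \<Longrightarrow> v \<in> carrier (obj V X) \<Longrightarrow>
           arr V X Z (g \<circ> f) v = arr V Y Z g (arr V X Y f v)"
  shows "fi_module R V"
  unfolding fi_module_def
  apply (intro conjI allI impI ballI)
  subgoal by (rule assms(1))
  subgoal by (rule assms(2))
  subgoal by (rule assms(3)) auto
  subgoal by (rule assms(4))
  subgoal by (rule assms(5))
  done

lemma fi_moduleD:
  assumes "fi_module R V"
  shows fi_obj: "finite X \<Longrightarrow> module R (obj V X)"
    and fi_arr: "finite X \<Longrightarrow> finite Y \<Longrightarrow> f \<in> injections X Y \<Longrightarrow>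
           arr V X Y f \<in> linear_maps R (obj V X) (obj V Y)"
    and fi_arr_cong: "finite X \<Longrightarrow> finite Y \<Longrightarrow> f \<in> injections X Y \<Longrightarrow> g \<in> injections X Y \<Longrightarrow>
           (\<And>x. x \<in> X \<Longrightarrow> f x = g x) \<Longrightarrow> v \<in> carrier (obj V X) \<Longrightarrow> arr V X Y f v = arr V X Y g v"
    and fi_arr_id: "finite X \<Longrightarrow> v \<in> carrier (obj V X) \<Longrightarrow> arr V X X id v = v"
    and fi_arr_comp: "finite X \<Longrightarrow> finite Y \<Longrightarrow> finite Z \<Longrightarrow> f \<in> injections X Y \<Longrightarrow>
           g \<in> injections Y Z \<Longrightarrow> v \<in> carrier (obj V X) \<Longrightarrow>
           arr V X Z (g \<circ> f) v = arr V Y Z g (arr V X Y f v)"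
proof -
  note * = assms[unfolded fi_module_def]
  show "finite X \<Longrightarrow> module R (obj V X)"
    by (rule *[THEN conjunct1, rule_format])
  show "finite X \<Longrightarrow> finite Y \<Longrightarrow> f \<in> injections X Y \<Longrightarrow>
      arr V X Y f \<in> linear_maps R (obj V X) (obj V Y)"
    by (rule *[THEN conjunct2, THEN conjunct1, rule_format])
  show "finite X \<Longrightarrow> finite Y \<Longrightarrow> f \<in> injections X Y \<Longrightarrow> g \<in> injections X Y \<Longrightarrow>
      (\<And>x. x \<in> X \<Longrightarrow> f x = g x) \<Longrightarrow> v \<in> carrier (obj V X) \<Longrightarrow> arr V X Y f v = arr V X Y g v"
    by (rule *[THEN conjunct2, THEN conjunct2, THEN conjunct1, rule_format])
  show "finite X \<Longrightarrow> v \<in> carrier (obj V X) \<Longrightarrow> arr V X X id v = v"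
    by (rule *[THEN conjunct2, THEN conjunct2, THEN conjunct2, THEN conjunct1, rule_format])
  show "finite X \<Longrightarrow> finite Y \<Longrightarrow> finite Z \<Longrightarrow> f \<in> injections X Y \<Longrightarrow>
      g \<in> injections Y Z \<Longrightarrow> v \<in> carrier (obj V X) \<Longrightarrow>
      arr V X Z (g \<circ> f) v = arr V Y Z g (arr V X Y f v)"
    by (rule *[THEN conjunct2, THEN conjunct2, THEN conjunct2, THEN conjunct2, rule_format])
qed

lemma fi_arr_closed:
  "fi_module R V \<Longrightarrow> finite X \<Longrightarrow> finite Y \<Longrightarrow> f \<in> injections X Y \<Longrightarrow> v \<in> carrier (obj V X) \<Longrightarrow>
    arr V X Y f v \<in> carrier (obj V Y)"
  by (rule linear_closed[OF fi_arr])

lemma fi_arr_id_on: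
  assumes "fi_module R V" "finite X" "\<And>x. x \<in> X \<Longrightarrow> f x = x" "v \<in> carrier (obj V X)"
  shows "arr V X X f v = v"
proof -
  have "f \<in> injections X X" using assms(3) by (auto simp: injections_def inj_on_def)
  moreover have "id \<in> injections X X" by (auto simp: injections_def)
  ultimately have "arr V X X f v = arr V X X id v"
    by (rule fi_arr_cong[OF assms(1,2,2) _ _ _ assms(4)]) (simp add: assms(3))
  then show ?thesis using fi_arr_id[OF assms(1,2,4)] by simp
qed

lemma injections_comp: "f \<in> injections X Y \<Longrightarrow> g \<in> injections Y Z \<Longrightarrow> g \<circ> f \<in> injections X Z"
  by (auto simp: injections_def inj_on_def Pi_iff)

text \<open>Morphisms are represented by functions on the whole type, and functions that agree on
  \<open>X\<close> induce the same map. So the triangle is required to commute on the points of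
  \<open>X\<close> only.\<close>

lemma fi_arr_comp_eq':
  assumes V: "fi_module R V" and fin: "finite X" "finite Y" "finite Z"
    and f: "f \<in> injections X Y" and g: "g \<in> injections Y Z" and h: "h \<in> injections X Z"
    and eq: "\<And>x. x \<in> X \<Longrightarrow> g (f x) = h x" and v: "v \<in> carrier (obj V X)"
  shows "arr V Y Z g (arr V X Y f v) = arr V X Z h v"
proof -
  have "arr V X Z (g \<circ> f) v = arr V X Z h v"
    by (rule fi_arr_cong[OF V fin(1,3) injections_comp[OF f g] h _ v]) (simp add: eq)
  then show ?thesis by (simp only: fi_arr_comp[OF V fin f g v])
qed

lemma fi_arr_comp_eq:
  assumes V: "fi_module R V" and fin: "finite X" "finite Y" "finite Y'" "finite Z"
    and f: "f \<in> injections X Y" and g: "g \<in> injections Y Z"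
    and f': "f' \<in> injections X Y'" and g': "g' \<in> injections Y' Z"
    and eq: "\<And>x. x \<in> X \<Longrightarrow> g (f x) = g' (f' x)" and v: "v \<in> carrier (obj V X)"
  shows "arr V Y Z g (arr V X Y f v) = arr V Y' Z g' (arr V X Y' f' v)"
  by (simp only: fi_arr_comp_eq'[OF V fin(1,2,4) f g injections_comp[OF f' g'] _ v]
        fi_arr_comp[OF V fin(1,3,4) f' g' v] eq comp_apply)

lemma fi_homI:
  assumes "fi_module R V" "fi_module R W"
    and "\<And>X. finite X \<Longrightarrow> \<phi> X \<in> linear_maps R (obj V X) (obj W X)"
    and "\<And>X Y f v. finite X \<Longrightarrow> finite Y \<Longrightarrow> f \<in> injections X Y \<Longrightarrow> v \<in> carrier (obj V X) \<Longrightarrow>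
           \<phi> Y (arr V X Y f v) = arr W X Y f (\<phi> X v)"
  shows "fi_hom R V W \<phi>"
  using assms by (simp add: fi_hom_def)

lemma fi_homD:
  assumes "fi_hom R V W \<phi>"
  shows fi_hom_dom: "fi_module R V" and fi_hom_cod: "fi_module R W"
    and fi_hom_linear: "finite X \<Longrightarrow> \<phi> X \<in> linear_maps R (obj V X) (obj W X)"
    and fi_hom_arr: "finite X \<Longrightarrow> finite Y \<Longrightarrow> f \<in> injections X Y \<Longrightarrow> v \<in> carrier (obj V X) \<Longrightarrow>
           \<phi> Y (arr V X Y f v) = arr W X Y f (\<phi> X v)"
  using assms by (simp_all add: fi_hom_def)

lemma fi_hom_ops:
  assumes "fi_hom R V W \<phi>" "finite X"
  shows fi_hom_closed: "v \<in> carrier (obj V X) \<Longrightarrow> \<phi> X v \<in> carrier (obj W X)"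
    and fi_hom_add: "u \<in> carrier (obj V X) \<Longrightarrow> v \<in> carrier (obj V X) \<Longrightarrow>
          \<phi> X (u \<oplus>\<^bsub>obj V X\<^esub> v) = \<phi> X u \<oplus>\<^bsub>obj W X\<^esub> \<phi> X v"
    and fi_hom_smult: "r \<in> carrier R \<Longrightarrow> v \<in> carrier (obj V X) \<Longrightarrow>
          \<phi> X (r \<odot>\<^bsub>obj V X\<^esub> v) = r \<odot>\<^bsub>obj W X\<^esub> \<phi> X v"
    and fi_hom_zero: "\<phi> X \<zero>\<^bsub>obj V X\<^esub> = \<zero>\<^bsub>obj W X\<^esub>"
    and fi_hom_minus: "u \<in> carrier (obj V X) \<Longrightarrow> v \<in> carrier (obj V X) \<Longrightarrow>
          \<phi> X (u \<ominus>\<^bsub>obj V X\<^esub> v) = \<phi> X u \<ominus>\<^bsub>obj W X\<^esub> \<phi> X v"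
proof -
  note l = fi_hom_linear[OF assms] and m = fi_obj[OF fi_hom_dom[OF assms(1)] assms(2)]
    and m' = fi_obj[OF fi_hom_cod[OF assms(1)] assms(2)]
  show "v \<in> carrier (obj V X) \<Longrightarrow> \<phi> X v \<in> carrier (obj W X)" by (rule linear_closed[OF l])
  show "u \<in> carrier (obj V X) \<Longrightarrow> v \<in> carrier (obj V X) \<Longrightarrow>
          \<phi> X (u \<oplus>\<^bsub>obj V X\<^esub> v) = \<phi> X u \<oplus>\<^bsub>obj W X\<^esub> \<phi> X v" by (rule linear_add[OF l])
  show "r \<in> carrier R \<Longrightarrow> v \<in> carrier (obj V X) \<Longrightarrow>
          \<phi> X (r \<odot>\<^bsub>obj V X\<^esub> v) = r \<odot>\<^bsub>obj W X\<^esub> \<phi> X v" by (rule linear_smult[OF l])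
  show "\<phi> X \<zero>\<^bsub>obj V X\<^esub> = \<zero>\<^bsub>obj W X\<^esub>" by (rule linear_zero[OF l m m'])
  show "u \<in> carrier (obj V X) \<Longrightarrow> v \<in> carrier (obj V X) \<Longrightarrow>
          \<phi> X (u \<ominus>\<^bsub>obj V X\<^esub> v) = \<phi> X u \<ominus>\<^bsub>obj W X\<^esub> \<phi> X v" by (rule linear_minus[OF l m m'])
qed

lemma fi_hom_comp:
  fixes U :: "('x, 'k, 'l) fi_mod" and V :: "('x, 'k, 'm) fi_mod" and W :: "('x, 'k, 'n) fi_mod"
  assumes "fi_hom R U V \<phi>" "fi_hom R V W \<psi>"
  shows "fi_hom R U W (\<lambda>X v. \<psi> X (\<phi> X v))"
proof (rule fi_homI)
  show "fi_module R U" "fi_module R W"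
    by (rule fi_hom_dom[OF assms(1)]) (rule fi_hom_cod[OF assms(2)])
  fix X :: "'x set" assume X: "finite X"
  show "(\<lambda>v. \<psi> X (\<phi> X v)) \<in> linear_maps R (obj U X) (obj W X)"
    using X by (intro linear_mapsI) (simp_all add: fi_hom_ops[OF assms(1)] fi_hom_ops[OF assms(2)])
qed (simp add: fi_hom_arr[OF assms(1)] fi_hom_arr[OF assms(2)] fi_hom_closed[OF assms(1)])

lemma fi_hom_id: "fi_module R V \<Longrightarrow> fi_hom R V V (\<lambda>X v. v)"
  by (rule fi_homI) (auto intro!: linear_mapsI)

text \<open>For maps built from \<open>inv_into\<close> or \<open>coset_map\<close>, which have
  their intended values on the carriers only.\<close>

lemma fi_hom_cong:
  fixes V :: "('x, 'k, 'm) fi_mod" and W :: "('x, 'k, 'n) fi_mod"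
  assumes "fi_hom R V W \<phi>" "\<And>X v. finite X \<Longrightarrow> v \<in> carrier (obj V X) \<Longrightarrow> \<psi> X v = \<phi> X v"
  shows "fi_hom R V W \<psi>"
proof (rule fi_homI)
  show m: "fi_module R V" "fi_module R W"
    by (rule fi_hom_dom[OF assms(1)]) (rule fi_hom_cod[OF assms(1)])
  fix X :: "'x set" assume X: "finite X"
  interpret module R "obj V X" using fi_obj[OF m(1) X] .
  show "\<psi> X \<in> linear_maps R (obj V X) (obj W X)"
    using X by (intro linear_mapsI) (simp_all add: fi_hom_ops[OF assms(1)] assms(2))
qed (use assms(2) in \<open>simp add: fi_hom_arr[OF assms(1)] fi_arr_closed[OF fi_hom_dom[OF assms(1)]]\<close>)

lemma fi_hom_diff:
  fixes V :: "('x, 'k, 'm) fi_mod" and W :: "('x, 'k, 'n) fi_mod"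
  assumes "fi_hom R V W \<phi>" "fi_hom R V W \<psi>"
  shows "fi_hom R V W (\<lambda>X v. \<phi> X v \<ominus>\<^bsub>obj W X\<^esub> \<psi> X v)"
proof (rule fi_homI)
  show m: "fi_module R V" "fi_module R W"
    by (rule fi_hom_dom[OF assms(1)]) (rule fi_hom_cod[OF assms(1)])
  fix X :: "'x set" assume X: "finite X"
  interpret W: module R "obj W X" using fi_obj[OF m(2) X] .
  show "(\<lambda>v. \<phi> X v \<ominus>\<^bsub>obj W X\<^esub> \<psi> X v) \<in> linear_maps R (obj V X) (obj W X)"
    using X by (intro linear_mapsI)
      (simp_all add: fi_hom_ops[OF assms(1)] fi_hom_ops[OF assms(2)] a_minus_def W.minus_add
        W.a_ac W.smult_r_distr W.smult_r_minus)
  fix Y f v assume *: "finite Y" "f \<in> injections X Y" "v \<in> carrier (obj V X)"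
  show "\<phi> Y (arr V X Y f v) \<ominus>\<^bsub>obj W Y\<^esub> \<psi> Y (arr V X Y f v) =
     arr W X Y f (\<phi> X v \<ominus>\<^bsub>obj W X\<^esub> \<psi> X v)"
    using * X linear_minus[OF fi_arr[OF m(2) X *(1,2)]] fi_obj[OF m(2)]
    by (simp add: fi_hom_ops[OF assms(1)] fi_hom_ops[OF assms(2)] fi_hom_arr[OF assms(1)]
         fi_hom_arr[OF assms(2)])
qed

text \<open>The functor laws, like the module laws, are equations and pass along the surjection.
  That \<open>W\<close> is an FI-module is part of the conclusion \<open>fi_epi\<close>.\<close>

lemma fi_module_surj_image:
  fixes V :: "('x, 'k, 'm) fi_mod" and W :: "('x, 'k, 'n) fi_mod"
  assumes V: "fi_module R V"
    and carr: "\<And>X. finite X \<Longrightarrow> carrier (obj W X) = \<pi> X ` carrier (obj V X)"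
    and add: "\<And>X u v. finite X \<Longrightarrow> u \<in> carrier (obj V X) \<Longrightarrow> v \<in> carrier (obj V X) \<Longrightarrow>
        \<pi> X u \<oplus>\<^bsub>obj W X\<^esub> \<pi> X v = \<pi> X (u \<oplus>\<^bsub>obj V X\<^esub> v)"
    and smult: "\<And>X r v. finite X \<Longrightarrow> r \<in> carrier R \<Longrightarrow> v \<in> carrier (obj V X) \<Longrightarrow>
        r \<odot>\<^bsub>obj W X\<^esub> \<pi> X v = \<pi> X (r \<odot>\<^bsub>obj V X\<^esub> v)"
    and zero: "\<And>X. finite X \<Longrightarrow> \<zero>\<^bsub>obj W X\<^esub> = \<pi> X \<zero>\<^bsub>obj V X\<^esub>"
    and arr: "\<And>X Y f v. finite X \<Longrightarrow> finite Y \<Longrightarrow> f \<in> injections X Y \<Longrightarrow> v \<in> carrier (obj V X) \<Longrightarrow>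
        arr W X Y f (\<pi> X v) = \<pi> Y (arr V X Y f v)"
  shows "fi_epi R V W \<pi>"
proof -
  have W: "fi_module R W"
  proof (rule fi_moduleI)
    fix X :: "'x set" assume X: "finite X"
    show "module R (obj W X)"
      by (rule module_surj_image[OF fi_obj[OF V X], of _ "\<pi> X"]) (use X carr add smult zero in auto)
  next
    fix X Y :: "'x set" and f assume *: "finite X" "finite Y" "f \<in> injections X Y"
    interpret V: module R "obj V X" using fi_obj[OF V] * by simp
    note l = fi_arr[OF V *]
    show "arr W X Y f \<in> linear_maps R (obj W X) (obj W Y)"
      using * by (intro linear_mapsI)
        (auto simp: carr arr add smult linear_closed[OF l] linear_add[OF l] linear_smult[OF l])
  next
    fix X Y :: "'x set" and f g v
    assume *: "finite X" "finite Y" "f \<in> injections X Y" "g \<in> injections X Y"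
      and eq: "\<And>x. x \<in> X \<Longrightarrow> f x = g x" and "v \<in> carrier (obj W X)"
    then obtain u where u: "v = \<pi> X u" "u \<in> carrier (obj V X)" by (auto simp: carr)
    then show "arr W X Y f v = arr W X Y g v"
      using fi_arr_cong[OF V * eq u(2)] * by (simp add: arr)
  next
    fix X Y Z :: "'x set" and f g v
    assume "finite X" "finite Y" "finite Z" "f \<in> injections X Y" "g \<in> injections Y Z"
      "v \<in> carrier (obj W X)"
    then show "arr W X Z (g \<circ> f) v = arr W Y Z g (arr W X Y f v)"
      by (auto simp: carr arr fi_arr_comp[OF V] fi_arr_closed[OF V] injections_comp)
  next
    fix X :: "'x set" and v assume "finite X" "v \<in> carrier (obj W X)"
    moreover have "id \<in> injections X X" by (auto simp: injections_def)
    ultimately show "arr W X X id v = v" by (auto simp: carr arr fi_arr_id[OF V])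
  qed
  have "fi_hom R V W \<pi>"
    by (rule fi_homI[OF V W]) (auto intro!: linear_mapsI simp: carr add smult arr)
  then show ?thesis by (simp add: fi_epi_def carr)
qed

lemma fi_epiD:
  assumes "fi_epi R V W \<phi>"
  shows fi_epi_hom: "fi_hom R V W \<phi>"
    and fi_epi_surj: "finite X \<Longrightarrow> \<phi> X ` carrier (obj V X) = carrier (obj W X)"
  using assms by (auto simp: fi_epi_def)

lemma fi_epi_comp:
  assumes "fi_epi R U V \<phi>" "fi_epi R V W \<psi>"
  shows "fi_epi R U W (\<lambda>X v. \<psi> X (\<phi> X v))"
proof -
  have "(\<lambda>v. \<psi> X (\<phi> X v)) ` carrier (obj U X) = carrier (obj W X)" if "finite X" for X
    using fi_epi_surj[OF assms(1) that] fi_epi_surj[OF assms(2) that] by (metis image_image)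
  then show ?thesis
    using fi_hom_comp[OF fi_epi_hom[OF assms(1)] fi_epi_hom[OF assms(2)]] by (simp add: fi_epi_def)
qed


subsection \<open>Submodules and quotients\<close>

definition fi_submodule ::
  "('k, 'r) ring_scheme \<Rightarrow> ('x, 'k, 'm) fi_mod \<Rightarrow> ('x set \<Rightarrow> 'm set) \<Rightarrow> bool" where
  "fi_submodule R V N \<longleftrightarrow>
     (\<forall>X. finite X \<longrightarrow> submodule (N X) R (obj V X)) \<and>
     (\<forall>X Y. finite X \<longrightarrow> finite Y \<longrightarrow> (\<forall>f \<in> injections X Y. \<forall>v \<in> N X. arr V X Y f v \<in> N Y))"

lemma fi_submoduleD:
  assumes "fi_submodule R V N"
  shows fi_submodule_obj: "finite X \<Longrightarrow> submodule (N X) R (obj V X)"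
    and fi_submodule_arr: "finite X \<Longrightarrow> finite Y \<Longrightarrow> f \<in> injections X Y \<Longrightarrow> v \<in> N X \<Longrightarrow>
      arr V X Y f v \<in> N Y"
    and fi_submodule_closed: "finite X \<Longrightarrow> v \<in> N X \<Longrightarrow> v \<in> carrier (obj V X)"
  using assms by (auto simp: fi_submodule_def dest: submodule_closed)

lemma fi_sub_simps [simp]:
  "carrier (obj (fi_sub V N) X) = N X"
  "add (obj (fi_sub V N) X) = add (obj V X)"
  "zero (obj (fi_sub V N) X) = zero (obj V X)"
  "smult (obj (fi_sub V N) X) = smult (obj V X)"
  "arr (fi_sub V N) = arr V"
  by (simp_all add: fi_sub_def)

lemma fi_module_sub:
  fixes V :: "('x, 'k, 'm) fi_mod"
  assumes V: "fi_module R V" and N: "fi_submodule R V N"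
  shows "fi_module R (fi_sub V N)"
proof (rule fi_moduleI)
  fix X :: "'x set" assume X: "finite X"
  show "module R (obj (fi_sub V N) X)"
    using submodule.submodule_is_module[OF fi_submodule_obj[OF N X] fi_obj[OF V X]]
    by (simp add: fi_sub_def)
next
  fix X Y :: "'x set" and f assume *: "finite X" "finite Y" "f \<in> injections X Y"
  note l = fi_arr[OF V *]
  show "arr (fi_sub V N) X Y f \<in> linear_maps R (obj (fi_sub V N) X) (obj (fi_sub V N) Y)"
    using * by (intro linear_mapsI)
      (auto simp: fi_submodule_arr[OF N] fi_submodule_closed[OF N] linear_add[OF l] linear_smult[OF l])
next
  fix X Y :: "'x set" and f g v
  assume *: "finite X" "finite Y" "f \<in> injections X Y" "g \<in> injections X Y"
    and eq: "\<And>x. x \<in> X \<Longrightarrow> f x = g x" and v: "v \<in> carrier (obj (fi_sub V N) X)"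
  have "v \<in> carrier (obj V X)" using v *(1) by (simp add: fi_submodule_closed[OF N])
  from fi_arr_cong[OF V * eq this] show "arr (fi_sub V N) X Y f v = arr (fi_sub V N) X Y g v" by simp
qed (simp_all add: fi_arr_id[OF V] fi_arr_comp[OF V] fi_submodule_closed[OF N])

lemma fi_hom_to_sub:
  assumes "fi_hom R U V \<phi>" "fi_submodule R V N"
    and "\<And>X v. finite X \<Longrightarrow> v \<in> carrier (obj U X) \<Longrightarrow> \<phi> X v \<in> N X"
  shows "fi_hom R U (fi_sub V N) \<phi>"
  using assms by (intro fi_homI fi_module_sub[OF fi_hom_cod[OF assms(1)]] linear_mapsI)
    (simp_all add: fi_hom_ops[OF assms(1)] fi_hom_arr[OF assms(1)] fi_hom_dom[OF assms(1)])

lemma fi_hom_from_sub: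
  assumes "fi_hom R V W \<phi>" "fi_submodule R V N"
  shows "fi_hom R (fi_sub V N) W \<phi>"
  using assms by (intro fi_homI fi_module_sub[OF fi_hom_dom[OF assms(1)]] linear_mapsI)
    (simp_all add: fi_hom_ops[OF assms(1)] fi_hom_arr[OF assms(1)] fi_hom_cod[OF assms(1)]
      fi_submodule_closed[OF assms(2)])

lemma fi_submodule_preimage:
  assumes "fi_hom R V W \<phi>" "fi_submodule R W N"
  shows "fi_submodule R V (\<lambda>X. {v \<in> carrier (obj V X). \<phi> X v \<in> N X})"
  unfolding fi_submodule_def
  using submodule_preimage[OF fi_hom_linear[OF assms(1)] fi_obj[OF fi_hom_dom[OF assms(1)]]
      fi_obj[OF fi_hom_cod[OF assms(1)]] fi_submodule_obj[OF assms(2)]]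
  by (auto simp: fi_hom_arr[OF assms(1)] fi_arr_closed[OF fi_hom_dom[OF assms(1)]]
        fi_submodule_arr[OF assms(2)])

lemma fi_submodule_zero:
  assumes "fi_module R V"
  shows "fi_submodule R V (\<lambda>X. {\<zero>\<^bsub>obj V X\<^esub>})"
  unfolding fi_submodule_def
  using submodule_zero_set[OF fi_obj[OF assms]] linear_zero[OF fi_arr[OF assms]] fi_obj[OF assms]
  by auto

lemma fi_submodule_kernel:
  assumes "fi_hom R V W \<phi>"
  shows "fi_submodule R V (fi_kernel V W \<phi>)"
  using fi_submodule_preimage[OF assms fi_submodule_zero[OF fi_hom_cod[OF assms]]]
  by (simp add: fi_kernel_def[abs_def])

lemma fi_submodule_carrier:
  assumes "fi_module R V"
  shows "fi_submodule R V (\<lambda>X. carrier (obj V X))"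
  unfolding fi_submodule_def
  using module.carrier_is_submodule[OF fi_obj[OF assms]] fi_arr_closed[OF assms] by auto

lemma fi_submodule_image:
  fixes V :: "('x, 'k, 'm) fi_mod" and W :: "('x, 'k, 'n) fi_mod"
  assumes "fi_hom R V W \<phi>" "fi_submodule R V N"
  shows "fi_submodule R W (\<lambda>X. \<phi> X ` N X)"
  unfolding fi_submodule_def
proof (intro conjI allI impI ballI)
  fix X :: "'x set" assume "finite X"
  then show "submodule (\<phi> X ` N X) R (obj W X)"
    using submodule_image[OF fi_hom_linear[OF assms(1)] fi_obj[OF fi_hom_dom[OF assms(1)]]
      fi_obj[OF fi_hom_cod[OF assms(1)]] fi_submodule_obj[OF assms(2)]] by blast
next
  fix X Y :: "'x set" and f w
  assume *: "finite X" "finite Y" "f \<in> injections X Y" "w \<in> \<phi> X ` N X"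
  then obtain v where v: "v \<in> N X" "w = \<phi> X v" by auto
  then have "arr W X Y f w = \<phi> Y (arr V X Y f v)"
    using fi_hom_arr[OF assms(1) *(1-3), of v] fi_submodule_closed[OF assms(2) *(1)] by simp
  then show "arr W X Y f w \<in> \<phi> Y ` N Y"
    using fi_submodule_arr[OF assms(2) *(1-3) v(1)] by simp
qed

lemma fi_epi_image:
  assumes "fi_hom R V W \<phi>"
  shows "fi_epi R V (fi_sub W (\<lambda>X. \<phi> X ` carrier (obj V X))) \<phi>"
  unfolding fi_epi_def
  using fi_hom_to_sub[OF assms fi_submodule_image[OF assms fi_submodule_carrier[OF fi_hom_dom[OF assms]]]]
  by simp

section \<open>Cosets, quotients and the homomorphism theorem\<close>

lemma abelian_subgroup_of_submodule:
  assumes "module R M" "submodule N R M"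
  shows "abelian_subgroup N M"
proof -
  interpret M: module R M by fact
  show ?thesis
    by (rule abelian_subgroupI3) (auto intro!: additive_subgroupI submodule.axioms assms M.abelian_group_axioms)
qed

lemma coset_eq_iff:
  assumes "module R M" "submodule N R M" "u \<in> carrier M" "v \<in> carrier M"
  shows "N +>\<^bsub>M\<^esub> u = N +>\<^bsub>M\<^esub> v \<longleftrightarrow> u \<ominus>\<^bsub>M\<^esub> v \<in> N"
proof -
  interpret M: module R M by fact
  interpret N: abelian_subgroup N M by (rule abelian_subgroup_of_submodule[OF assms(1,2)])
  have "N +>\<^bsub>M\<^esub> u = N +>\<^bsub>M\<^esub> v \<longleftrightarrow> u \<in> N +>\<^bsub>M\<^esub> v"
    using N.a_repr_independence'[of u v] N.a_rcos_self[of u] assms by auto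
  also have "\<dots> \<longleftrightarrow> u \<ominus>\<^bsub>M\<^esub> v \<in> N"
    using N.a_rcos_module[of v u] assms by (simp add: a_minus_def)
  finally show ?thesis .
qed

lemma (in abelian_group) minus_self [simp]: "x \<in> carrier G \<Longrightarrow> x \<ominus> x = \<zero>"
  by (simp add: a_minus_def r_neg)

lemma (in abelian_group) minus_zero_right [simp]: "x \<in> carrier G \<Longrightarrow> x \<ominus> \<zero> = x"
  by (simp add: a_minus_def)

lemma (in abelian_group) minus_eq_zero_iff:
  "x \<in> carrier G \<Longrightarrow> y \<in> carrier G \<Longrightarrow> x \<ominus> y = \<zero> \<longleftrightarrow> x = y"
  by (metis a_minus_def add.inv_closed add.inv_inv minus_equality minus_self)

lemma coset_zero:
  assumes "module R M" "submodule N R M"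
  shows "N +>\<^bsub>M\<^esub> \<zero>\<^bsub>M\<^esub> = N"
proof -
  interpret M: module R M by fact
  show ?thesis using submodule_subset[OF assms(2)] by (rule M.a_coset_add_zero)
qed

lemma coset_eq_self_iff:
  assumes "module R M" "submodule N R M" "u \<in> carrier M"
  shows "N +>\<^bsub>M\<^esub> u = N \<longleftrightarrow> u \<in> N"
proof -
  interpret M: module R M by fact
  show ?thesis
    using coset_eq_iff[OF assms(1,2,3) M.zero_closed] coset_zero[OF assms(1,2)] assms(3)
    by simp
qed

text \<open>Two elements of the coset of \<open>v\<close> differ by some \<open>k\<close> in
  \<open>K\<close>, so their images differ by \<open>g k\<close>, which lies in \<open>N\<close>:
  the union in \<open>coset_map\<close> is a union of equal cosets. Taking \<open>g\<close> additive
  covers scalar multiplications, arrows and homomorphisms alike.\<close>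

lemma coset_map_coset:
  assumes "module R L" "module R M" "submodule K R L" "submodule N R M"
    and g: "\<And>u. u \<in> carrier L \<Longrightarrow> g u \<in> carrier M"
      "\<And>u v. u \<in> carrier L \<Longrightarrow> v \<in> carrier L \<Longrightarrow> g (u \<oplus>\<^bsub>L\<^esub> v) = g u \<oplus>\<^bsub>M\<^esub> g v"
    and gK: "\<And>u. u \<in> K \<Longrightarrow> g u \<in> N" and v: "v \<in> carrier L"
  shows "coset_map M N g (K +>\<^bsub>L\<^esub> v) = N +>\<^bsub>M\<^esub> g v"
proof -
  interpret L: module R L by fact
  interpret M: module R M by fact
  have *: "N +>\<^bsub>M\<^esub> g a = N +>\<^bsub>M\<^esub> g v" if a: "a \<in> K +>\<^bsub>L\<^esub> v" for a
  proof -
    obtain k where k: "k \<in> K" "a = k \<oplus>\<^bsub>L\<^esub> v" using a by (auto simp: a_r_coset_def')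
    have kc: "k \<in> carrier L" using submodule_closed[OF assms(3)] k by auto
    have "g a \<ominus>\<^bsub>M\<^esub> g v = g k"
      using kc v k(2) by (simp add: g a_minus_def M.a_assoc M.r_neg)
    then show ?thesis using coset_eq_iff[OF assms(2,4), of "g a" "g v"] kc v k gK g by simp
  qed
  have "\<zero>\<^bsub>L\<^esub> \<oplus>\<^bsub>L\<^esub> v \<in> K +>\<^bsub>L\<^esub> v" using submodule_zero[OF assms(3)] unfolding a_r_coset_def' by blast
  then show ?thesis unfolding coset_map_def using * by blast
qed

lemma fi_quotient_simps [simp]:
  "carrier (obj (fi_quotient V N) X) = a_rcosets\<^bsub>obj V X\<^esub> (N X)"
  "add (obj (fi_quotient V N) X) = set_add (obj V X)"
  "zero (obj (fi_quotient V N) X) = N X"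
  "smult (obj (fi_quotient V N) X) r = coset_map (obj V X) (N X) (\<lambda>v. r \<odot>\<^bsub>obj V X\<^esub> v)"
  "arr (fi_quotient V N) X Y f = coset_map (obj V Y) (N Y) (arr V X Y f)"
  by (simp_all add: fi_quotient_def quotient_module_def)

text \<open>The quotient is the image of \<open>V\<close> under the coset map, so
  \<open>fi_module_surj_image\<close> supplies its structure and the epimorphism together.\<close>

lemma fi_epi_quotient:
  fixes V :: "('x, 'k, 'm) fi_mod"
  assumes V: "fi_module R V" and N: "fi_submodule R V N"
  shows "fi_epi R V (fi_quotient V N) (\<lambda>X v. N X +>\<^bsub>obj V X\<^esub> v)"
proof (rule fi_module_surj_image[OF V])
  fix X :: "'x set" assume X: "finite X"
  note m = fi_obj[OF V X] and s = fi_submodule_obj[OF N X]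
  interpret M: module R "obj V X" by (rule m)
  interpret S: abelian_subgroup "N X" "obj V X" by (rule abelian_subgroup_of_submodule[OF m s])
  show "carrier (obj (fi_quotient V N) X) = (\<lambda>v. N X +>\<^bsub>obj V X\<^esub> v) ` carrier (obj V X)"
    by (auto simp: A_RCOSETS_def')
  show "\<zero>\<^bsub>obj (fi_quotient V N) X\<^esub> = N X +>\<^bsub>obj V X\<^esub> \<zero>\<^bsub>obj V X\<^esub>"
    by (simp add: coset_zero[OF m s])
  fix u v assume "u \<in> carrier (obj V X)" "v \<in> carrier (obj V X)"
  then show "(N X +>\<^bsub>obj V X\<^esub> u) \<oplus>\<^bsub>obj (fi_quotient V N) X\<^esub> (N X +>\<^bsub>obj V X\<^esub> v) =
      N X +>\<^bsub>obj V X\<^esub> (u \<oplus>\<^bsub>obj V X\<^esub> v)"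
    by (simp add: S.a_rcos_sum)
next
  fix X :: "'x set" and r v assume *: "finite X" "r \<in> carrier R" "v \<in> carrier (obj V X)"
  note m = fi_obj[OF V *(1)] and s = fi_submodule_obj[OF N *(1)]
  interpret M: module R "obj V X" by (rule m)
  show "r \<odot>\<^bsub>obj (fi_quotient V N) X\<^esub> (N X +>\<^bsub>obj V X\<^esub> v) = N X +>\<^bsub>obj V X\<^esub> (r \<odot>\<^bsub>obj V X\<^esub> v)"
    using * by (simp add: coset_map_coset[OF m m s s] M.smult_r_distr submodule.smult_closed[OF s])
next
  fix X Y :: "'x set" and f v
  assume *: "finite X" "finite Y" "f \<in> injections X Y" "v \<in> carrier (obj V X)"
  note l = fi_arr[OF V *(1-3)]
  show "arr (fi_quotient V N) X Y f (N X +>\<^bsub>obj V X\<^esub> v) = N Y +>\<^bsub>obj V Y\<^esub> (arr V X Y f v)"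
    unfolding fi_quotient_simps
    by (rule coset_map_coset[OF fi_obj[OF V *(1)] fi_obj[OF V *(2)] fi_submodule_obj[OF N *(1)]
          fi_submodule_obj[OF N *(2)] linear_closed[OF l] linear_add[OF l]
          fi_submodule_arr[OF N *(1-3)] *(4)])
qed

lemma fi_quotient_map_coset:
  assumes \<phi>: "fi_hom R V W \<phi>" and M: "fi_submodule R V M" and N: "fi_submodule R W N"
    and \<phi>N: "\<And>v. v \<in> M X \<Longrightarrow> \<phi> X v \<in> N X" and X: "finite X" and v: "v \<in> carrier (obj V X)"
  shows "fi_quotient_map W N \<phi> X (M X +>\<^bsub>obj V X\<^esub> v) = N X +>\<^bsub>obj W X\<^esub> \<phi> X v"
  unfolding fi_quotient_map_def
  by (rule coset_map_coset[OF fi_obj[OF fi_hom_dom[OF \<phi>] X] fi_obj[OF fi_hom_cod[OF \<phi>] X]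
        fi_submodule_obj[OF M X] fi_submodule_obj[OF N X] fi_hom_closed[OF \<phi> X]
        fi_hom_add[OF \<phi> X] \<phi>N v])

text \<open>The homomorphism theorem, for an arbitrary epimorphism \<pi> in place of a quotient map,
  because homology will be reached from representatives by such a \<pi>. The maps \<theta> and
  \<delta> of the long exact sequence are obtained from it.\<close>

lemma fi_hom_factor:
  fixes A :: "('x, 'k, 'a) fi_mod" and H :: "('x, 'k, 'h) fi_mod" and W :: "('x, 'k, 'w) fi_mod"
  assumes \<pi>: "fi_epi R A H \<pi>" and \<phi>: "fi_hom R A W \<phi>"
    and ker: "\<And>X v. finite X \<Longrightarrow> v \<in> carrier (obj A X) \<Longrightarrow> \<pi> X v = \<zero>\<^bsub>obj H X\<^esub> \<Longrightarrow> \<phi> X v = \<zero>\<^bsub>obj W X\<^esub>"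
  shows "\<exists>\<psi>. fi_hom R H W \<psi> \<and> (\<forall>X. finite X \<longrightarrow> (\<forall>v \<in> carrier (obj A X). \<psi> X (\<pi> X v) = \<phi> X v))"
proof -
  note h = fi_epi_hom[OF \<pi>]
  note A = fi_hom_dom[OF h] and H = fi_hom_cod[OF h] and W = fi_hom_cod[OF \<phi>]
  \<comment> \<open>The value is computed on an arbitrary preimage. Two preimages differ by an
    element of the kernel of \<pi>, on which \<phi> vanishes.\<close>
  define \<psi> where "\<psi> X c = \<phi> X (inv_into (carrier (obj A X)) (\<pi> X) c)" for X c
  have eq: "\<psi> X (\<pi> X v) = \<phi> X v" if X: "finite X" and v: "v \<in> carrier (obj A X)" for X v
  proof -
    interpret AX: module R "obj A X" by (rule fi_obj[OF A X])
    interpret HX: module R "obj H X" by (rule fi_obj[OF H X])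
    interpret WX: module R "obj W X" by (rule fi_obj[OF W X])
    let ?u = "inv_into (carrier (obj A X)) (\<pi> X) (\<pi> X v)"
    have im: "\<pi> X v \<in> \<pi> X ` carrier (obj A X)" using v by simp
    have u: "?u \<in> carrier (obj A X)" "\<pi> X ?u = \<pi> X v"
      using inv_into_into[OF im] f_inv_into_f[OF im] by auto
    have "\<phi> X (?u \<ominus>\<^bsub>obj A X\<^esub> v) = \<zero>\<^bsub>obj W X\<^esub>"
      using u v by (intro ker[OF X]) (simp_all add: fi_hom_minus[OF h X] fi_hom_closed[OF h X])
    then show ?thesis
      using u v unfolding \<psi>_def
      by (simp add: fi_hom_minus[OF \<phi> X] fi_hom_closed[OF \<phi> X] WX.minus_eq_zero_iff)
  qed
  have ex: "\<exists>v \<in> carrier (obj A X). c = \<pi> X v" if "finite X" "c \<in> carrier (obj H X)" for X c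
    using that fi_epi_surj[OF \<pi> that(1)] by blast
  have "fi_hom R H W \<psi>"
  proof (rule fi_homI[OF H W linear_mapsI])
    fix X :: "'x set" and c assume X: "finite X" and c: "c \<in> carrier (obj H X)"
    interpret AX: module R "obj A X" by (rule fi_obj[OF A X])
    obtain v where v: "v \<in> carrier (obj A X)" "c = \<pi> X v" using ex[OF X c] by blast
    show "\<psi> X c \<in> carrier (obj W X)" using v by (simp add: eq[OF X] fi_hom_closed[OF \<phi> X])
    show "\<psi> X (r \<odot>\<^bsub>obj H X\<^esub> c) = r \<odot>\<^bsub>obj W X\<^esub> \<psi> X c" if r: "r \<in> carrier R" for r
      using v r
      by (simp only: fi_hom_smult[OF h X, symmetric] eq[OF X] AX.smult_closed fi_hom_smult[OF \<phi> X])
    fix c' assume c': "c' \<in> carrier (obj H X)"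
    obtain v' where v': "v' \<in> carrier (obj A X)" "c' = \<pi> X v'" using ex[OF X c'] by blast
    show "\<psi> X (c \<oplus>\<^bsub>obj H X\<^esub> c') = \<psi> X c \<oplus>\<^bsub>obj W X\<^esub> \<psi> X c'"
      using v v'
      by (simp only: fi_hom_add[OF h X, symmetric] eq[OF X] AX.a_closed fi_hom_add[OF \<phi> X])
  next
    fix X Y :: "'x set" and f c
    assume *: "finite X" "finite Y" "f \<in> injections X Y" and c: "c \<in> carrier (obj H X)"
    obtain v where v: "v \<in> carrier (obj A X)" "c = \<pi> X v" using ex[OF *(1) c] by blast
    show "\<psi> Y (arr H X Y f c) = arr W X Y f (\<psi> X c)"
      using v(1) unfolding v(2)
      by (simp only: fi_hom_arr[OF h *, symmetric] eq[OF *(2)] eq[OF *(1)] fi_arr_closed[OF A *]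
          fi_hom_arr[OF \<phi> *])
  qed
  then show ?thesis using eq by blast
qed

lemma fi_hom_quotient_map:
  fixes V :: "('x, 'k, 'm) fi_mod" and W :: "('x, 'k, 'n) fi_mod"
  assumes \<phi>: "fi_hom R V W \<phi>" and M: "fi_submodule R V M" and N: "fi_submodule R W N"
    and \<phi>N: "\<And>X v. finite X \<Longrightarrow> v \<in> M X \<Longrightarrow> \<phi> X v \<in> N X"
  shows "fi_hom R (fi_quotient V M) (fi_quotient W N) (fi_quotient_map W N \<phi>)"
proof -
  note V = fi_hom_dom[OF \<phi>] and W = fi_hom_cod[OF \<phi>]
  note eV = fi_epi_quotient[OF V M] and eW = fi_epi_quotient[OF W N]
  have h: "fi_hom R V (fi_quotient W N) (\<lambda>X v. N X +>\<^bsub>obj W X\<^esub> \<phi> X v)"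
    by (rule fi_hom_comp[OF \<phi> fi_epi_hom[OF eW]])
  have "N X +>\<^bsub>obj W X\<^esub> \<phi> X v = \<zero>\<^bsub>obj (fi_quotient W N) X\<^esub>"
    if X: "finite X" and v: "v \<in> carrier (obj V X)"
      and z: "M X +>\<^bsub>obj V X\<^esub> v = \<zero>\<^bsub>obj (fi_quotient V M) X\<^esub>" for X v
    using z coset_eq_self_iff[OF fi_obj[OF V X] fi_submodule_obj[OF M X] v] \<phi>N[OF X]
      coset_eq_self_iff[OF fi_obj[OF W X] fi_submodule_obj[OF N X] fi_hom_closed[OF \<phi> X v]] by simp
  from fi_hom_factor[OF eV h this] obtain \<psi> where \<psi>: "fi_hom R (fi_quotient V M) (fi_quotient W N) \<psi>"
    "\<And>X v. finite X \<Longrightarrow> v \<in> carrier (obj V X) \<Longrightarrow> \<psi> X (M X +>\<^bsub>obj V X\<^esub> v) = N X +>\<^bsub>obj W X\<^esub> \<phi> X v"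
    by blast
  show ?thesis
  proof (rule fi_hom_cong[OF \<psi>(1)])
    fix X :: "'x set" and c assume X: "finite X" and "c \<in> carrier (obj (fi_quotient V M) X)"
    then obtain v where v: "v \<in> carrier (obj V X)" "c = M X +>\<^bsub>obj V X\<^esub> v"
      using fi_epi_surj[OF eV X] by blast
    show "fi_quotient_map W N \<phi> X c = \<psi> X c"
      unfolding v(2) \<psi>(2)[OF X v(1)] by (rule fi_quotient_map_coset[OF \<phi> M N \<phi>N[OF X] X v(1)])
  qed
qed


subsection \<open>Transport of structure along injections\<close>

text \<open>The structure of \<open>V\<close> moved to another element type. Projectivity refers to
  a fixed element type, and modules of functions have to be brought into it.\<close>

definition fi_transport :: "('x set \<Rightarrow> 'm \<Rightarrow> 'n) \<Rightarrow> ('x, 'k, 'm) fi_mod \<Rightarrow> ('x, 'k, 'n) fi_mod" where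
  "fi_transport c V =
    (let d = (\<lambda>X. inv_into (carrier (obj V X)) (c X)) in
     \<lparr>obj = (\<lambda>X.
        \<lparr>carrier = c X ` carrier (obj V X), mult = undefined, one = undefined,
         zero = c X \<zero>\<^bsub>obj V X\<^esub>, add = (\<lambda>a b. c X (d X a \<oplus>\<^bsub>obj V X\<^esub> d X b)),
         smult = (\<lambda>r a. c X (r \<odot>\<^bsub>obj V X\<^esub> d X a))\<rparr>),
      arr = (\<lambda>X Y f a. c Y (arr V X Y f (d X a)))\<rparr>)"

lemma fi_transport:
  fixes V :: "('x, 'k, 'm) fi_mod" and c :: "'x set \<Rightarrow> 'm \<Rightarrow> 'n"
  assumes V: "fi_module R V" and inj: "\<And>X. finite X \<Longrightarrow> inj_on (c X) (carrier (obj V X))"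
  shows fi_epi_transport: "fi_epi R V (fi_transport c V) c"
    and fi_hom_transport_inv:
      "fi_hom R (fi_transport c V) V (\<lambda>X. inv_into (carrier (obj V X)) (c X))"
proof -
  show epi: "fi_epi R V (fi_transport c V) c"
    using inj by (intro fi_module_surj_image[OF V]) (simp_all add: fi_transport_def Let_def)
  \<comment> \<open>The inverse of \<open>c\<close> is a homomorphism because it is the identity of
    \<open>V\<close> factored through the epimorphism \<open>c\<close>, whose kernel is
    zero.\<close>
  obtain \<psi> where \<psi>: "fi_hom R (fi_transport c V) V \<psi>"
    "\<And>X v. finite X \<Longrightarrow> v \<in> carrier (obj V X) \<Longrightarrow> \<psi> X (c X v) = v"
  proof -
    have "v = \<zero>\<^bsub>obj V X\<^esub>" if "finite X" "v \<in> carrier (obj V X)"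
      "c X v = \<zero>\<^bsub>obj (fi_transport c V) X\<^esub>" for X v
    proof -
      interpret M: module R "obj V X" by (rule fi_obj[OF V that(1)])
      show ?thesis using that inj_onD[OF inj[OF that(1)], of v "\<zero>\<^bsub>obj V X\<^esub>"]
        by (simp add: fi_transport_def Let_def)
    qed
    from fi_hom_factor[OF epi fi_hom_id[OF V] this] that show ?thesis by blast
  qed
  show "fi_hom R (fi_transport c V) V (\<lambda>X. inv_into (carrier (obj V X)) (c X))"
  proof (rule fi_hom_cong[OF \<psi>(1)])
    fix X :: "'x set" and a assume X: "finite X" and a: "a \<in> carrier (obj (fi_transport c V) X)"
    then obtain v where v: "v \<in> carrier (obj V X)" "a = c X v"
      using fi_epi_surj[OF epi X] by blast
    then show "inv_into (carrier (obj V X)) (c X) a = \<psi> X a"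
      using \<psi>(2)[OF X] inv_into_f_f[OF inj[OF X]] by simp
  qed
qed


section \<open>The functor \<open>F\<close> and the homology of \<open>F P\<close>\<close>

lemma fi_J_generators:
  assumes V: "fi_module R V" and X: "finite X"
  shows "(\<Union>Y \<in> {Y. finite Y \<and> card Y < card X}. \<Union>f \<in> injections Y X.
        arr V Y X f ` carrier (obj V Y)) \<subseteq> carrier (obj V X)"
  using fi_arr_closed[OF V _ X] by fastforce

lemma fi_J_submodule_obj:
  assumes "fi_module R V" "finite X"
  shows "submodule (fi_J R V X) R (obj V X)"
  unfolding fi_J_def by (rule submodule_span[OF fi_obj[OF assms] fi_J_generators[OF assms]])

lemma fi_J_I:
  assumes "finite Y" "card Y < card X" "f \<in> injections Y X" "v \<in> carrier (obj V Y)"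
  shows "arr V Y X f v \<in> fi_J R V X"
proof -
  have "arr V Y X f v \<in> (\<Union>Y \<in> {Y. finite Y \<and> card Y < card X}. \<Union>f \<in> injections Y X.
        arr V Y X f ` carrier (obj V Y))" using assms by blast
  then show ?thesis unfolding fi_J_def by (rule subsetD[OF module_span_superset])
qed

text \<open>Facts about \<open>J\<close> are proved by taking for \<open>N\<close> the submodule of
  elements with the desired property, often a preimage, so that only generators are
  inspected.\<close>

lemma fi_J_least:
  assumes "submodule N R (obj V X)"
    and "\<And>Y f v. finite Y \<Longrightarrow> card Y < card X \<Longrightarrow> f \<in> injections Y X \<Longrightarrow> v \<in> carrier (obj V Y) \<Longrightarrow>
        arr V Y X f v \<in> N"
  shows "fi_J R V X \<subseteq> N"
  unfolding fi_J_def using assms(2) by (intro module_span_least[OF assms(1)]) blast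

lemma fi_J_hom:
  fixes V :: "('x, 'k, 'm) fi_mod" and W :: "('x, 'k, 'n) fi_mod"
  assumes \<phi>: "fi_hom R V W \<phi>" and X: "finite X" and v: "v \<in> fi_J R V X"
  shows "\<phi> X v \<in> fi_J R W X"
proof -
  note V = fi_hom_dom[OF \<phi>] and W = fi_hom_cod[OF \<phi>]
  have "fi_J R V X \<subseteq> {v \<in> carrier (obj V X). \<phi> X v \<in> fi_J R W X}"
  proof (rule fi_J_least[OF submodule_preimage[OF fi_hom_linear[OF \<phi> X] fi_obj[OF V X] fi_obj[OF W X]
          fi_J_submodule_obj[OF W X]]])
    fix Y :: "'x set" and f v
    assume *: "finite Y" "card Y < card X" "f \<in> injections Y X" "v \<in> carrier (obj V Y)"
    then show "arr V Y X f v \<in> {v \<in> carrier (obj V X). \<phi> X v \<in> fi_J R W X}"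
      using X by (simp add: fi_hom_arr[OF \<phi>] fi_arr_closed[OF V] fi_J_I fi_hom_closed[OF \<phi>])
  qed
  then show ?thesis using v by blast
qed

lemma injections_card: "f \<in> injections X Y \<Longrightarrow> finite Y \<Longrightarrow> card X \<le> card Y"
  unfolding injections_def by (auto intro: card_inj_on_le[of f])

lemma fi_submodule_J:
  fixes V :: "('x, 'k, 'm) fi_mod"
  assumes V: "fi_module R V"
  shows "fi_submodule R V (fi_J R V)"
  unfolding fi_submodule_def
proof (intro conjI allI impI ballI)
  fix X :: "'x set" assume "finite X"
  then show "submodule (fi_J R V X) R (obj V X)" by (rule fi_J_submodule_obj[OF V])
next
  fix X Y :: "'x set" and f v
  assume X: "finite X" and Y: "finite Y" and f: "f \<in> injections X Y" and v: "v \<in> fi_J R V X"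
  have "fi_J R V X \<subseteq> {v \<in> carrier (obj V X). arr V X Y f v \<in> fi_J R V Y}"
  proof (rule fi_J_least[OF submodule_preimage[OF fi_arr[OF V X Y f] fi_obj[OF V X] fi_obj[OF V Y]
          fi_J_submodule_obj[OF V Y]]])
    fix Z :: "'x set" and g v
    assume *: "finite Z" "card Z < card X" "g \<in> injections Z X" "v \<in> carrier (obj V Z)"
    \<comment> \<open>An injection \<open>X \<rightarrow> Y\<close> gives
      \<open>|X| \<le> |Y|\<close>, so composing a generator at \<open>X\<close> with it yields a
      generator at \<open>Y\<close>.\<close>
    have "card Z < card Y" using injections_card[OF f Y] *(2) by simp
    then show "arr V Z X g v \<in> {v \<in> carrier (obj V X). arr V X Y f v \<in> fi_J R V Y}"
      using * X Y f
      by (simp add: fi_arr_closed[OF V] fi_arr_comp[OF V, symmetric] fi_J_I injections_comp)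
  qed
  then show "arr V X Y f v \<in> fi_J R V Y" using v by blast
qed

lemmas fi_J_closed = fi_submodule_closed[OF fi_submodule_J]

lemma fi_epi_F:
  "fi_module R V \<Longrightarrow> fi_epi R V (fi_F R V) (\<lambda>X v. fi_J R V X +>\<^bsub>obj V X\<^esub> v)"
  unfolding fi_F_def by (rule fi_epi_quotient[OF _ fi_submodule_J])

lemma fi_hom_F_map:
  assumes "fi_hom R V W \<phi>"
  shows "fi_hom R (fi_F R V) (fi_F R W) (fi_F_map R W \<phi>)"
  unfolding fi_F_def fi_F_map_def
  by (rule fi_hom_quotient_map[OF assms fi_submodule_J[OF fi_hom_dom[OF assms]]
        fi_submodule_J[OF fi_hom_cod[OF assms]] fi_J_hom[OF assms]])

lemma fi_F_map_coset:
  assumes "fi_hom R V W \<phi>" "finite X" "v \<in> carrier (obj V X)"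
  shows "fi_F_map R W \<phi> X (fi_J R V X +>\<^bsub>obj V X\<^esub> v) = fi_J R W X +>\<^bsub>obj W X\<^esub> \<phi> X v"
  unfolding fi_F_map_def
  by (rule fi_quotient_map_coset[OF assms(1) fi_submodule_J[OF fi_hom_dom[OF assms(1)]]
        fi_submodule_J[OF fi_hom_cod[OF assms(1)]] fi_J_hom[OF assms(1,2)] assms(2,3)])

lemma fi_F_coset_zero_iff:
  assumes "fi_module R V" "finite X" "v \<in> carrier (obj V X)"
  shows "fi_J R V X +>\<^bsub>obj V X\<^esub> v = \<zero>\<^bsub>obj (fi_F R V) X\<^esub> \<longleftrightarrow> v \<in> fi_J R V X"
  using coset_eq_self_iff[OF fi_obj[OF assms(1,2)] fi_J_submodule_obj[OF assms(1,2)] assms(3)]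
  by (simp add: fi_F_def)

section \<open>The shift functor\<close>

lemma finite_add_point [simp]: "finite X \<Longrightarrow> finite (add_point e X)"
  by (simp add: add_point_def)

lemma mem_add_point: "y \<in> add_point e X \<longleftrightarrow> y = e None \<or> (\<exists>x\<in>X. y = e (Some x))"
  by (auto simp: add_point_def)

lemma card_add_point: "inj e \<Longrightarrow> finite X \<Longrightarrow> card (add_point e X) = Suc (card X)"
  unfolding add_point_def by (subst card_image[OF inj_on_subset]) (auto simp: card_image)

lemma add_point_map_simps:
  assumes "inj e"
  shows "add_point_map e f (e None) = e None" "add_point_map e f (e (Some x)) = e (Some (f x))"
  using assms by (simp_all add: add_point_map_def)

lemma add_point_map_injections:
  assumes "inj e" "f \<in> injections X Y"
  shows "add_point_map e f \<in> injections (add_point e X) (add_point e Y)"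
  using assms(2) inj_eq[OF assms(1)]
  by (auto 0 3 simp: injections_def mem_add_point add_point_map_simps[OF assms(1)] inj_on_def Pi_iff)

lemma some_injections:
  assumes "inj e"
  shows "e \<circ> Some \<in> injections X (add_point e X)"
  using inj_eq[OF assms] by (auto simp: injections_def mem_add_point inj_on_def)

lemma shift_simps [simp]:
  "obj (shift e V) X = obj V (add_point e X)"
  "arr (shift e V) X Y f = arr V (add_point e X) (add_point e Y) (add_point_map e f)"
  by (simp_all add: shift_def)

lemma fi_module_shift:
  fixes V :: "('x, 'k, 'm) fi_mod"
  assumes V: "fi_module R V" and e: "inj e"
  shows "fi_module R (shift e V)"
proof (rule fi_moduleI)
  fix X Y :: "'x set" and f g v
  assume fin: "finite X" "finite Y" and fg: "f \<in> injections X Y" "g \<in> injections X Y"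
    and eq: "\<And>x. x \<in> X \<Longrightarrow> f x = g x" and v: "v \<in> carrier (obj (shift e V) X)"
  show "arr (shift e V) X Y f v = arr (shift e V) X Y g v"
    using v unfolding shift_simps
    by (rule fi_arr_cong[OF V finite_add_point[OF fin(1)] finite_add_point[OF fin(2)]
          add_point_map_injections[OF e fg(1)] add_point_map_injections[OF e fg(2)], rotated])
      (auto simp: mem_add_point add_point_map_simps[OF e] eq)
next
  fix X :: "'x set" and v
  assume "finite X" "v \<in> carrier (obj (shift e V) X)"
  then show "arr (shift e V) X X id v = v"
    unfolding shift_simps
    by (intro fi_arr_id_on[OF V]) (auto simp: mem_add_point add_point_map_simps[OF e])
next
  fix X Y Z :: "'x set" and f g v
  assume fin: "finite X" "finite Y" "finite Z" and fg: "f \<in> injections X Y" "g \<in> injections Y Z"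
    and v: "v \<in> carrier (obj (shift e V) X)"
  show "arr (shift e V) X Z (g \<circ> f) v = arr (shift e V) Y Z g (arr (shift e V) X Y f v)"
    using v unfolding shift_simps
    by (intro fi_arr_comp_eq'[OF V _ _ _ add_point_map_injections[OF e fg(1)]
          add_point_map_injections[OF e fg(2)] add_point_map_injections[OF e injections_comp[OF fg]],
          symmetric] finite_add_point fin)
      (auto simp: mem_add_point add_point_map_simps[OF e])
qed (simp_all add: fi_obj[OF V] fi_arr[OF V] add_point_map_injections[OF e])

lemma fi_hom_shift:
  assumes "fi_hom R V W \<phi>" "inj e"
  shows "fi_hom R (shift e V) (shift e W) (\<lambda>X. \<phi> (add_point e X))"
  by (rule fi_homI[OF fi_module_shift[OF fi_hom_dom[OF assms(1)] assms(2)]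
        fi_module_shift[OF fi_hom_cod[OF assms(1)] assms(2)]])
    (simp_all add: fi_hom_linear[OF assms(1)] fi_hom_arr[OF assms(1)]
      add_point_map_injections[OF assms(2)])

lemma fi_submodule_shift:
  assumes "fi_submodule R V N" "inj e"
  shows "fi_submodule R (shift e V) (\<lambda>X. N (add_point e X))"
  using assms(1) by (simp add: fi_submodule_def add_point_map_injections[OF assms(2)])

lemma fi_epi_shift:
  assumes "fi_epi R V W \<phi>" "inj e"
  shows "fi_epi R (shift e V) (shift e W) (\<lambda>X. \<phi> (add_point e X))"
  using fi_hom_shift[OF fi_epi_hom[OF assms(1)] assms(2)] fi_epi_surj[OF assms(1)]
  by (simp add: fi_epi_def)

lemma fi_exact_shift:
  assumes "fi_exact R U V W \<phi> \<psi>" "inj e"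
  shows "fi_exact R (shift e U) (shift e V) (shift e W)
    (\<lambda>X. \<phi> (add_point e X)) (\<lambda>X. \<psi> (add_point e X))"
  using assms(1)
  by (simp add: fi_exact_def fi_image_def fi_kernel_def fi_hom_shift[OF _ assms(2)])

lemma fi_hom_shift_incl:
  fixes V :: "('x, 'k, 'm) fi_mod"
  assumes V: "fi_module R V" and e: "inj e"
  shows "fi_hom R V (shift e V) (shift_incl e V)"
proof (rule fi_homI[OF V fi_module_shift[OF V e]])
  fix X :: "'x set" assume "finite X"
  then show "shift_incl e V X \<in> linear_maps R (obj V X) (obj (shift e V) X)"
    by (simp add: shift_incl_def fi_arr[OF V] some_injections[OF e])
next
  fix X Y :: "'x set" and f v
  assume *: "finite X" "finite Y" "f \<in> injections X Y" "v \<in> carrier (obj V X)"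
  then show "shift_incl e V Y (arr V X Y f v) = arr (shift e V) X Y f (shift_incl e V X v)"
    unfolding shift_incl_def shift_simps
    by (intro fi_arr_comp_eq[OF V]) (simp_all add: some_injections[OF e]
          add_point_map_injections[OF e] add_point_map_simps[OF e])
qed

lemma shift_incl_natural:
  assumes "fi_hom R V W \<phi>" "inj e" "finite X" "v \<in> carrier (obj V X)"
  shows "\<phi> (add_point e X) (shift_incl e V X v) = shift_incl e W X (\<phi> X v)"
  using assms unfolding shift_incl_def by (simp add: fi_hom_arr[OF assms(1)] some_injections)

text \<open>Adding the point raises both cardinalities by one, so a generator of
  \<open>J (S V)\<close> at \<open>X\<close> is a generator of \<open>J V\<close> at
  \<open>X \<squnion> {\<star>}\<close>. The inclusion induces the map
  \<open>F (S V) \<rightarrow> S (F V)\<close>.\<close>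

lemma fi_J_shift_subset:
  fixes V :: "('x, 'k, 'm) fi_mod"
  assumes V: "fi_module R V" and e: "inj e" and X: "finite X" and v: "v \<in> fi_J R (shift e V) X"
  shows "v \<in> fi_J R V (add_point e X)"
proof -
  note X' = finite_add_point[OF X, of e]
  have "fi_J R (shift e V) X \<subseteq> fi_J R V (add_point e X)"
  proof (rule fi_J_least)
    show "submodule (fi_J R V (add_point e X)) R (obj (shift e V) X)"
      using fi_J_submodule_obj[OF V X'] by simp
  qed (simp add: fi_J_I add_point_map_injections[OF e] card_add_point[OF e X] card_add_point[OF e])
  then show ?thesis using v by blast
qed

text \<open>The source of the inclusion is smaller by one point. Hence the composite
  \<open>F V \<rightarrow> F (S V) \<rightarrow> S (F V)\<close> is zero.\<close>

lemma shift_incl_in_J: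
  assumes e: "inj e" and X: "finite X" and v: "v \<in> carrier (obj V X)"
  shows "shift_incl e V X v \<in> fi_J R V (add_point e X)"
  unfolding shift_incl_def
  by (rule fi_J_I[OF X _ some_injections[OF e] v]) (simp add: card_add_point[OF e X])

text \<open>
  A map \<open>f : Y \<rightarrow> X \<squnion> {\<star>}\<close> with \<open>|Y| \<le> |X|\<close> misses a point: either \<open>\<star>\<close>, and then it factors through
  \<open>X\<close>, or a point of \<open>X\<close>, and then it factors through \<open>Z \<squnion> {\<star>}\<close> for a proper subset \<open>Z\<close> of \<open>X\<close>.
\<close>

lemma fi_J_add_point:
  fixes V :: "('x, 'k, 'm) fi_mod"
  assumes V: "fi_module R V" and e: "inj e" and X: "finite X" and v: "v \<in> fi_J R V (add_point e X)"
  shows "\<exists>j \<in> fi_J R (shift e V) X. \<exists>u \<in> carrier (obj V X).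
    v = j \<oplus>\<^bsub>obj V (add_point e X)\<^esub> shift_incl e V X u"
proof -
  note X' = finite_add_point[OF X, of e]
  note SV = fi_module_shift[OF V e]
  interpret M: module R "obj V (add_point e X)" by (rule fi_obj[OF V X'])
  let ?A = "fi_J R (shift e V) X" and ?B = "shift_incl e V X ` carrier (obj V X)"
  let ?N = "{a \<oplus>\<^bsub>obj V (add_point e X)\<^esub> b | a b. a \<in> ?A \<and> b \<in> ?B}"
  have A: "submodule ?A R (obj V (add_point e X))" using fi_J_submodule_obj[OF SV X] by simp
  have B: "submodule ?B R (obj V (add_point e X))"
    using fi_submodule_obj[OF fi_submodule_image[OF fi_hom_shift_incl[OF V e] fi_submodule_carrier[OF V]] X]
    by simp
  have AN: "a \<in> ?N" if "a \<in> ?A" for a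
    using M.r_zero[OF submodule_closed[OF A that]] that submodule_zero[OF B]
    by (intro CollectI exI[of _ a] exI[of _ "\<zero>\<^bsub>obj V (add_point e X)\<^esub>"]) simp
  have BN: "b \<in> ?N" if "b \<in> ?B" for b
    using M.l_zero[OF submodule_closed[OF B that]] that submodule_zero[OF A]
    by (intro CollectI exI[of _ b] exI[of _ "\<zero>\<^bsub>obj V (add_point e X)\<^esub>"]) simp
  have "fi_J R V (add_point e X) \<subseteq> ?N"
  proof (rule fi_J_least[OF submodule_sum[OF M.module_axioms A B]])
    fix Y :: "'x set" and f v
    assume Y: "finite Y" "card Y < card (add_point e X)" and f: "f \<in> injections Y (add_point e X)"
      and v: "v \<in> carrier (obj V Y)"
    \<comment> \<open>\<tau> undoes \<open>e \<circ> Some\<close>. Its value at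
      \<open>e None\<close> is unspecified, and it is applied only in the case where
      \<open>f\<close> avoids that point.\<close>
    define \<tau> where "\<tau> y = the (inv_into UNIV e y)" for y
    have \<tau>: "\<tau> (e (Some x)) = x" for x using e by (simp add: \<tau>_def)
    have fY: "f y \<in> add_point e X" if "y \<in> Y" for y using f that by (auto simp: injections_def)
    have injf: "inj_on f Y" using f by (simp add: injections_def)
    show "arr V Y (add_point e X) f v \<in> ?N"
    proof (cases "e None \<in> f ` Y")
      case False
      have fS: "\<exists>x\<in>X. f y = e (Some x)" if "y \<in> Y" for y
        using fY[OF that] False that by (metis imageI mem_add_point)
      have fS': "\<tau> (f y) \<in> X" "e (Some (\<tau> (f y))) = f y" if y: "y \<in> Y" for y
      proof -
        obtain x where "x \<in> X" "f y = e (Some x)" using fS[OF y] by blast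
        then show "\<tau> (f y) \<in> X" "e (Some (\<tau> (f y))) = f y" by (simp_all only: \<tau>)
      qed
      have "inj_on (\<tau> \<circ> f) Y"
      proof (rule inj_onI)
        fix y y' assume y: "y \<in> Y" "y' \<in> Y" "(\<tau> \<circ> f) y = (\<tau> \<circ> f) y'"
        then have "f y = f y'"
          by (subst (1 2) fS'(2)[symmetric]) (simp_all only: comp_apply)
        then show "y = y'" using inj_onD[OF injf] y by blast
      qed
      then have 1: "\<tau> \<circ> f \<in> injections Y X" using fS' by (simp add: injections_def)
      have "shift_incl e V X (arr V Y X (\<tau> \<circ> f) v) = arr V Y (add_point e X) f v"
        unfolding shift_incl_def
        by (rule fi_arr_comp_eq'[OF V Y(1) X X' 1 some_injections[OF e] f _ v]) (simp add: fS'(2))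
      moreover have "shift_incl e V X (arr V Y X (\<tau> \<circ> f) v) \<in> ?B"
        by (rule imageI[OF fi_arr_closed[OF V Y(1) X 1 v]])
      ultimately show ?thesis using BN by simp
    next
      case True
      \<comment> \<open>\<open>Z\<close> consists of the points of \<open>X\<close> that
        \<open>f\<close> hits, so \<open>f\<close> maps \<open>Y\<close> onto \<open>Z\<close> with
        the point added. Counting gives \<open>|Z| + 1 = |Y| \<le> |X|\<close>, hence the strict
        inequality \<open>|Z| < |X|\<close> that makes this a generator of
        \<open>J (S V)\<close>.\<close>
      define Z where "Z = {x \<in> X. e (Some x) \<in> f ` Y}"
      have Z: "finite Z" using X by (simp add: Z_def)
      have fYZ: "f y \<in> add_point e Z" if "y \<in> Y" for y
        using fY[OF that] imageI[OF that, of f] by (auto simp: mem_add_point Z_def)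
      then have 1: "f \<in> injections Y (add_point e Z)" using injf by (simp add: injections_def)
      have "f ` Y = add_point e Z"
        using fYZ True by (auto simp: mem_add_point Z_def)
      then have "card (add_point e Z) = card Y" using card_image[OF injf] by simp
      then have cZ: "card Z < card X" using Y(2) by (simp add: card_add_point[OF e X] card_add_point[OF e Z])
      have i: "id \<in> injections Z X" by (auto simp: injections_def Z_def)
      have "arr (shift e V) Z X id (arr V Y (add_point e Z) f v) = arr V Y (add_point e X) f v"
        unfolding shift_simps
      proof (rule fi_arr_comp_eq'[OF V Y(1) finite_add_point[OF Z] X' 1 add_point_map_injections[OF e i] f _ v])
        fix y assume "y \<in> Y"
        from fYZ[OF this] show "add_point_map e id (f y) = f y"
          by (auto simp: mem_add_point add_point_map_simps[OF e])
      qed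
      moreover have "arr (shift e V) Z X id (arr V Y (add_point e Z) f v) \<in> ?A"
        using fi_arr_closed[OF V Y(1) finite_add_point[OF Z] 1 v] by (intro fi_J_I[OF Z cZ i]) simp
      ultimately show ?thesis using AN by simp
    qed
  qed
  then show ?thesis using v by blast
qed


section \<open>Coinduction, the right adjoint of the shift\<close>

text \<open>The record is spelled out so that it matches the objects of \<open>coind\<close> after
  unfolding. The laws hold componentwise, and for extensional functions componentwise equality is
  equality.\<close>

lemma module_PiE:
  assumes R: "cring R" and M: "\<And>i. i \<in> I \<Longrightarrow> module R (M i)"
  shows "module R \<lparr>carrier = (\<Pi>\<^sub>E i\<in>I. carrier (M i)), mult = undefined, one = undefined,
    zero = (\<lambda>i\<in>I. \<zero>\<^bsub>M i\<^esub>), add = (\<lambda>a b. \<lambda>i\<in>I. a i \<oplus>\<^bsub>M i\<^esub> b i),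
    smult = (\<lambda>r a. \<lambda>i\<in>I. r \<odot>\<^bsub>M i\<^esub> a i)\<rparr>"  (is "module R ?P")
proof -
  note [simp] = module.axioms(2)[OF M, THEN abelian_group.axioms(1), THEN abelian_monoid.a_closed]
    module.axioms(2)[OF M, THEN abelian_group.axioms(1), THEN abelian_monoid.zero_closed]
    module.smult_closed[OF M]
  note ext = PiE_ext[of _ I "\<lambda>i. carrier (M i)"]
  show ?thesis
  proof (rule moduleI[OF R abelian_groupI])
    fix x assume x: "x \<in> carrier ?P"
    have [simp]: "x i \<in> carrier (M i)" if "i \<in> I" for i using x that by auto
    show "\<exists>y\<in>carrier ?P. y \<oplus>\<^bsub>?P\<^esub> x = \<zero>\<^bsub>?P\<^esub>"
    proof
      show "(\<lambda>i\<in>I. \<ominus>\<^bsub>M i\<^esub> x i) \<in> carrier ?P"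
        using x by (auto intro!: abelian_group.a_inv_closed module.axioms(2)[OF M])
      show "(\<lambda>i\<in>I. \<ominus>\<^bsub>M i\<^esub> x i) \<oplus>\<^bsub>?P\<^esub> x = \<zero>\<^bsub>?P\<^esub>"
        using x by (auto intro!: restrict_ext abelian_group.l_neg module.axioms(2)[OF M])
    qed
    show "\<zero>\<^bsub>?P\<^esub> \<oplus>\<^bsub>?P\<^esub> x = x"
      using x by (intro ext) (auto intro!: abelian_monoid.l_zero abelian_group.axioms(1) module.axioms(2)[OF M])
    show "\<one>\<^bsub>R\<^esub> \<odot>\<^bsub>?P\<^esub> x = x"
      using x cring.axioms(1)[OF R, THEN ring.axioms(2), THEN monoid.one_closed]
      by (intro ext) (auto intro!: module.smult_one[OF M])
    fix y assume y: "y \<in> carrier ?P"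
    show "x \<oplus>\<^bsub>?P\<^esub> y = y \<oplus>\<^bsub>?P\<^esub> x"
      using x y by (auto intro!: restrict_ext abelian_monoid.a_comm abelian_group.axioms(1) module.axioms(2)[OF M])
    fix z assume z: "z \<in> carrier ?P"
    show "(x \<oplus>\<^bsub>?P\<^esub> y) \<oplus>\<^bsub>?P\<^esub> z = x \<oplus>\<^bsub>?P\<^esub> (y \<oplus>\<^bsub>?P\<^esub> z)"
      using x y z by (auto intro!: restrict_ext abelian_monoid.a_assoc abelian_group.axioms(1) module.axioms(2)[OF M])
  next
    fix r x y assume "r \<in> carrier R" "x \<in> carrier ?P" "y \<in> carrier ?P"
    then show "r \<odot>\<^bsub>?P\<^esub> (x \<oplus>\<^bsub>?P\<^esub> y) = r \<odot>\<^bsub>?P\<^esub> x \<oplus>\<^bsub>?P\<^esub> r \<odot>\<^bsub>?P\<^esub> y"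
      by (auto intro!: restrict_ext module.smult_r_distr[OF M])
  next
    fix r s x assume "r \<in> carrier R" "s \<in> carrier R" "x \<in> carrier ?P"
    then show "(r \<oplus>\<^bsub>R\<^esub> s) \<odot>\<^bsub>?P\<^esub> x = r \<odot>\<^bsub>?P\<^esub> x \<oplus>\<^bsub>?P\<^esub> s \<odot>\<^bsub>?P\<^esub> x"
      by (auto intro!: restrict_ext module.smult_l_distr[OF M])
  next
    fix r s x assume "r \<in> carrier R" "s \<in> carrier R" "x \<in> carrier ?P"
    then show "(r \<otimes>\<^bsub>R\<^esub> s) \<odot>\<^bsub>?P\<^esub> x = r \<odot>\<^bsub>?P\<^esub> (s \<odot>\<^bsub>?P\<^esub> x)"
      by (auto intro!: restrict_ext module.smult_assoc1[OF M])
  qed (auto simp: PiE_iff)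
qed

definition with_none :: "'x set \<Rightarrow> 'x option set" where
  "with_none X = insert None (Some ` X)"

text \<open>An index for \<open>Y\<close> removes a point of \<open>Y\<close>, or nothing in the
  case of \<open>None\<close>. Its pull is what has to be removed from \<open>X\<close> so that
  \<open>f\<close> restricts to the complements: the preimage of that point, or nothing if
  \<open>f\<close> misses it.\<close>

definition pull :: "'x set \<Rightarrow> ('x \<Rightarrow> 'x) \<Rightarrow> 'x option \<Rightarrow> 'x option" where
  "pull X f o' = (case o' of None \<Rightarrow> None | Some y \<Rightarrow> if y \<in> f ` X then Some (inv_into X f y) else None)"

text \<open>
  \<open>(coind V)\<^sub>X\<close> is the product of \<open>V\<^sub>X\<close>, at the index \<^const>\<open>None\<close>, and of the \<open>V\<^bsub>X - {x}\<^esub>\<close>.  It is the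
  module of homomorphisms to \<open>V\<close> from the shift of the representable FI-module at \<open>X\<close>.
\<close>

definition coind :: "('x, 'k, 'm) fi_mod \<Rightarrow> ('x, 'k, 'x option \<Rightarrow> 'm) fi_mod" where
  "coind V =
    \<lparr>obj = (\<lambda>X. \<lparr>carrier = (\<Pi>\<^sub>E i\<in>with_none X. carrier (obj V (X - set_option i))),
       mult = undefined, one = undefined, zero = (\<lambda>i\<in>with_none X. \<zero>\<^bsub>obj V (X - set_option i)\<^esub>),
       add = (\<lambda>a b. \<lambda>i\<in>with_none X. a i \<oplus>\<^bsub>obj V (X - set_option i)\<^esub> b i),
       smult = (\<lambda>r a. \<lambda>i\<in>with_none X. r \<odot>\<^bsub>obj V (X - set_option i)\<^esub> a i)\<rparr>),
     arr = (\<lambda>X Y f b. \<lambda>i\<in>with_none Y.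
       arr V (X - set_option (pull X f i)) (Y - set_option i) f (b (pull X f i)))\<rparr>"

lemma coind_simps [simp]:
  "carrier (obj (coind V) X) = (\<Pi>\<^sub>E i\<in>with_none X. carrier (obj V (X - set_option i)))"
  "zero (obj (coind V) X) = (\<lambda>i\<in>with_none X. \<zero>\<^bsub>obj V (X - set_option i)\<^esub>)"
  "add (obj (coind V) X) a b = (\<lambda>i\<in>with_none X. a i \<oplus>\<^bsub>obj V (X - set_option i)\<^esub> b i)"
  "smult (obj (coind V) X) r a = (\<lambda>i\<in>with_none X. r \<odot>\<^bsub>obj V (X - set_option i)\<^esub> a i)"
  "arr (coind V) X Y f b = (\<lambda>i\<in>with_none Y.
       arr V (X - set_option (pull X f i)) (Y - set_option i) f (b (pull X f i)))"
  by (simp_all add: coind_def)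

lemma pull_None [simp]: "pull X f None = None"
  by (simp add: pull_def)

lemma pull_Some: "f \<in> injections X Y \<Longrightarrow> x \<in> X \<Longrightarrow> pull X f (Some (f x)) = Some x"
  by (simp add: pull_def injections_def)

lemma pull_notin: "y \<notin> f ` X \<Longrightarrow> pull X f (Some y) = None"
  by (simp add: pull_def)

lemma pull_with_none [simp]: "pull X f i \<in> with_none X"
  by (auto simp: pull_def with_none_def inv_into_into split: option.splits)

lemma pull_cases:
  assumes "f \<in> injections X Y"
  obtains x where "x \<in> X" "i = Some (f x)" "pull X f i = Some x"
    | "pull X f i = None" "\<And>x. x \<in> X \<Longrightarrow> i \<noteq> Some (f x)"
proof (cases "\<exists>x\<in>X. i = Some (f x)")
  case True
  then show ?thesis using that(1) pull_Some[OF assms] by blast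
next
  case False
  then have "pull X f i = None" by (cases i) (auto intro!: pull_notin)
  then show ?thesis using that(2) False by blast
qed

lemma pull_eq_iff: "f \<in> injections X Y \<Longrightarrow> x \<in> X \<Longrightarrow> pull X f i = Some x \<longleftrightarrow> i = Some (f x)"
  by (cases rule: pull_cases[of f X Y i]) (auto simp: injections_def inj_on_def)

lemma pull_injections:
  assumes "f \<in> injections X Y"
  shows "f \<in> injections (X - set_option (pull X f i)) (Y - set_option i)"
proof -
  have "f x \<notin> set_option i" if "x \<in> X" "x \<notin> set_option (pull X f i)" for x
    using pull_eq_iff[OF assms that(1), of i] that(2) by auto
  then show ?thesis using assms by (auto simp: injections_def intro: inj_on_subset)
qed

text \<open>Together with \<open>pull_eq_iff\<close>, which describes \<open>pull\<close> without
  \<open>inv_into\<close>, this reduces the congruence, identity and composition laws of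
  \<open>pull\<close> to statements about points of \<open>X\<close>.\<close>

lemma pull_eqI:
  assumes "\<And>x. x \<in> X \<Longrightarrow> p = Some x \<longleftrightarrow> q = Some x" "p \<in> with_none X" "q \<in> with_none X"
  shows "p = q"
  using assms by (auto simp: with_none_def)

lemma pull_cong:
  assumes "f \<in> injections X Y" "g \<in> injections X Y" "\<And>x. x \<in> X \<Longrightarrow> f x = g x"
  shows "pull X f i = pull X g i"
  by (rule pull_eqI[of X]) (simp_all add: pull_eq_iff[OF assms(1)] pull_eq_iff[OF assms(2)] assms(3))

lemma pull_id:
  assumes "i \<in> with_none X"
  shows "pull X id i = i"
  using assms by (intro pull_eqI) (auto simp: pull_eq_iff[of id X X] injections_def)

lemma pull_comp:
  assumes "f \<in> injections X Y" "g \<in> injections Y Z"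
  shows "pull X (g \<circ> f) i = pull X f (pull Y g i)"
proof (rule pull_eqI)
  fix x assume x: "x \<in> X"
  then have "f x \<in> Y" using assms(1) by (auto simp: injections_def)
  then show "pull X (g \<circ> f) i = Some x \<longleftrightarrow> pull X f (pull Y g i) = Some x"
    using x by (simp add: pull_eq_iff[OF injections_comp[OF assms]] pull_eq_iff[OF assms(1)]
        pull_eq_iff[OF assms(2)])
qed simp_all

lemma fi_module_coind:
  fixes V :: "('x, 'k, 'm) fi_mod"
  assumes V: "fi_module R V"
  shows "fi_module R (coind V)"
proof (rule fi_moduleI)
  fix X :: "'x set" assume X: "finite X"
  show "module R (obj (coind V) X)"
    unfolding coind_def fi_mod.simps
    by (rule module_PiE[OF module.axioms(1)[OF fi_obj[OF V X]] fi_obj[OF V]]) (simp add: X)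
next
  fix X Y :: "'x set" and f assume *: "finite X" "finite Y" "f \<in> injections X Y"
  have l: "arr V (X - set_option (pull X f i)) (Y - set_option i) f \<in>
      linear_maps R (obj V (X - set_option (pull X f i))) (obj V (Y - set_option i))" for i
    using * by (intro fi_arr[OF V] pull_injections) simp_all
  have c: "b (pull X f i) \<in> carrier (obj V (X - set_option (pull X f i)))"
    if "b \<in> carrier (obj (coind V) X)" for b i
    using PiE_mem[OF that[unfolded coind_simps] pull_with_none] .
  show "arr (coind V) X Y f \<in> linear_maps R (obj (coind V) X) (obj (coind V) Y)"
  proof (rule linear_mapsI)
    fix a assume a: "a \<in> carrier (obj (coind V) X)"
    show "arr (coind V) X Y f a \<in> carrier (obj (coind V) Y)"
      using linear_closed[OF l c[OF a]] by simp
    show "arr (coind V) X Y f (r \<odot>\<^bsub>obj (coind V) X\<^esub> a) = r \<odot>\<^bsub>obj (coind V) Y\<^esub> arr (coind V) X Y f a"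
      if "r \<in> carrier R" for r
      using linear_smult[OF l that c[OF a]] by (simp cong: restrict_cong)
    fix b assume b: "b \<in> carrier (obj (coind V) X)"
    show "arr (coind V) X Y f (a \<oplus>\<^bsub>obj (coind V) X\<^esub> b) =
        arr (coind V) X Y f a \<oplus>\<^bsub>obj (coind V) Y\<^esub> arr (coind V) X Y f b"
      using linear_add[OF l c[OF a] c[OF b]] by (simp cong: restrict_cong)
  qed
next
  fix X Y :: "'x set" and f g b
  assume fin: "finite X" "finite Y" and f: "f \<in> injections X Y" and g: "g \<in> injections X Y"
    and eq: "\<And>x. x \<in> X \<Longrightarrow> f x = g x" and b: "b \<in> carrier (obj (coind V) X)"
  have "arr V (X - set_option (pull X f i)) (Y - set_option i) f (b (pull X f i)) =
      arr V (X - set_option (pull X f i)) (Y - set_option i) g (b (pull X f i))" for i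
    using fin b pull_injections[OF f, of i] pull_injections[OF g, of i]
    by (intro fi_arr_cong[OF V]) (auto simp: eq PiE_mem pull_cong[OF f g eq])
  then show "arr (coind V) X Y f b = arr (coind V) X Y g b"
    by (simp add: pull_cong[OF f g eq] cong: restrict_cong)
next
  fix X :: "'x set" and b assume X: "finite X" and b: "b \<in> carrier (obj (coind V) X)"
  have "arr V (X - set_option i) (X - set_option i) id (b i) = b i" if "i \<in> with_none X" for i
    using X b that by (intro fi_arr_id[OF V]) (auto simp: PiE_mem)
  then have "arr (coind V) X X id b = (\<lambda>i\<in>with_none X. b i)"
    by (auto simp: pull_id intro!: restrict_ext)
  then show "arr (coind V) X X id b = b" using b by (simp add: PiE_restrict)
next
  fix X Y Z :: "'x set" and f g b
  assume fin: "finite X" "finite Y" "finite Z" and f: "f \<in> injections X Y" and g: "g \<in> injections Y Z"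
    and b: "b \<in> carrier (obj (coind V) X)"
  have "arr V (X - set_option (pull X (g \<circ> f) i)) (Z - set_option i) (g \<circ> f) (b (pull X (g \<circ> f) i)) =
      arr V (Y - set_option (pull Y g i)) (Z - set_option i) g
        (arr V (X - set_option (pull X f (pull Y g i))) (Y - set_option (pull Y g i)) f
          (b (pull X f (pull Y g i))))" for i
    unfolding pull_comp[OF f g]
    using fin b by (intro fi_arr_comp[OF V] pull_injections f g) (auto simp: PiE_mem)
  then show "arr (coind V) X Z (g \<circ> f) b = arr (coind V) Y Z g (arr (coind V) X Y f b)"
    by (simp cong: restrict_cong)
qed

text \<open>At each \<open>X\<close> coinduction is a product of values of the module, so preimages
  can be chosen in every factor separately.\<close>

lemma fi_epi_coind:
  fixes A :: "('x, 'k, 'a) fi_mod" and B :: "('x, 'k, 'b) fi_mod"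
  assumes g: "fi_epi R A B g"
  shows "fi_epi R (coind A) (coind B) (\<lambda>X b. \<lambda>i\<in>with_none X. g (X - set_option i) (b i))"
proof -
  note h = fi_epi_hom[OF g]
  note A = fi_hom_dom[OF h] and B = fi_hom_cod[OF h]
  have "fi_hom R (coind A) (coind B) (\<lambda>X b. \<lambda>i\<in>with_none X. g (X - set_option i) (b i))"
  proof (rule fi_homI[OF fi_module_coind[OF A] fi_module_coind[OF B] linear_mapsI])
    fix X Y :: "'x set" and f b
    assume *: "finite X" "finite Y" "f \<in> injections X Y" "b \<in> carrier (obj (coind A) X)"
    have "g (Y - set_option i) (arr A (X - set_option (pull X f i)) (Y - set_option i) f (b (pull X f i)))
       = arr B (X - set_option (pull X f i)) (Y - set_option i) f
           (g (X - set_option (pull X f i)) (b (pull X f i)))" for i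
      using * by (intro fi_hom_arr[OF h] pull_injections) (auto simp: PiE_mem)
    then show "(\<lambda>i\<in>with_none Y. g (Y - set_option i) (arr (coind A) X Y f b i)) =
        arr (coind B) X Y f (\<lambda>i\<in>with_none X. g (X - set_option i) (b i))"
      by (simp cong: restrict_cong)
  next
    fix X :: "'x set" and b assume X: "finite X" and b: "b \<in> carrier (obj (coind A) X)"
    note m = PiE_mem[OF b[unfolded coind_simps]] and fin = finite_Diff[OF X]
    show "(\<lambda>i\<in>with_none X. g (X - set_option i) (b i)) \<in> carrier (obj (coind B) X)"
      using m by (auto simp: fi_hom_closed[OF h fin])
    show "(\<lambda>i\<in>with_none X. g (X - set_option i) ((r \<odot>\<^bsub>obj (coind A) X\<^esub> b) i)) =
        r \<odot>\<^bsub>obj (coind B) X\<^esub> (\<lambda>i\<in>with_none X. g (X - set_option i) (b i))" if "r \<in> carrier R" for r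
      using m that by (auto simp: fi_hom_smult[OF h fin] intro!: restrict_ext)
    fix b' assume b': "b' \<in> carrier (obj (coind A) X)"
    note m' = PiE_mem[OF b'[unfolded coind_simps]]
    show "(\<lambda>i\<in>with_none X. g (X - set_option i) ((b \<oplus>\<^bsub>obj (coind A) X\<^esub> b') i)) =
        (\<lambda>i\<in>with_none X. g (X - set_option i) (b i)) \<oplus>\<^bsub>obj (coind B) X\<^esub>
        (\<lambda>i\<in>with_none X. g (X - set_option i) (b' i))"
      using m m' by (auto simp: fi_hom_add[OF h fin] intro!: restrict_ext)
  qed
  moreover have "(\<lambda>b. \<lambda>i\<in>with_none X. g (X - set_option i) (b i)) ` carrier (obj (coind A) X) =
      carrier (obj (coind B) X)" (is "?G ` _ = _") if X: "finite X" for X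
  proof
    show "?G ` carrier (obj (coind A) X) \<subseteq> carrier (obj (coind B) X)"
      using X by (auto dest: PiE_mem intro!: fi_hom_closed[OF h])
    show "carrier (obj (coind B) X) \<subseteq> ?G ` carrier (obj (coind A) X)"
    proof
      fix b assume b: "b \<in> carrier (obj (coind B) X)"
      define a where
        "a = (\<lambda>i\<in>with_none X. inv_into (carrier (obj A (X - set_option i))) (g (X - set_option i)) (b i))"
      have im: "b i \<in> g (X - set_option i) ` carrier (obj A (X - set_option i))" if "i \<in> with_none X" for i
        using PiE_mem[OF b[unfolded coind_simps] that] fi_epi_surj[OF g finite_Diff[OF X]] by simp
      have "a \<in> carrier (obj (coind A) X)" using inv_into_into[OF im] by (simp add: a_def)
      moreover have "b = ?G a"
        using f_inv_into_f[OF im] b by (intro PiE_ext[OF b[unfolded coind_simps]])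
          (auto simp: a_def PiE_iff)
      ultimately show "b \<in> ?G ` carrier (obj (coind A) X)" by blast
    qed
  qed
  ultimately show ?thesis by (simp add: fi_epi_def)
qed

section \<open>The adjunction between the shift and coinduction\<close>

definition unshift :: "('x option \<Rightarrow> 'x) \<Rightarrow> 'x \<Rightarrow> 'x" where
  "unshift e y = the (inv_into UNIV e y)"

text \<open>The universal injections into a set with an added point: \<open>Some x\<close> sends
  \<open>x\<close> to the new point, \<open>None\<close> is the inclusion. Every injection
  \<open>X \<rightarrow> Y \<squnion> {\<star>}\<close> factors through exactly one of them, with
  index in \<open>with_none X\<close>, by a map that fixes the added point; this is why
  \<open>coind\<close> has these factors.\<close>

definition to_point :: "('x option \<Rightarrow> 'x) \<Rightarrow> 'x option \<Rightarrow> 'x \<Rightarrow> 'x" where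
  "to_point e i x = (if Some x = i then e None else e (Some x))"

lemma unshift_simp: "inj e \<Longrightarrow> unshift e (e (Some x)) = x"
  by (simp add: unshift_def)

lemma to_point_injections:
  assumes "inj e"
  shows "to_point e i \<in> injections X (add_point e (X - set_option i))"
proof -
  note [simp] = inj_eq[OF assms]
  show ?thesis
    by (cases i) (auto simp: injections_def mem_add_point to_point_def inj_on_def)
qed

lemma unshift_injections:
  assumes "inj e"
  shows "unshift e \<in> injections (add_point e X - {e None}) X"
  by (auto simp: injections_def mem_add_point unshift_simp[OF assms] inj_on_def)

text \<open>The adjunct \<open>P \<rightarrow> coind B\<close> of
  \<open>h : S P \<rightarrow> B\<close>.\<close>

definition to_coind ::
  "('x option \<Rightarrow> 'x) \<Rightarrow> ('x, 'k, 'm) fi_mod \<Rightarrow> ('x set \<Rightarrow> 'm \<Rightarrow> 'n) \<Rightarrow> 'x set \<Rightarrow> 'm \<Rightarrow> 'x option \<Rightarrow> 'n" where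
  "to_coind e P h X p = (\<lambda>i\<in>with_none X.
     h (X - set_option i) (arr P X (add_point e (X - set_option i)) (to_point e i) p))"

text \<open>The adjunct \<open>S P \<rightarrow> A\<close> of
  \<open>l : P \<rightarrow> coind A\<close>. The factor of \<open>coind A\<close> at
  \<open>X \<squnion> {\<star>}\<close> that removes \<star> is a copy of \<open>A\<close> at
  \<open>X\<close>, and \<open>unshift\<close> makes the identification.\<close>

definition from_coind ::
  "('x option \<Rightarrow> 'x) \<Rightarrow> ('x, 'k, 'n) fi_mod \<Rightarrow> ('x set \<Rightarrow> 'm \<Rightarrow> 'x option \<Rightarrow> 'n) \<Rightarrow> 'x set \<Rightarrow> 'm \<Rightarrow> 'n" where
  "from_coind e A l X q =
     arr A (add_point e X - {e None}) X (unshift e) (l (add_point e X) q (Some (e None)))"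

lemma fi_hom_to_coind:
  fixes P :: "('x, 'k, 'm) fi_mod" and B :: "('x, 'k, 'n) fi_mod"
  assumes P: "fi_module R P" and e: "inj e" and h: "fi_hom R (shift e P) B h"
  shows "fi_hom R P (coind B) (to_coind e P h)"
proof (rule fi_homI[OF P fi_module_coind[OF fi_hom_cod[OF h]] linear_mapsI])
  fix X :: "'x set" and p assume X: "finite X" and p: "p \<in> carrier (obj P X)"
  have fin: "finite (X - set_option i)" for i using X by simp
  note l = fi_arr[OF P X finite_add_point[OF fin] to_point_injections[OF e]]
  note hl = fi_hom_ops[OF h fin, unfolded shift_simps]
  show "to_coind e P h X p \<in> carrier (obj (coind B) X)"
    by (auto simp: to_coind_def intro!: hl(1) linear_closed[OF l] p)
  show "to_coind e P h X (r \<odot>\<^bsub>obj P X\<^esub> p) = r \<odot>\<^bsub>obj (coind B) X\<^esub> to_coind e P h X p"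
    if r: "r \<in> carrier R" for r
    by (auto simp: to_coind_def linear_smult[OF l r p] hl(3)[OF r linear_closed[OF l p]]
        intro!: restrict_ext)
  fix q assume q: "q \<in> carrier (obj P X)"
  show "to_coind e P h X (p \<oplus>\<^bsub>obj P X\<^esub> q) =
      to_coind e P h X p \<oplus>\<^bsub>obj (coind B) X\<^esub> to_coind e P h X q"
    by (auto simp: to_coind_def linear_add[OF l p q] hl(2)[OF linear_closed[OF l p] linear_closed[OF l q]]
        intro!: restrict_ext)
next
  fix X Y :: "'x set" and f p
  assume X: "finite X" and Y: "finite Y" and f: "f \<in> injections X Y" and p: "p \<in> carrier (obj P X)"
  have eq: "h (Y - set_option i) (arr P Y (add_point e (Y - set_option i)) (to_point e i) (arr P X Y f p)) =
      arr B (X - set_option (pull X f i)) (Y - set_option i) f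
        (h (X - set_option (pull X f i))
          (arr P X (add_point e (X - set_option (pull X f i))) (to_point e (pull X f i)) p))" for i
  proof -
    let ?X = "X - set_option (pull X f i)" and ?Y = "Y - set_option i"
    have fin: "finite ?X" "finite ?Y" using X Y by simp_all
    note f' = pull_injections[OF f, of i]
    note c = fi_arr_closed[OF P X finite_add_point[OF fin(1)] to_point_injections[OF e] p]
    \<comment> \<open>Both sides are the new point exactly when \<open>f x\<close> is the point that
      \<open>i\<close> removes, which is what \<open>pull\<close> expresses.\<close>
    have "add_point_map e f (to_point e (pull X f i) x) = to_point e i (f x)" if "x \<in> X" for x
      using pull_eq_iff[OF f that, of i] by (auto simp: to_point_def add_point_map_simps[OF e])
    then have "arr P Y (add_point e ?Y) (to_point e i) (arr P X Y f p) =
        arr (shift e P) ?X ?Y f (arr P X (add_point e ?X) (to_point e (pull X f i)) p)"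
      unfolding shift_simps
      by (intro fi_arr_comp_eq[OF P X Y finite_add_point[OF fin(1)] finite_add_point[OF fin(2)] f
            to_point_injections[OF e] to_point_injections[OF e] add_point_map_injections[OF e f'] _ p]) simp
    then show ?thesis using fi_hom_arr[OF h fin f'] c by simp
  qed
  show "to_coind e P h Y (arr P X Y f p) = arr (coind B) X Y f (to_coind e P h X p)"
    by (auto simp: to_coind_def eq intro!: restrict_ext)
qed

lemma fi_hom_from_coind:
  fixes P :: "('x, 'k, 'm) fi_mod" and A :: "('x, 'k, 'n) fi_mod"
  assumes A: "fi_module R A" and e: "inj e" and l: "fi_hom R P (coind A) l"
  shows "fi_hom R (shift e P) A (from_coind e A l)"
proof -
  note P = fi_hom_dom[OF l]
  have n: "Some (e None) \<in> with_none (add_point e X)" for X :: "'x set"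
    by (simp add: with_none_def mem_add_point)
  have c: "b (Some (e None)) \<in> carrier (obj A (add_point e X - {e None}))"
    if "b \<in> carrier (obj (coind A) (add_point e X))" for X b
    using PiE_mem[OF that[unfolded coind_simps] n] by simp
  show ?thesis
  proof (rule fi_homI[OF fi_module_shift[OF P e] A linear_mapsI])
    fix X :: "'x set" and p assume X: "finite X" and p: "p \<in> carrier (obj (shift e P) X)"
    note X' = finite_add_point[OF X, of e]
    have p': "p \<in> carrier (obj P (add_point e X))" using p by simp
    have a: "arr A (add_point e X - {e None}) X (unshift e) \<in>
        linear_maps R (obj A (add_point e X - {e None})) (obj A X)"
      using X by (intro fi_arr[OF A _ _ unshift_injections[OF e]]) simp_all
    note lc = fi_hom_closed[OF l X']
    show "from_coind e A l X p \<in> carrier (obj A X)"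
      unfolding from_coind_def by (rule linear_closed[OF a c[OF lc[OF p']]])
    show "from_coind e A l X (r \<odot>\<^bsub>obj (shift e P) X\<^esub> p) = r \<odot>\<^bsub>obj A X\<^esub> from_coind e A l X p"
      if r: "r \<in> carrier R" for r
      using n by (simp add: from_coind_def fi_hom_smult[OF l X' r p'] linear_smult[OF a r c[OF lc[OF p']]])
    fix q assume q: "q \<in> carrier (obj (shift e P) X)"
    have q': "q \<in> carrier (obj P (add_point e X))" using q by simp
    show "from_coind e A l X (p \<oplus>\<^bsub>obj (shift e P) X\<^esub> q) =
        from_coind e A l X p \<oplus>\<^bsub>obj A X\<^esub> from_coind e A l X q"
      using n by (simp add: from_coind_def fi_hom_add[OF l X' p' q']
          linear_add[OF a c[OF lc[OF p']] c[OF lc[OF q']]])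
  next
    fix X Y :: "'x set" and f p
    assume X: "finite X" and Y: "finite Y" and f: "f \<in> injections X Y" and p: "p \<in> carrier (obj (shift e P) X)"
    note f' = add_point_map_injections[OF e f]
    have p': "p \<in> carrier (obj P (add_point e X))" using p by simp
    note b = fi_hom_closed[OF l finite_add_point[OF X] p']
    \<comment> \<open>The shifted map takes the added point to the added point, so the factor
      removing it at \<open>Y\<close> is reached from the factor removing it at
      \<open>X\<close>.\<close>
    have pl: "pull (add_point e X) (add_point_map e f) (Some (e None)) = Some (e None)"
      using pull_Some[OF f', of "e None"] by (simp add: mem_add_point add_point_map_simps[OF e])
    have f'': "add_point_map e f \<in> injections (add_point e X - {e None}) (add_point e Y - {e None})"
      using pull_injections[OF f', of "Some (e None)"] by (simp add: pl)
    have "from_coind e A l Y (arr (shift e P) X Y f p) =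
      arr A (add_point e Y - {e None}) Y (unshift e)
        (arr A (add_point e X - {e None}) (add_point e Y - {e None}) (add_point_map e f)
          (l (add_point e X) p (Some (e None))))"
      using n by (simp add: from_coind_def pl
          fi_hom_arr[OF l finite_add_point[OF X] finite_add_point[OF Y] f' p'])
    also have "\<dots> = arr A X Y f (arr A (add_point e X - {e None}) X (unshift e)
          (l (add_point e X) p (Some (e None))))"
    proof (rule fi_arr_comp_eq[OF A _ _ X Y f'' unshift_injections[OF e] unshift_injections[OF e] f _ c[OF b]])
      fix x assume "x \<in> add_point e X - {e None}"
      then show "unshift e (add_point_map e f x) = f (unshift e x)"
        by (auto simp: mem_add_point add_point_map_simps[OF e] unshift_simp[OF e])
    qed (simp_all add: X Y)
    finally show "from_coind e A l Y (arr (shift e P) X Y f p) = arr A X Y f (from_coind e A l X p)"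
      by (simp add: from_coind_def)
  qed
qed

text \<open>The half of the adjunction that turns a lift of the adjunct of \<open>h\<close> back
  into a lift of \<open>h\<close>.\<close>

lemma from_to_coind:
  assumes P: "fi_module R P" and e: "inj e" and h: "fi_hom R (shift e P) B h"
    and X: "finite X" and q: "q \<in> carrier (obj (shift e P) X)"
  shows "from_coind e B (to_coind e P h) X q = h X q"
proof -
  let ?Y = "add_point e X - {e None}"
  have q': "q \<in> carrier (obj P (add_point e X))" using q by simp
  have Y: "finite ?Y" using X by simp
  note X' = finite_add_point[OF X, of e]
  have k: "to_point e (Some (e None)) \<in> injections (add_point e X) (add_point e ?Y)"
    using to_point_injections[OF e, of "Some (e None)" "add_point e X"] by simp
  note u = unshift_injections[OF e, of X]
  note c = fi_arr_closed[OF P X' finite_add_point[OF Y] k q']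
  have n: "Some (e None) \<in> with_none (add_point e X)"
    by (simp add: with_none_def mem_add_point)
  have "from_coind e B (to_coind e P h) X q =
      arr B ?Y X (unshift e) (h ?Y (arr P (add_point e X) (add_point e ?Y) (to_point e (Some (e None))) q))"
    using n by (simp add: from_coind_def to_coind_def)
  also have "\<dots> = h X (arr (shift e P) ?Y X (unshift e)
      (arr P (add_point e X) (add_point e ?Y) (to_point e (Some (e None))) q))"
    using fi_hom_arr[OF h Y X u] c by simp
  \<comment> \<open>\<open>to_point\<close> moves the point added to \<open>X\<close> to a second
    added point, and \<open>unshift\<close>, extended by that second point, moves everything back.
    The composite is the identity.\<close>
  also have "arr (shift e P) ?Y X (unshift e)
      (arr P (add_point e X) (add_point e ?Y) (to_point e (Some (e None))) q) =
      arr P (add_point e X) (add_point e X) id q"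
    unfolding shift_simps
  proof (rule fi_arr_comp_eq'[OF P X' finite_add_point[OF Y] X' k add_point_map_injections[OF e u] _ _ q'])
    show "id \<in> injections (add_point e X) (add_point e X)" by (simp add: injections_def)
    fix x assume "x \<in> add_point e X"
    then show "add_point_map e (unshift e) (to_point e (Some (e None)) x) = id x"
      by (auto simp: mem_add_point to_point_def add_point_map_simps[OF e] unshift_simp[OF e] inj_eq[OF e])
  qed
  also have "\<dots> = q" by (rule fi_arr_id[OF P X' q'])
  finally show ?thesis .
qed

text \<open>Naturality of the adjunction in its target.\<close>

lemma from_coind_epi:
  assumes g: "fi_hom R A B g" and e: "inj e" and l: "fi_hom R P (coind A) l"
    and X: "finite X" and q: "q \<in> carrier (obj (shift e P) X)"
  shows "g X (from_coind e A l X q) =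
    from_coind e B (\<lambda>X p. \<lambda>i\<in>with_none X. g (X - set_option i) (l X p i)) X q"
proof -
  have n: "Some (e None) \<in> with_none (add_point e X)"
    by (simp add: with_none_def mem_add_point)
  have q': "q \<in> carrier (obj P (add_point e X))" using q by simp
  have "l (add_point e X) q (Some (e None)) \<in> carrier (obj A (add_point e X - {e None}))"
    using PiE_mem[OF fi_hom_closed[OF l finite_add_point[OF X] q', unfolded coind_simps] n] by simp
  then show ?thesis
    using n X by (simp add: from_coind_def fi_hom_arr[OF g _ X unshift_injections[OF e]])
qed

text \<open>The inclusion of \<open>X\<close> misses \<star>, so on the image of \<iota> the factor
  that removes \<star> is fed by the factor \<open>None\<close>. Composing the adjunct of
  \<open>l\<close> with \<iota> therefore projects \<open>l\<close> to that factor.\<close>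

lemma from_coind_shift_incl:
  assumes A: "fi_module R A" and e: "inj e" and l: "fi_hom R P (coind A) l"
    and X: "finite X" and p: "p \<in> carrier (obj P X)"
  shows "from_coind e A l X (shift_incl e P X p) = l X p None"
proof -
  note s = some_injections[OF e, of X]
  note X' = finite_add_point[OF X, of e]
  have n: "Some (e None) \<in> with_none (add_point e X)" "None \<in> with_none X"
    by (simp_all add: with_none_def mem_add_point)
  have pl: "pull X (e \<circ> Some) (Some (e None)) = None"
    by (rule pull_notin) (auto simp: inj_eq[OF e])
  have c: "l X p None \<in> carrier (obj A X)"
    using PiE_mem[OF fi_hom_closed[OF l X p, unfolded coind_simps] n(2)] by simp
  have s': "e \<circ> Some \<in> injections X (add_point e X - {e None})"
    using pull_injections[OF s, of "Some (e None)"] by (simp add: pl)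
  have "l (add_point e X) (shift_incl e P X p) (Some (e None)) =
      arr A X (add_point e X - {e None}) (e \<circ> Some) (l X p None)"
    using n by (simp add: shift_incl_def fi_hom_arr[OF l X X' s p] pl)
  then have "from_coind e A l X (shift_incl e P X p) =
      arr A (add_point e X - {e None}) X (unshift e) (arr A X (add_point e X - {e None}) (e \<circ> Some) (l X p None))"
    by (simp add: from_coind_def)
  also have "\<dots> = arr A X X id (l X p None)"
    by (rule fi_arr_comp_eq'[OF A X _ X s' unshift_injections[OF e] _ _ c])
      (simp_all add: X unshift_simp[OF e] injections_def)
  also have "\<dots> = l X p None" by (rule fi_arr_id[OF A X c])
  finally show ?thesis .
qed

text \<open>Filling the other factors with zero gives preimages at each object. In general these do
  not form a homomorphism, so splitting the projection over \<open>P\<close> takes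
  projectivity.\<close>

lemma fi_epi_coind_None:
  fixes A :: "('x, 'k, 'a) fi_mod"
  assumes A: "fi_module R A"
  shows "fi_epi R (coind A) A (\<lambda>X b. b None)"
proof -
  have n: "None \<in> with_none X" for X :: "'x set" by (simp add: with_none_def)
  have "fi_hom R (coind A) A (\<lambda>X b. b None)"
  proof (rule fi_homI[OF fi_module_coind[OF A] A linear_mapsI])
    fix X :: "'x set" and b assume "b \<in> carrier (obj (coind A) X)"
    from PiE_mem[OF this[unfolded coind_simps] n] show "b None \<in> carrier (obj A X)" by simp
  qed (use n in simp_all)
  moreover have "a \<in> (\<lambda>b. b None) ` carrier (obj (coind A) X)"
    if X: "finite X" and a: "a \<in> carrier (obj A X)" for X a
  proof -
    let ?b = "\<lambda>i\<in>with_none X. if i = None then a else \<zero>\<^bsub>obj A (X - set_option i)\<^esub>"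
    have "?b None = a" using n by simp
    moreover have "?b \<in> carrier (obj (coind A) X)"
      using a submodule_zero[OF fi_submodule_obj[OF fi_submodule_carrier[OF A]]] X by auto
    ultimately show ?thesis by (intro image_eqI[of _ _ ?b]) simp_all
  qed
  moreover have "(\<lambda>b. b None) ` carrier (obj (coind A) X) \<subseteq> carrier (obj A X)" for X
    using PiE_mem[OF _ n] by fastforce
  ultimately show ?thesis unfolding fi_epi_def by blast
qed


section \<open>Projective FI-modules\<close>

lemma fi_projective_module: "fi_projective R P \<Longrightarrow> fi_module R P"
  by (simp add: fi_projective_def)

lemma fi_projectiveD:
  fixes P A B :: "('x, 'k, 'u) fi_mod"
  assumes "fi_projective R P" "fi_epi R A B g" "fi_hom R P B h"
  obtains l where "fi_hom R P A l" "\<And>X v. finite X \<Longrightarrow> v \<in> carrier (obj P X) \<Longrightarrow> g X (l X v) = h X v"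
  using assms unfolding fi_projective_def by metis

text \<open>
  The target \<open>B\<close> need not embed into \<^typ>\<open>'u\<close> a priori; it does so through a section of \<open>g\<close>.
\<close>

lemma projective_lift:
  fixes P :: "('x, 'k, 'u) fi_mod" and A :: "('x, 'k, 'a) fi_mod" and B :: "('x, 'k, 'b) fi_mod"
  assumes P: "fi_projective R P" and g: "fi_epi R A B g" and h: "fi_hom R P B h"
    and c: "\<And>X. finite X \<Longrightarrow> inj_on (c X :: 'a \<Rightarrow> 'u) (carrier (obj A X))"
  obtains l where "fi_hom R P A l" "\<And>X v. finite X \<Longrightarrow> v \<in> carrier (obj P X) \<Longrightarrow> g X (l X v) = h X v"
proof -
  note A = fi_hom_dom[OF fi_epi_hom[OF g]] and B = fi_hom_cod[OF h]
  define s where "s X = c X \<circ> inv_into (carrier (obj A X)) (g X)" for X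
  have s: "inj_on (s X) (carrier (obj B X))" if X: "finite X" for X
  proof -
    have "inj_on (inv_into (carrier (obj A X)) (g X)) (carrier (obj B X))"
      using inj_on_inv_into[of "carrier (obj B X)" "g X" "carrier (obj A X)"] fi_epi_surj[OF g X] by simp
    moreover have "inv_into (carrier (obj A X)) (g X) ` carrier (obj B X) \<subseteq> carrier (obj A X)"
      using fi_epi_surj[OF g X] by (auto intro: inv_into_into)
    ultimately show ?thesis
      unfolding s_def by (intro comp_inj_on) (auto intro: inj_on_subset[OF c[OF X]])
  qed
  let ?d = "\<lambda>X. inv_into (carrier (obj A X)) (c X)"
  note eB = fi_epi_transport[OF B s] and eA = fi_epi_transport[OF A c]
  have dA: "?d X (c X a) = a" if "finite X" "a \<in> carrier (obj A X)" for X a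
    using inv_into_f_f[OF c[OF that(1)] that(2)] .
  have "fi_epi R (fi_transport c A) A ?d"
    unfolding fi_epi_def
  proof (intro conjI allI impI)
    fix X :: "'x set" assume X: "finite X"
    show "?d X ` carrier (obj (fi_transport c A) X) = carrier (obj A X)"
      using dA[OF X] by (simp add: fi_epi_surj[OF eA X, symmetric] image_image)
  qed (rule fi_hom_transport_inv[OF A c])
  then have "fi_epi R (fi_transport c A) (fi_transport s B) (\<lambda>X a. s X (g X (?d X a)))"
    by (rule fi_epi_comp[OF _ fi_epi_comp[OF g eB]])
  then obtain l where l: "fi_hom R P (fi_transport c A) l"
    "\<And>X v. finite X \<Longrightarrow> v \<in> carrier (obj P X) \<Longrightarrow> s X (g X (?d X (l X v))) = s X (h X v)"
    using fi_projectiveD[OF P _ fi_hom_comp[OF h fi_epi_hom[OF eB]]] by blast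
  have l': "fi_hom R P A (\<lambda>X v. ?d X (l X v))"
    by (rule fi_hom_comp[OF l(1) fi_hom_transport_inv[OF A c]])
  have "g X (?d X (l X v)) = h X v" if X: "finite X" and v: "v \<in> carrier (obj P X)" for X v
    using inj_onD[OF s[OF X] l(2)[OF X v]] fi_hom_closed[OF l' X v]
      fi_hom_closed[OF fi_epi_hom[OF g] X] fi_hom_closed[OF h X v] by blast
  with l' that show thesis by blast
qed

lemma projective_lift':
  fixes P A :: "('x, 'k, 'u) fi_mod"
  assumes "fi_projective R P" "fi_epi R A B g" "fi_hom R P B h"
  obtains l where "fi_hom R P A l" "\<And>X v. finite X \<Longrightarrow> v \<in> carrier (obj P X) \<Longrightarrow> g X (l X v) = h X v"
  using projective_lift[OF assms, of "\<lambda>X a. a"] by auto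

text \<open>Replacing \<open>B\<close> by the image of \<open>f\<close> makes \<open>f\<close> an
  epimorphism. Projectivity is used in this form along exact sequences, where the image of one map
  is known as the kernel of the next.\<close>

lemma projective_lift_image:
  fixes P A :: "('x, 'k, 'u) fi_mod" and B :: "('x, 'k, 'b) fi_mod"
  assumes P: "fi_projective R P" and f: "fi_hom R A B f" and h: "fi_hom R P B h"
    and im: "\<And>X v. finite X \<Longrightarrow> v \<in> carrier (obj P X) \<Longrightarrow> h X v \<in> f X ` carrier (obj A X)"
  obtains l where "fi_hom R P A l" "\<And>X v. finite X \<Longrightarrow> v \<in> carrier (obj P X) \<Longrightarrow> f X (l X v) = h X v"
proof -
  have "fi_hom R P (fi_sub B (\<lambda>X. f X ` carrier (obj A X))) h"
    using im by (intro fi_hom_to_sub[OF h fi_submodule_image[OF f fi_submodule_carrier[OF fi_hom_dom[OF f]]]])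
  from projective_lift'[OF P fi_epi_image[OF f] this] that show thesis by blast
qed

text \<open>
  \<^const>\<open>fi_projective\<close> only tests against FI-modules with elements in \<^typ>\<open>'u\<close>, while those of
  \<^const>\<open>coind\<close> are functions to \<^typ>\<open>'u\<close> with a finite domain, extended by \<^const>\<open>undefined\<close>.
\<close>

definition coind_code :: "(('x option \<Rightarrow> 'u) \<Rightarrow> 'u) \<Rightarrow> bool" where
  "coind_code c \<longleftrightarrow> inj_on c {b. finite {i. b i \<noteq> undefined}}"

lemma coind_code_inj_on:
  assumes "coind_code c" "finite X"
  shows "inj_on c (carrier (obj (coind A) X))"
proof -
  have "finite {i. b i \<noteq> undefined}" if "b \<in> carrier (obj (coind A) X)" for b
  proof (rule finite_subset)
    show "{i. b i \<noteq> undefined} \<subseteq> with_none X" using that by (auto simp: PiE_iff extensional_def)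
    show "finite (with_none X)" using assms(2) by (simp add: with_none_def)
  qed
  then show ?thesis using assms(1) unfolding coind_code_def by (rule_tac inj_on_subset) auto
qed

lemma fi_projective_shift:
  fixes P :: "('x, 'k, 'u) fi_mod"
  assumes P: "fi_projective R P" and e: "inj e" and c: "coind_code (c :: ('x option \<Rightarrow> 'u) \<Rightarrow> 'u)"
  shows "fi_projective R (shift e P)"
  unfolding fi_projective_def
proof (intro conjI allI impI)
  note PM = fi_projective_module[OF P]
  show "fi_module R (shift e P)" by (rule fi_module_shift[OF PM e])
  fix A B :: "('x, 'k, 'u) fi_mod" and g h
  assume g: "fi_epi R A B g" and h: "fi_hom R (shift e P) B h"
  note A = fi_hom_dom[OF fi_epi_hom[OF g]]
  \<comment> \<open>The lifting problem for \<open>S P\<close> against \<open>g\<close> is traded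
    for one for \<open>P\<close> against the coinduced epimorphism. The encoding \<open>c\<close>
    enters because the elements of \<open>coind A\<close> are functions.\<close>
  obtain l where l: "fi_hom R P (coind A) l"
    "\<And>X v. finite X \<Longrightarrow> v \<in> carrier (obj P X) \<Longrightarrow>
      (\<lambda>i\<in>with_none X. g (X - set_option i) (l X v i)) = to_coind e P h X v"
    using projective_lift[OF P fi_epi_coind[OF g] fi_hom_to_coind[OF PM e h], of "\<lambda>X. c"]
      coind_code_inj_on[OF c] by blast
  have "g X (from_coind e A l X v) = h X v" if X: "finite X" and v: "v \<in> carrier (obj (shift e P) X)" for X v
  proof -
    have "v \<in> carrier (obj P (add_point e X))" using v by simp
    then show ?thesis
      using l(2)[OF finite_add_point[OF X]] unfolding from_coind_epi[OF fi_epi_hom[OF g] e l(1) X v]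
        from_to_coind[OF PM e h X v, symmetric] by (simp add: from_coind_def)
  qed
  then show "\<exists>l. fi_hom R (shift e P) A l \<and>
      (\<forall>X. finite X \<longrightarrow> (\<forall>v\<in>carrier (obj (shift e P) X). g X (l X v) = h X v))"
    using fi_hom_from_coind[OF A e l(1)] by blast
qed

lemma projective_shift_retraction:
  fixes P :: "('x, 'k, 'u) fi_mod"
  assumes P: "fi_projective R P" and e: "inj e" and c: "coind_code (c :: ('x option \<Rightarrow> 'u) \<Rightarrow> 'u)"
  obtains \<rho> where "fi_hom R (shift e P) P \<rho>"
    "\<And>X v. finite X \<Longrightarrow> v \<in> carrier (obj P X) \<Longrightarrow> \<rho> X (shift_incl e P X v) = v"
proof -
  note PM = fi_projective_module[OF P]
  obtain l where l: "fi_hom R P (coind P) l"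
    "\<And>X v. finite X \<Longrightarrow> v \<in> carrier (obj P X) \<Longrightarrow> l X v None = v"
    using projective_lift[OF P fi_epi_coind_None[OF PM] fi_hom_id[OF PM], of "\<lambda>X. c"]
      coind_code_inj_on[OF c] by blast
  show thesis
    by (rule that[OF fi_hom_from_coind[OF PM e l(1)]])
      (simp add: from_coind_shift_incl[OF PM e l(1)] l(2))
qed

section \<open>Resolutions and lifts\<close>

lemma projective_resolutionD:
  assumes "projective_resolution R V P"
  shows res_projective: "fi_projective R (res_term P n)"
    and res_module: "fi_module R (res_term P n)"
    and res_hom: "fi_hom R (res_term P (Suc n)) (res_term P n) (res_diff P n)"
    and res_aug_epi: "fi_epi R (res_term P 0) V (res_aug P)"
    and res_exact: "finite X \<Longrightarrow> res_diff P (Suc n) X ` carrier (obj (res_term P (Suc (Suc n))) X) =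
      {v \<in> carrier (obj (res_term P (Suc n)) X). res_diff P n X v = \<zero>\<^bsub>obj (res_term P n) X\<^esub>}"
    and res_exact_aug: "finite X \<Longrightarrow> res_diff P 0 X ` carrier (obj (res_term P (Suc 0)) X) =
      {v \<in> carrier (obj (res_term P 0) X). res_aug P X v = \<zero>\<^bsub>obj V X\<^esub>}"
proof -
  note * = assms[unfolded projective_resolution_def]
  have p: "fi_projective R (res_term P n)" for n using *[THEN conjunct1] by simp
  have e: "fi_exact R (res_term P (Suc (Suc n))) (res_term P (Suc n)) (res_term P n)
      (res_diff P (Suc n)) (res_diff P n)" for n using *[THEN conjunct2, THEN conjunct1] by simp
  have e0: "fi_exact R (res_term P 1) (res_term P 0) V (res_diff P 0) (res_aug P)"
    using *[THEN conjunct2, THEN conjunct2, THEN conjunct1] .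
  show "fi_projective R (res_term P n)" by (rule p)
  show "fi_module R (res_term P n)" by (rule fi_projective_module[OF p])
  show "fi_epi R (res_term P 0) V (res_aug P)"
    using *[THEN conjunct2, THEN conjunct2, THEN conjunct2] .
  show "fi_hom R (res_term P (Suc n)) (res_term P n) (res_diff P n)"
    using e0 e by (cases n) (simp_all add: fi_exact_def)
  show "finite X \<Longrightarrow> res_diff P (Suc n) X ` carrier (obj (res_term P (Suc (Suc n))) X) =
      {v \<in> carrier (obj (res_term P (Suc n)) X). res_diff P n X v = \<zero>\<^bsub>obj (res_term P n) X\<^esub>}"
    using e by (simp add: fi_exact_def fi_image_def fi_kernel_def)
  show "finite X \<Longrightarrow> res_diff P 0 X ` carrier (obj (res_term P (Suc 0)) X) =
      {v \<in> carrier (obj (res_term P 0) X). res_aug P X v = \<zero>\<^bsub>obj V X\<^esub>}"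
    using e0 by (simp add: fi_exact_def fi_image_def fi_kernel_def)
qed

lemma res_diff_diff:
  assumes "projective_resolution R V P" "finite X" "v \<in> carrier (obj (res_term P (Suc (Suc n))) X)"
  shows "res_diff P n X (res_diff P (Suc n) X v) = \<zero>\<^bsub>obj (res_term P n) X\<^esub>"
  using res_exact[OF assms(1,2), of n] assms(3) by blast

lemma res_aug_diff:
  assumes "projective_resolution R V P" "finite X" "v \<in> carrier (obj (res_term P (Suc 0)) X)"
  shows "res_aug P X (res_diff P 0 X v) = \<zero>\<^bsub>obj V X\<^esub>"
  using res_exact_aug[OF assms(1,2)] assms(3) by blast

lemma is_liftD:
  assumes "is_lift R P Q \<phi> \<Phi>"
  shows lift_hom: "fi_hom R (res_term P n) (res_term Q n) (\<Phi> n)"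
    and lift_diff: "finite X \<Longrightarrow> v \<in> carrier (obj (res_term P (Suc n)) X) \<Longrightarrow>
        \<Phi> n X (res_diff P n X v) = res_diff Q n X (\<Phi> (Suc n) X v)"
    and lift_aug: "finite X \<Longrightarrow> v \<in> carrier (obj (res_term P 0) X) \<Longrightarrow>
        res_aug Q X (\<Phi> 0 X v) = \<phi> X (res_aug P X v)"
  using assms unfolding is_lift_def by simp_all

lemma is_lift_comp:
  assumes "is_lift R P Q \<phi> \<Phi>" "is_lift R Q S \<psi> \<Psi>"
    and P: "projective_resolution R V P"
  shows "is_lift R P S (\<lambda>X v. \<psi> X (\<phi> X v)) (\<lambda>n X v. \<Psi> n X (\<Phi> n X v))"
  unfolding is_lift_def
  using fi_hom_comp[OF lift_hom[OF assms(1)] lift_hom[OF assms(2)]]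
  by (simp add: lift_diff[OF assms(1)] lift_diff[OF assms(2)] lift_aug[OF assms(1)] lift_aug[OF assms(2)]
      fi_hom_closed[OF lift_hom[OF assms(1)]])

lemma is_lift_id:
  assumes P: "projective_resolution R V P"
  shows "is_lift R P P (\<lambda>X v. v) (\<lambda>n X v. v)"
  unfolding is_lift_def by (simp add: fi_hom_id res_module[OF P])

text \<open>The comparison theorem. Each map is lifted through a differential of \<open>Q\<close>,
  and the lifting problem in degree \<open>n + 1\<close> involves the map chosen in degree
  \<open>n\<close>, hence the dependent choice.\<close>

lemma lift_exists:
  fixes V :: "('x, 'k, 'm) fi_mod" and P :: "('x, 'k, 'm, 'u) resolution"
    and W :: "('x, 'k, 'n) fi_mod" and Q :: "('x, 'k, 'n, 'u) resolution"
  assumes P: "projective_resolution R V P" and Q: "projective_resolution R W Q"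
    and \<phi>: "fi_hom R V W \<phi>"
  shows "\<exists>\<Phi>. is_lift R P Q \<phi> \<Phi>"
proof -
  \<comment> \<open>The invariant speaks of the current map alone. Its second clause is what makes
    the next lift possible; the third lets compatibility with the augmentations be read off from the
    map chosen in degree 0.\<close>
  define good where "good n f \<longleftrightarrow> fi_hom R (res_term P n) (res_term Q n) f \<and>
      (\<forall>X. finite X \<longrightarrow> (\<forall>v \<in> carrier (obj (res_term P (Suc n)) X).
        f X (res_diff P n X v) \<in> res_diff Q n X ` carrier (obj (res_term Q (Suc n)) X))) \<and>
      (n = 0 \<longrightarrow> (\<forall>X. finite X \<longrightarrow> (\<forall>v \<in> carrier (obj (res_term P 0) X).
        res_aug Q X (f X v) = \<phi> X (res_aug P X v))))" for n and f :: "'x set \<Rightarrow> 'u \<Rightarrow> 'u"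
  note dP = res_hom[OF P] and dQ = res_hom[OF Q]
  note aP = fi_epi_hom[OF res_aug_epi[OF P]]
  have "\<exists>\<Phi>. \<forall>n. good n (\<Phi> n) \<and>
      (\<forall>X. finite X \<longrightarrow> (\<forall>v \<in> carrier (obj (res_term P (Suc n)) X).
        \<Phi> n X (res_diff P n X v) = res_diff Q n X (\<Phi> (Suc n) X v)))"
  proof (rule dependent_nat_choice)
    obtain f where f: "fi_hom R (res_term P 0) (res_term Q 0) f"
      "\<And>X v. finite X \<Longrightarrow> v \<in> carrier (obj (res_term P 0) X) \<Longrightarrow> res_aug Q X (f X v) = \<phi> X (res_aug P X v)"
      using projective_lift'[OF res_projective[OF P] res_aug_epi[OF Q] fi_hom_comp[OF aP \<phi>]] by blast
    have "good 0 f" unfolding good_def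
    proof (intro conjI allI impI ballI)
      fix X v assume *: "finite X" "v \<in> carrier (obj (res_term P (Suc 0)) X)"
      show "f X (res_diff P 0 X v) \<in> res_diff Q 0 X ` carrier (obj (res_term Q (Suc 0)) X)"
        unfolding res_exact_aug[OF Q *(1)]
        using * by (simp add: f(2) fi_hom_closed[OF f(1)] fi_hom_closed[OF dP] res_aug_diff[OF P]
            fi_hom_zero[OF \<phi>])
    qed (simp_all add: f)
    then show "\<exists>f. good 0 f" by (rule exI[where x = f])
  next
    fix f n assume "good n f"
    then have f: "fi_hom R (res_term P n) (res_term Q n) f"
      and im: "\<And>X v. finite X \<Longrightarrow> v \<in> carrier (obj (res_term P (Suc n)) X) \<Longrightarrow>
        f X (res_diff P n X v) \<in> res_diff Q n X ` carrier (obj (res_term Q (Suc n)) X)"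
      by (simp_all add: good_def)
    obtain g where g: "fi_hom R (res_term P (Suc n)) (res_term Q (Suc n)) g"
      "\<And>X v. finite X \<Longrightarrow> v \<in> carrier (obj (res_term P (Suc n)) X) \<Longrightarrow>
        res_diff Q n X (g X v) = f X (res_diff P n X v)"
      using projective_lift_image[OF res_projective[OF P] dQ fi_hom_comp[OF dP f]] im by blast
    have "good (Suc n) g" unfolding good_def
    proof (intro conjI allI impI ballI)
      fix X v assume *: "finite X" "v \<in> carrier (obj (res_term P (Suc (Suc n))) X)"
      show "g X (res_diff P (Suc n) X v) \<in> res_diff Q (Suc n) X ` carrier (obj (res_term Q (Suc (Suc n))) X)"
        unfolding res_exact[OF Q *(1)]
        using * by (simp add: g(2) fi_hom_closed[OF g(1)] fi_hom_closed[OF dP] res_diff_diff[OF P]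
            fi_hom_zero[OF f])
    qed (simp_all add: g)
    then show "\<exists>g. good (Suc n) g \<and> (\<forall>X. finite X \<longrightarrow> (\<forall>v\<in>carrier (obj (res_term P (Suc n)) X).
        f X (res_diff P n X v) = res_diff Q n X (g X v)))"
      by (intro exI[where x = g] conjI allI impI ballI) (simp_all only: g(2))
  qed
  then obtain \<Phi> where *: "\<forall>n. good n (\<Phi> n) \<and>
      (\<forall>X. finite X \<longrightarrow> (\<forall>v \<in> carrier (obj (res_term P (Suc n)) X).
        \<Phi> n X (res_diff P n X v) = res_diff Q n X (\<Phi> (Suc n) X v)))" by (rule exE)
  note \<Phi> = *[rule_format, THEN conjunct1] *[THEN spec, THEN conjunct2]
  have "is_lift R P Q \<phi> \<Phi>"
    unfolding is_lift_def
  proof (intro conjI allI)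
    show "fi_hom R (res_term P n) (res_term Q n) (\<Phi> n)" for n using \<Phi>(1)[of n] by (simp add: good_def)
    show "finite X \<longrightarrow> (\<forall>v \<in> carrier (obj (res_term P (Suc n)) X).
        \<Phi> n X (res_diff P n X v) = res_diff Q n X (\<Phi> (Suc n) X v))" for n X
      by (rule spec[OF \<Phi>(2)])
    show "finite X \<longrightarrow> (\<forall>v \<in> carrier (obj (res_term P 0) X).
        res_aug Q X (\<Phi> 0 X v) = \<phi> X (res_aug P X v))" for X
      using \<Phi>(1)[of 0] by (simp add: good_def)
  qed
  then show ?thesis by (rule exI[where x = \<Phi>])
qed


section \<open>Cycles and boundaries on representatives\<close>

text \<open>
  The homology of \<open>F P\<close> at \<open>n\<close> is \<open>fi_cycles / fi_boundaries\<close>, both submodules of \<open>P\<^sub>n\<close> itself;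
  \<open>fi_class\<close> is the quotient map.
\<close>

definition fi_cycles ::
  "('k, 'r) ring_scheme \<Rightarrow> ('x, 'k, 'm, 'u) resolution \<Rightarrow> nat \<Rightarrow> 'x set \<Rightarrow> 'u set" where
  "fi_cycles R P n X = {v \<in> carrier (obj (res_term P n) X).
     \<forall>m. n = Suc m \<longrightarrow> res_diff P m X v \<in> fi_J R (res_term P m) X}"

definition fi_boundaries ::
  "('k, 'r) ring_scheme \<Rightarrow> ('x, 'k, 'm, 'u) resolution \<Rightarrow> nat \<Rightarrow> 'x set \<Rightarrow> 'u set" where
  "fi_boundaries R P n X = {v \<in> carrier (obj (res_term P n) X).
     \<exists>w \<in> carrier (obj (res_term P (Suc n)) X).
       v \<ominus>\<^bsub>obj (res_term P n) X\<^esub> res_diff P n X w \<in> fi_J R (res_term P n) X}"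

definition fi_class ::
  "('k, 'r) ring_scheme \<Rightarrow> ('x, 'k, 'm, 'u) resolution \<Rightarrow> nat \<Rightarrow> 'x set \<Rightarrow> 'u \<Rightarrow> 'u set set" where
  "fi_class R P n X v = boundaries (F_terms R P) (F_diffs R P) n X
     +>\<^bsub>obj (fi_sub (F_terms R P n) (cycles (F_terms R P) (F_diffs R P) n)) X\<^esub>
     (fi_J R (res_term P n) X +>\<^bsub>obj (res_term P n) X\<^esub> v)"

text \<open>The difference \<open>D\<close> of two lifts is \<open>d s + s d\<close> for a chain
  homotopy \<open>s\<close>. On a cycle \<open>v\<close> of \<open>F P\<close> the term
  \<open>s (d v)\<close> lies in \<open>J\<close>, because \<open>d v\<close> does and homomorphisms
  preserve \<open>J\<close>; what is left is the boundary \<open>d (s v)\<close>.\<close>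

lemma lifts_agree:
  fixes V :: "('x, 'k, 'm) fi_mod" and P :: "('x, 'k, 'm, 'u) resolution"
    and W :: "('x, 'k, 'n) fi_mod" and Q :: "('x, 'k, 'n, 'u) resolution"
  assumes P: "projective_resolution R V P" and Q: "projective_resolution R W Q"
    and f: "is_lift R P Q \<phi> f" and g: "is_lift R P Q \<phi> g"
    and X: "finite X" and v: "v \<in> fi_cycles R P n X"
  shows "f n X v \<ominus>\<^bsub>obj (res_term Q n) X\<^esub> g n X v \<in> fi_boundaries R Q n X"
proof -
  note dP = res_hom[OF P] and dQ = res_hom[OF Q]
  note fh = lift_hom[OF f] and gh = lift_hom[OF g]
  define D where "D n X v = f n X v \<ominus>\<^bsub>obj (res_term Q n) X\<^esub> g n X v" for n X v
  have D: "fi_hom R (res_term P n) (res_term Q n) (D n)" for n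
    unfolding D_def[abs_def] by (rule fi_hom_diff[OF fh gh])
  have Dd: "res_diff Q n X (D (Suc n) X v) = D n X (res_diff P n X v)"
    if "finite X" "v \<in> carrier (obj (res_term P (Suc n)) X)" for n X v
    using that by (simp add: D_def fi_hom_minus[OF dQ] fi_hom_closed[OF fh] fi_hom_closed[OF gh]
        lift_diff[OF f] lift_diff[OF g])
  \<comment> \<open>The next component of the homotopy has to lift \<open>?E n s\<close> through the
    differential of \<open>Q\<close>.\<close>
  let ?E = "\<lambda>n s X v. D (Suc n) X v \<ominus>\<^bsub>obj (res_term Q (Suc n)) X\<^esub> s X (res_diff P n X v)"
  define good where "good n s \<longleftrightarrow> fi_hom R (res_term P n) (res_term Q (Suc n)) s \<and>
      (\<forall>X. finite X \<longrightarrow> (\<forall>v \<in> carrier (obj (res_term P (Suc n)) X).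
        ?E n s X v \<in> res_diff Q (Suc n) X ` carrier (obj (res_term Q (Suc (Suc n))) X))) \<and>
      (n = 0 \<longrightarrow> (\<forall>X. finite X \<longrightarrow> (\<forall>v \<in> carrier (obj (res_term P 0) X).
        res_diff Q 0 X (s X v) = D 0 X v)))" for n and s :: "'x set \<Rightarrow> 'u \<Rightarrow> 'u"
  have "\<exists>s. \<forall>n. good n (s n) \<and>
      (\<forall>X. finite X \<longrightarrow> (\<forall>v \<in> carrier (obj (res_term P (Suc n)) X).
        res_diff Q (Suc n) X (s (Suc n) X v) = ?E n (s n) X v))"
  proof (rule dependent_nat_choice)
    have "D 0 X v \<in> res_diff Q 0 X ` carrier (obj (res_term Q (Suc 0)) X)"
      if "finite X" "v \<in> carrier (obj (res_term P 0) X)" for X v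
    proof -
      note a = fi_epi_hom[OF res_aug_epi[OF Q]]
      interpret W: module R "obj W X" by (rule fi_obj[OF fi_hom_cod[OF a] that(1)])
      show ?thesis unfolding res_exact_aug[OF Q that(1)] using that fi_hom_closed[OF a that(1)]
        by (simp add: fi_hom_closed[OF D]) (simp add: D_def fi_hom_minus[OF a] fi_hom_closed[OF fh]
            fi_hom_closed[OF gh] lift_aug[OF f, symmetric] lift_aug[OF g, unfolded lift_aug[OF f, symmetric]])
    qed
    from projective_lift_image[OF res_projective[OF P] dQ D this]
    obtain s where s: "fi_hom R (res_term P 0) (res_term Q (Suc 0)) s"
      "\<And>X v. finite X \<Longrightarrow> v \<in> carrier (obj (res_term P 0) X) \<Longrightarrow> res_diff Q 0 X (s X v) = D 0 X v"
      by blast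
    have "good 0 s" unfolding good_def
    proof (intro conjI allI impI ballI)
      fix X v assume X: "finite X" and v: "v \<in> carrier (obj (res_term P (Suc 0)) X)"
      note dv = fi_hom_closed[OF dP X v]
      interpret Q0: module R "obj (res_term Q 0) X" by (rule fi_obj[OF res_module[OF Q] X])
      interpret Q1: module R "obj (res_term Q (Suc 0)) X" by (rule fi_obj[OF res_module[OF Q] X])
      show "?E 0 s X v \<in> res_diff Q (Suc 0) X ` carrier (obj (res_term Q (Suc (Suc 0))) X)"
        unfolding res_exact[OF Q X]
        by (simp add: fi_hom_minus[OF dQ X] fi_hom_closed[OF D X] fi_hom_closed[OF s(1) X] dv v
            Dd[OF X] s(2)[OF X])
    qed (simp_all add: s)
    then show "\<exists>s. good 0 s" by (rule exI[where x = s])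
  next
    fix s n assume "good n s"
    then have s: "fi_hom R (res_term P n) (res_term Q (Suc n)) s"
      and im: "\<And>X v. finite X \<Longrightarrow> v \<in> carrier (obj (res_term P (Suc n)) X) \<Longrightarrow>
        ?E n s X v \<in> res_diff Q (Suc n) X ` carrier (obj (res_term Q (Suc (Suc n))) X)"
      by (simp_all add: good_def)
    from projective_lift_image[OF res_projective[OF P] dQ fi_hom_diff[OF D fi_hom_comp[OF dP s]] im]
    obtain t where t: "fi_hom R (res_term P (Suc n)) (res_term Q (Suc (Suc n))) t"
      "\<And>X v. finite X \<Longrightarrow> v \<in> carrier (obj (res_term P (Suc n)) X) \<Longrightarrow>
        res_diff Q (Suc n) X (t X v) = ?E n s X v" by blast
    have "good (Suc n) t" unfolding good_def
    proof (intro conjI allI impI ballI)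
      fix X v assume X: "finite X" and v: "v \<in> carrier (obj (res_term P (Suc (Suc n))) X)"
      note dv = fi_hom_closed[OF dP X v]
      interpret Q1: module R "obj (res_term Q (Suc n)) X" by (rule fi_obj[OF res_module[OF Q] X])
      interpret Q2: module R "obj (res_term Q (Suc (Suc n))) X" by (rule fi_obj[OF res_module[OF Q] X])
      show "?E (Suc n) t X v \<in> res_diff Q (Suc (Suc n)) X ` carrier (obj (res_term Q (Suc (Suc (Suc n)))) X)"
        unfolding res_exact[OF Q X]
        by (simp add: fi_hom_minus[OF dQ X] fi_hom_closed[OF D X] fi_hom_closed[OF t(1) X] dv v
            Dd[OF X] t(2)[OF X] res_diff_diff[OF P X] fi_hom_zero[OF s X])
    qed (simp_all add: t)
    then show "\<exists>t. good (Suc n) t \<and> (\<forall>X. finite X \<longrightarrow> (\<forall>v\<in>carrier (obj (res_term P (Suc n)) X).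
        res_diff Q (Suc n) X (t X v) = ?E n s X v))"
      by (intro exI[where x = t] conjI allI impI ballI) (simp_all only: t(2))
  qed
  then obtain s where *: "\<forall>n. good n (s n) \<and>
      (\<forall>X. finite X \<longrightarrow> (\<forall>v \<in> carrier (obj (res_term P (Suc n)) X).
        res_diff Q (Suc n) X (s (Suc n) X v) = ?E n (s n) X v))" by (rule exE)
  note s = *[rule_format, THEN conjunct1] and rel = *[THEN spec, THEN conjunct2, rule_format]
  have sh: "fi_hom R (res_term P n) (res_term Q (Suc n)) (s n)" for n using s by (simp add: good_def)
  have v': "v \<in> carrier (obj (res_term P n) X)" using v by (simp add: fi_cycles_def)
  interpret Qn: module R "obj (res_term Q n) X" by (rule fi_obj[OF res_module[OF Q] X])
  have "D n X v \<ominus>\<^bsub>obj (res_term Q n) X\<^esub> res_diff Q n X (s n X v) \<in> fi_J R (res_term Q n) X"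
  proof (cases n)
    case 0
    have "res_diff Q 0 X (s 0 X v) = D 0 X v" using s[of 0] X v' 0 by (simp add: good_def)
    then show ?thesis
      using submodule_zero[OF fi_J_submodule_obj[OF res_module[OF Q] X]] fi_hom_closed[OF D X v'] 0
      by (simp add: Qn.minus_self[unfolded 0])
  next
    case (Suc m)
    have vm: "v \<in> carrier (obj (res_term P (Suc m)) X)" "res_diff P m X v \<in> fi_J R (res_term P m) X"
      using v Suc by (auto simp: fi_cycles_def)
    interpret Qm: module R "obj (res_term Q (Suc m)) X" by (rule fi_obj[OF res_module[OF Q] X])
    have c: "D (Suc m) X v \<in> carrier (obj (res_term Q (Suc m)) X)"
      "s m X (res_diff P m X v) \<in> carrier (obj (res_term Q (Suc m)) X)"
      by (simp_all add: fi_hom_closed[OF D X] fi_hom_closed[OF sh X] fi_hom_closed[OF dP X] vm)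
    \<comment> \<open>The homotopy relation is applied in degree \<open>m + 1\<close>: subtracting
      \<open>d (s v)\<close> from \<open>D v\<close> leaves \<open>s (d v)\<close>.\<close>
    have "D (Suc m) X v \<ominus>\<^bsub>obj (res_term Q (Suc m)) X\<^esub> ?E m (s m) X v = s m X (res_diff P m X v)"
      using c by (simp add: a_minus_def Qm.minus_add Qm.r_neg1 Qm.r_neg2)
    moreover have "s m X (res_diff P m X v) \<in> fi_J R (res_term Q (Suc m)) X"
      by (rule fi_J_hom[OF sh X vm(2)])
    ultimately show ?thesis using rel[OF X vm(1)] Suc by simp
  qed
  then show ?thesis
    unfolding fi_boundaries_def D_def[symmetric]
    using fi_hom_closed[OF D X v'] fi_hom_closed[OF sh X v'] by blast
qed

section \<open>The homology of \<open>F P\<close> in terms of representatives\<close>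

lemma fi_submodule_cycles:
  assumes P: "projective_resolution R V P"
  shows "fi_submodule R (res_term P n) (fi_cycles R P n)"
proof (cases n)
  case 0
  then have "fi_cycles R P n = (\<lambda>X. carrier (obj (res_term P n) X))" by (auto simp: fi_cycles_def)
  then show ?thesis using fi_submodule_carrier[OF res_module[OF P, of n]] by simp
next
  case (Suc m)
  then have "fi_cycles R P n = (\<lambda>X. {v \<in> carrier (obj (res_term P (Suc m)) X).
      res_diff P m X v \<in> fi_J R (res_term P m) X})" by (auto simp: fi_cycles_def)
  then show ?thesis
    using fi_submodule_preimage[OF res_hom[OF P] fi_submodule_J[OF res_module[OF P]], of m] Suc by simp
qed

lemma fi_submodule_sub:
  fixes V :: "('x, 'k, 'm) fi_mod"
  assumes "fi_module R V" "fi_submodule R V N" "fi_submodule R V M"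
    and "\<And>X. finite X \<Longrightarrow> M X \<subseteq> N X"
  shows "fi_submodule R (fi_sub V N) M"
  unfolding fi_submodule_def
proof (intro conjI allI impI ballI)
  fix X :: "'x set" assume X: "finite X"
  note M = fi_submodule_obj[OF assms(3) X]
  show "submodule (M X) R (obj (fi_sub V N) X)"
    by (rule submodule_intro[OF fi_obj[OF fi_module_sub[OF assms(1,2)] X]])
      (simp_all add: assms(4)[OF X] submodule_zero[OF M] submodule_add[OF M] submodule.smult_closed[OF M])
qed (simp add: fi_submodule_arr[OF assms(3)])

lemma fi_epi_sub:
  assumes "fi_epi R V W \<pi>" "fi_submodule R V N" "fi_submodule R W M"
    and "\<And>X. finite X \<Longrightarrow> \<pi> X ` N X = M X"
  shows "fi_epi R (fi_sub V N) (fi_sub W M) \<pi>"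
  unfolding fi_epi_def
  using fi_hom_to_sub[OF fi_hom_from_sub[OF fi_epi_hom[OF assms(1)] assms(2)] assms(3)] assms(4)
  by auto

lemma F_complex:
  assumes P: "projective_resolution R V P"
  shows F_terms_module: "fi_module R (F_terms R P n)"
    and F_terms_epi: "fi_epi R (res_term P n) (F_terms R P n)
      (\<lambda>X v. fi_J R (res_term P n) X +>\<^bsub>obj (res_term P n) X\<^esub> v)"
    and F_diffs_hom: "fi_hom R (F_terms R P (Suc n)) (F_terms R P n) (F_diffs R P n)"
    and F_diffs_coset: "finite X \<Longrightarrow> v \<in> carrier (obj (res_term P (Suc n)) X) \<Longrightarrow>
      F_diffs R P n X (fi_J R (res_term P (Suc n)) X +>\<^bsub>obj (res_term P (Suc n)) X\<^esub> v) =
      fi_J R (res_term P n) X +>\<^bsub>obj (res_term P n) X\<^esub> res_diff P n X v"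
    and F_terms_zero_iff: "finite X \<Longrightarrow> v \<in> carrier (obj (res_term P n) X) \<Longrightarrow>
      fi_J R (res_term P n) X +>\<^bsub>obj (res_term P n) X\<^esub> v = \<zero>\<^bsub>obj (F_terms R P n) X\<^esub> \<longleftrightarrow>
      v \<in> fi_J R (res_term P n) X"
proof -
  note d = res_hom[OF P]
  show e: "fi_epi R (res_term P n) (F_terms R P n)
      (\<lambda>X v. fi_J R (res_term P n) X +>\<^bsub>obj (res_term P n) X\<^esub> v)"
    unfolding F_terms_def by (rule fi_epi_F[OF res_module[OF P]])
  show "fi_module R (F_terms R P n)" by (rule fi_hom_cod[OF fi_epi_hom[OF e]])
  show "fi_hom R (F_terms R P (Suc n)) (F_terms R P n) (F_diffs R P n)"
    unfolding F_terms_def F_diffs_def by (rule fi_hom_F_map[OF d])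
  show "finite X \<Longrightarrow> v \<in> carrier (obj (res_term P (Suc n)) X) \<Longrightarrow>
      F_diffs R P n X (fi_J R (res_term P (Suc n)) X +>\<^bsub>obj (res_term P (Suc n)) X\<^esub> v) =
      fi_J R (res_term P n) X +>\<^bsub>obj (res_term P n) X\<^esub> res_diff P n X v"
    unfolding F_diffs_def by (rule fi_F_map_coset[OF d])
  show "finite X \<Longrightarrow> v \<in> carrier (obj (res_term P n) X) \<Longrightarrow>
      fi_J R (res_term P n) X +>\<^bsub>obj (res_term P n) X\<^esub> v = \<zero>\<^bsub>obj (F_terms R P n) X\<^esub> \<longleftrightarrow>
      v \<in> fi_J R (res_term P n) X"
    unfolding F_terms_def by (rule fi_F_coset_zero_iff[OF res_module[OF P]])
qed

text \<open>A coset is a cycle of \<open>F P\<close> exactly when the differential of a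
  representative lies in \<open>J\<close>. The representative is immaterial because the
  differentials preserve \<open>J\<close>.\<close>

lemma F_homology:
  fixes V :: "('x, 'k, 'm) fi_mod" and P :: "('x, 'k, 'm, 'u) resolution"
  assumes P: "projective_resolution R V P"
  shows fi_submodule_F_cycles: "fi_submodule R (F_terms R P n) (cycles (F_terms R P) (F_diffs R P) n)"
    and F_cycles_image: "finite X \<Longrightarrow> (\<lambda>v. fi_J R (res_term P n) X +>\<^bsub>obj (res_term P n) X\<^esub> v) `
      fi_cycles R P n X = cycles (F_terms R P) (F_diffs R P) n X"
    and fi_submodule_F_boundaries: "fi_submodule R
      (fi_sub (F_terms R P n) (cycles (F_terms R P) (F_diffs R P) n)) (boundaries (F_terms R P) (F_diffs R P) n)"
proof -
  let ?C = "F_terms R P" and ?d = "F_diffs R P"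
  let ?p = "\<lambda>n X v. fi_J R (res_term P n) X +>\<^bsub>obj (res_term P n) X\<^esub> v"
  note dh = F_diffs_hom[OF P] and e = F_terms_epi[OF P] and dc = F_diffs_coset[OF P]
    and z = F_terms_zero_iff[OF P]
  show cyc: "fi_submodule R (?C n) (cycles ?C ?d n)"
    using fi_submodule_kernel[OF dh] fi_submodule_carrier[OF F_terms_module[OF P]]
    by (cases n) (simp_all add: cycles_def)
  show "finite X \<Longrightarrow> (\<lambda>v. fi_J R (res_term P n) X +>\<^bsub>obj (res_term P n) X\<^esub> v) `
      fi_cycles R P n X = cycles ?C ?d n X" for X
  proof (cases n)
    case 0
    assume "finite X"
    then show ?thesis using fi_epi_surj[OF e, of X 0] 0 by (simp add: fi_cycles_def cycles_def)
  next
    case (Suc m)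
    assume X: "finite X"
    have "cycles ?C ?d n X = {c \<in> carrier (obj (?C (Suc m)) X). ?d m X c = \<zero>\<^bsub>obj (?C m) X\<^esub>}"
      by (simp add: Suc cycles_def fi_kernel_def)
    also have "\<dots> = ?p (Suc m) X ` {v \<in> carrier (obj (res_term P (Suc m)) X). res_diff P m X v \<in> fi_J R (res_term P m) X}"
    proof -
      have "?d m X (?p (Suc m) X v) = \<zero>\<^bsub>obj (?C m) X\<^esub> \<longleftrightarrow> res_diff P m X v \<in> fi_J R (res_term P m) X"
        if "v \<in> carrier (obj (res_term P (Suc m)) X)" for v
        using that by (simp only: dc[OF X] z[OF X] fi_hom_closed[OF res_hom[OF P] X])
      then show ?thesis unfolding fi_epi_surj[OF e X, symmetric] by blast
    qed
    finally show ?thesis by (simp add: Suc fi_cycles_def)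
  qed
  have bd: "fi_submodule R (?C n) (boundaries ?C ?d n)"
    using fi_submodule_image[OF dh fi_submodule_carrier[OF F_terms_module[OF P]]]
    by (simp add: boundaries_def fi_image_def[abs_def])
  show "fi_submodule R (fi_sub (?C n) (cycles ?C ?d n)) (boundaries ?C ?d n)"
  proof (rule fi_submodule_sub[OF F_terms_module[OF P] cyc bd])
    fix X :: "'x set" assume X: "finite X"
    show "boundaries ?C ?d n X \<subseteq> cycles ?C ?d n X"
    proof (cases n)
      case 0
      then show ?thesis using fi_hom_closed[OF dh X, of _ 0] by (auto simp: boundaries_def cycles_def fi_image_def)
    next
      case (Suc m)
      have "?d m X (?d (Suc m) X c) = \<zero>\<^bsub>obj (?C m) X\<^esub>" if c: "c \<in> carrier (obj (?C (Suc (Suc m))) X)" for c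
      proof -
        obtain v where v: "v \<in> carrier (obj (res_term P (Suc (Suc m))) X)"
          "c = fi_J R (res_term P (Suc (Suc m))) X +>\<^bsub>obj (res_term P (Suc (Suc m))) X\<^esub> v"
          using c by (auto simp: fi_epi_surj[OF e X, symmetric])
        show ?thesis
          using v fi_hom_closed[OF res_hom[OF P] X] z[OF X]
            submodule_zero[OF fi_J_submodule_obj[OF res_module[OF P] X]]
            submodule_zero[OF module.carrier_is_submodule[OF fi_obj[OF res_module[OF P] X]]]
          by (simp add: dc[OF X] res_diff_diff[OF P X])
      qed
      then show ?thesis using fi_hom_closed[OF dh X]
        by (auto simp: Suc boundaries_def cycles_def fi_image_def fi_kernel_def)
    qed
  qed
qed

lemma fi_epi_class:
  assumes P: "projective_resolution R V P"
  shows "fi_epi R (fi_sub (res_term P n) (fi_cycles R P n)) (homology (F_terms R P) (F_diffs R P) n)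
    (fi_class R P n)"
proof -
  let ?C = "F_terms R P" and ?d = "F_diffs R P"
  have "fi_epi R (fi_sub (res_term P n) (fi_cycles R P n)) (fi_sub (?C n) (cycles ?C ?d n))
      (\<lambda>X v. fi_J R (res_term P n) X +>\<^bsub>obj (res_term P n) X\<^esub> v)"
    by (rule fi_epi_sub[OF F_terms_epi[OF P] fi_submodule_cycles[OF P] fi_submodule_F_cycles[OF P]
          F_cycles_image[OF P]])
  from fi_epi_comp[OF this fi_epi_quotient[OF fi_hom_cod[OF fi_epi_hom[OF this]] fi_submodule_F_boundaries[OF P]]]
  show ?thesis by (simp add: homology_def fi_class_def[abs_def])
qed

text \<open>With \<open>fi_epi_class\<close> this identifies homology with \<open>fi_cycles\<close>
  modulo \<open>fi_boundaries\<close>. The exactness arguments then work with elements of the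
  resolution instead of cosets of cosets.\<close>

lemma fi_class_zero_iff:
  assumes P: "projective_resolution R V P" and X: "finite X" and v: "v \<in> fi_cycles R P n X"
  shows "fi_class R P n X v = \<zero>\<^bsub>obj (homology (F_terms R P) (F_diffs R P) n) X\<^esub> \<longleftrightarrow>
    v \<in> fi_boundaries R P n X"
proof -
  let ?C = "F_terms R P" and ?d = "F_diffs R P"
  let ?p = "\<lambda>n v. fi_J R (res_term P n) X +>\<^bsub>obj (res_term P n) X\<^esub> v"
  note cyc = fi_module_sub[OF F_terms_module[OF P] fi_submodule_F_cycles[OF P]]
  note e = F_terms_epi[OF P]
  note m = fi_obj[OF res_module[OF P] X]
  have v': "v \<in> carrier (obj (res_term P n) X)" using v by (simp add: fi_cycles_def)
  have pv: "?p n v \<in> carrier (obj (fi_sub (?C n) (cycles ?C ?d n)) X)"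
    using F_cycles_image[OF P X, of n] v by auto
  have "fi_class R P n X v = \<zero>\<^bsub>obj (homology ?C ?d n) X\<^esub> \<longleftrightarrow> ?p n v \<in> boundaries ?C ?d n X"
    using coset_eq_self_iff[OF fi_obj[OF cyc X] fi_submodule_obj[OF fi_submodule_F_boundaries[OF P] X] pv]
    by (simp add: fi_class_def homology_def)
  also have "\<dots> \<longleftrightarrow> (\<exists>w \<in> carrier (obj (res_term P (Suc n)) X). ?p n v = ?p n (res_diff P n X w))"
  proof -
    have "boundaries ?C ?d n X = (\<lambda>w. ?p n (res_diff P n X w)) ` carrier (obj (res_term P (Suc n)) X)"
      unfolding boundaries_def fi_image_def fi_epi_surj[OF e X, symmetric] image_image
      by (rule image_cong[OF refl F_diffs_coset[OF P X]])
    then show ?thesis by blast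
  qed
  also have "\<dots> \<longleftrightarrow> v \<in> fi_boundaries R P n X"
    using coset_eq_iff[OF m fi_J_submodule_obj[OF res_module[OF P] X] v'] v'
      fi_hom_closed[OF res_hom[OF P] X] by (auto simp: fi_boundaries_def)
  finally show ?thesis .
qed

lemma lift_cycles:
  assumes P: "projective_resolution R V P"
    and \<Phi>: "is_lift R P Q \<phi> \<Phi>" and X: "finite X" and v: "v \<in> fi_cycles R P n X"
  shows "\<Phi> n X v \<in> fi_cycles R Q n X"
proof -
  have v': "v \<in> carrier (obj (res_term P n) X)" using v by (simp add: fi_cycles_def)
  have "res_diff Q m X (\<Phi> n X v) \<in> fi_J R (res_term Q m) X" if n: "n = Suc m" for m
  proof -
    have "\<Phi> m X (res_diff P m X v) \<in> fi_J R (res_term Q m) X"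
      using v n by (intro fi_J_hom[OF lift_hom[OF \<Phi>] X]) (simp add: fi_cycles_def)
    then show ?thesis using lift_diff[OF \<Phi> X, of v m] v' n by simp
  qed
  then show ?thesis using fi_hom_closed[OF lift_hom[OF \<Phi>] X v'] by (simp add: fi_cycles_def)
qed

lemma lift_boundaries:
  assumes P: "projective_resolution R V P"
    and \<Phi>: "is_lift R P Q \<phi> \<Phi>" and X: "finite X" and v: "v \<in> fi_boundaries R P n X"
  shows "\<Phi> n X v \<in> fi_boundaries R Q n X"
proof -
  note h = lift_hom[OF \<Phi>]
  obtain w where v': "v \<in> carrier (obj (res_term P n) X)" and w: "w \<in> carrier (obj (res_term P (Suc n)) X)"
    "v \<ominus>\<^bsub>obj (res_term P n) X\<^esub> res_diff P n X w \<in> fi_J R (res_term P n) X"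
    using v by (auto simp: fi_boundaries_def)
  have "\<Phi> n X v \<ominus>\<^bsub>obj (res_term Q n) X\<^esub> res_diff Q n X (\<Phi> (Suc n) X w) =
      \<Phi> n X (v \<ominus>\<^bsub>obj (res_term P n) X\<^esub> res_diff P n X w)"
    using v' w(1) by (simp add: fi_hom_minus[OF h X] fi_hom_closed[OF res_hom[OF P] X] lift_diff[OF \<Phi> X])
  then have "\<Phi> n X v \<ominus>\<^bsub>obj (res_term Q n) X\<^esub> res_diff Q n X (\<Phi> (Suc n) X w) \<in> fi_J R (res_term Q n) X"
    using fi_J_hom[OF h X w(2)] by simp
  then show ?thesis
    unfolding fi_boundaries_def using fi_hom_closed[OF h X v'] fi_hom_closed[OF h X w(1)] by blast
qed

text \<open>The prescribed map on homology acts on cosets of cosets; it is computed by applying the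
  lift to a representative.\<close>

lemma homology_map_class:
  fixes P :: "('x, 'k, 'm, 'u) resolution" and Q :: "('x, 'k, 'n, 'w) resolution"
  assumes P: "projective_resolution R V P" and Q: "projective_resolution R W Q"
    and \<Phi>: "is_lift R P Q \<phi> \<Phi>"
  shows fi_hom_homology_map:
      "fi_hom R (homology (F_terms R P) (F_diffs R P) n) (homology (F_terms R Q) (F_diffs R Q) n)
        (homology_map (F_terms R Q) (F_diffs R Q) n (fi_F_map R (res_term Q n) (\<Phi> n)))"
    and homology_map_fi_class: "finite X \<Longrightarrow> v \<in> fi_cycles R P n X \<Longrightarrow>
      homology_map (F_terms R Q) (F_diffs R Q) n (fi_F_map R (res_term Q n) (\<Phi> n)) X (fi_class R P n X v) =
      fi_class R Q n X (\<Phi> n X v)"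
proof -
  let ?C = "F_terms R P" and ?d = "F_diffs R P" and ?D = "F_terms R Q" and ?e = "F_diffs R Q"
  let ?p = "\<lambda>X v. fi_J R (res_term P n) X +>\<^bsub>obj (res_term P n) X\<^esub> v"
  let ?q = "\<lambda>X v. fi_J R (res_term Q n) X +>\<^bsub>obj (res_term Q n) X\<^esub> v"
  let ?\<psi> = "fi_F_map R (res_term Q n) (\<Phi> n)"
  note h = lift_hom[OF \<Phi>]
  have \<psi>: "fi_hom R (?C n) (?D n) ?\<psi>"
    unfolding F_terms_def by (rule fi_hom_F_map[OF h])
  have \<psi>c: "?\<psi> X (?p X v) = ?q X (\<Phi> n X v)" if "finite X" "v \<in> carrier (obj (res_term P n) X)" for X v
    by (rule fi_F_map_coset[OF h that])
  have \<psi>s: "fi_hom R (fi_sub (?C n) (cycles ?C ?d n)) (fi_sub (?D n) (cycles ?D ?e n)) ?\<psi>"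
  proof (rule fi_hom_to_sub[OF fi_hom_from_sub[OF \<psi> fi_submodule_F_cycles[OF P]] fi_submodule_F_cycles[OF Q]])
    fix X c assume X: "finite X" and "c \<in> carrier (obj (fi_sub (?C n) (cycles ?C ?d n)) X)"
    then obtain v where v: "v \<in> fi_cycles R P n X" "c = ?p X v" using F_cycles_image[OF P X, of n] by auto
    then show "?\<psi> X c \<in> cycles ?D ?e n X"
      unfolding F_cycles_image[OF Q X, symmetric] using lift_cycles[OF P \<Phi> X v(1)]
      by (auto simp: \<psi>c[OF X] fi_cycles_def)
  qed
  have \<psi>b: "?\<psi> X c \<in> boundaries ?D ?e n X" if X: "finite X" and c: "c \<in> boundaries ?C ?d n X" for X c
  proof -
    obtain w where w: "w \<in> carrier (obj (res_term P (Suc n)) X)"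
      "c = ?d n X (fi_J R (res_term P (Suc n)) X +>\<^bsub>obj (res_term P (Suc n)) X\<^esub> w)"
      using c by (auto simp: boundaries_def fi_image_def fi_epi_surj[OF F_terms_epi[OF P] X, symmetric])
    have "?\<psi> X c = ?e n X (fi_J R (res_term Q (Suc n)) X +>\<^bsub>obj (res_term Q (Suc n)) X\<^esub> \<Phi> (Suc n) X w)"
      using w by (simp add: F_diffs_coset[OF P X] F_diffs_coset[OF Q X] fi_hom_closed[OF h X] \<psi>c[OF X]
          fi_hom_closed[OF res_hom[OF P] X] lift_diff[OF \<Phi> X])
    then show ?thesis
      using fi_hom_closed[OF fi_epi_hom[OF F_terms_epi[OF Q]] X fi_hom_closed[OF h X w(1)]]
      by (simp add: boundaries_def fi_image_def)
  qed
  note B = fi_submodule_F_boundaries[OF P] fi_submodule_F_boundaries[OF Q]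
  show "fi_hom R (homology ?C ?d n) (homology ?D ?e n) (homology_map ?D ?e n ?\<psi>)"
    unfolding homology_def homology_map_def by (rule fi_hom_quotient_map[OF \<psi>s B \<psi>b])
  show "homology_map ?D ?e n ?\<psi> X (fi_class R P n X v) = fi_class R Q n X (\<Phi> n X v)"
    if X: "finite X" and v: "v \<in> fi_cycles R P n X"
  proof -
    have pv: "?p X v \<in> carrier (obj (fi_sub (?C n) (cycles ?C ?d n)) X)"
      using F_cycles_image[OF P X, of n] v by auto
    show ?thesis
      unfolding homology_map_def fi_class_def
      using fi_quotient_map_coset[OF \<psi>s B \<psi>b[OF X] X pv] v by (simp add: \<psi>c[OF X] fi_cycles_def)
  qed
qed

section \<open>Encoding finitely supported functions as lists\<close>

text \<open>A self-delimiting code: \<open>t\<close> announces another entry and \<open>s\<close>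
  ends the list, so the entries themselves may be any letters, including \<open>t\<close> and
  \<open>s\<close>.\<close>

fun list_code :: "'a \<Rightarrow> 'a \<Rightarrow> 'a list \<Rightarrow> 'a list" where
  "list_code t s [] = [s]"
| "list_code t s (x # xs) = t # x # list_code t s xs"

text \<open>The arbitrary tails express that the code is prefix-free, which is what makes a
  concatenation of codes decodable.\<close>

lemma list_code_append_eq:
  assumes "t \<noteq> s"
  shows "list_code t s xs @ zs = list_code t s xs' @ zs' \<longleftrightarrow> xs = xs' \<and> zs = zs'"
proof (induction xs arbitrary: xs')
  case Nil
  show ?case using assms by (cases xs') auto
next
  case (Cons x xs)
  show ?case using assms Cons by (cases xs') auto
qed

lemma inj_concat_list_code:
  assumes "t \<noteq> s"
  shows "inj (\<lambda>xss. concat (map (list_code t s) xss))"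
proof (rule injI)
  have ne: "list_code t s xs \<noteq> []" for xs by (cases xs) auto
  fix xss yss assume "concat (map (list_code t s) xss) = concat (map (list_code t s) yss)"
  then show "xss = yss"
  proof (induction xss arbitrary: yss)
    case Nil
    then show ?case using ne by (cases yss) auto
  next
    case (Cons xs xss)
    then show ?case using ne list_code_append_eq[OF assms] by (cases yss) auto
  qed
qed

lemma inj_list_list_code:
  assumes "t \<noteq> (s :: 'a)"
  shows "\<exists>c :: 'a list list \<Rightarrow> 'a list. inj c"
  using inj_concat_list_code[OF assms] by blast

text \<open>A finitely supported function is recorded by the list of its pairs (index, value) over
  the support; each pair, and then the whole list, is packed with the list-of-lists code.\<close>

lemma finite_support_code:
  assumes ts: "t \<noteq> (s :: 'a)" and \<iota>: "inj (\<iota> :: 'i \<Rightarrow> 'a list)" and \<kappa>: "inj (\<kappa> :: 'w \<Rightarrow> 'a list)"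
  shows "\<exists>c :: ('i \<Rightarrow> 'w) \<Rightarrow> 'a list. inj_on c {f. finite {i. f i \<noteq> z}}"
proof -
  obtain E :: "'a list list \<Rightarrow> 'a list" where E: "inj E" using inj_list_list_code[OF ts] by blast
  \<comment> \<open>Any enumeration of the support will do: equal codes give equal lists of pairs,
    hence equal graphs over the supports, and outside the supports both functions are
    \<open>z\<close>.\<close>
  define l where "l f = (SOME l. set l = {i. f i \<noteq> z})" for f :: "'i \<Rightarrow> 'w"
  define c where "c f = E (map (\<lambda>i. E [\<iota> i, \<kappa> (f i)]) (l f))" for f
  have l: "set (l f) = {i. f i \<noteq> z}" if "finite {i. f i \<noteq> z}" for f
    unfolding l_def using finite_list[OF that] by (rule someI_ex)
  have "f = g" if f: "finite {i. f i \<noteq> z}" and g: "finite {i. g i \<noteq> z}" and "c f = c g" for f g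
  proof -
    have eq: "map (\<lambda>i. E [\<iota> i, \<kappa> (f i)]) (l f) = map (\<lambda>i. E [\<iota> i, \<kappa> (g i)]) (l g)"
      using \<open>c f = c g\<close> injD[OF E] by (simp add: c_def)
    have "map (\<lambda>i. (i, f i)) (l f) = map (\<lambda>i. (i, g i)) (l g)"
    proof -
      let ?p = "\<lambda>(i, w). E [\<iota> i, \<kappa> w]"
      have "inj ?p" using injD[OF E] injD[OF \<iota>] injD[OF \<kappa>] by (force intro!: injI)
      moreover have "map ?p (map (\<lambda>i. (i, f i)) (l f)) = map ?p (map (\<lambda>i. (i, g i)) (l g))"
        using eq by (simp add: comp_def)
      ultimately show ?thesis using inj_map_eq_map by blast
    qed
    then have *: "set (map (\<lambda>i. (i, f i)) (l f)) = set (map (\<lambda>i. (i, g i)) (l g))" by simp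
    then have **: "(\<lambda>i. (i, f i)) ` {i. f i \<noteq> z} = (\<lambda>i. (i, g i)) ` {i. g i \<noteq> z}"
      by (simp add: l[OF f] l[OF g])
    show "f = g"
    proof
      fix i
      have "(i, f i) \<in> (\<lambda>i. (i, g i)) ` {i. g i \<noteq> z}" if "f i \<noteq> z" using ** that by blast
      moreover have "(i, g i) \<in> (\<lambda>i. (i, f i)) ` {i. f i \<noteq> z}" if "g i \<noteq> z" using ** that by blast
      ultimately show "f i = g i" by (cases "f i = z"; cases "g i = z") auto
    qed
  qed
  then have "inj_on c {f. finite {i. f i \<noteq> z}}" by (intro inj_onI) simp
  then show ?thesis by blast
qed

lemma coind_code_exists: "\<exists>c :: ('x option \<Rightarrow> ('x + 'k + 'm) list) \<Rightarrow> ('x + 'k + 'm) list. coind_code c"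
proof -
  have "inj (\<lambda>i :: 'x option. case i of None \<Rightarrow> [] | Some x \<Rightarrow> [Inl x :: 'x + 'k + 'm])"
    by (rule injI) (auto split: option.splits)
  \<comment> \<open>The two letters differ by their tags, whatever \<open>undefined\<close> is. The
    default value is again \<open>undefined\<close>, as for extensional functions off their
    domain.\<close>
  from finite_support_code[OF _ this, of "Inl undefined" "Inr (Inl undefined)" "\<lambda>x. x"]
  show ?thesis by (simp add: coind_code_def)
qed


section \<open>Free FI-modules and projective covers\<close>

text \<open>
  \<open>G n\<close> is a set of generators at a set with \<open>n\<close> elements.  A basis element at \<open>X\<close> is a generator
  in some \<open>G n\<close> with an injection \<open>{1, \<dots>, n} \<rightarrow> X\<close>, which is given as a list.
\<close>

definition free_basis :: "(nat \<Rightarrow> 'g set) \<Rightarrow> 'x set \<Rightarrow> ('x list \<times> 'g) set" where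
  "free_basis G X = {(xs, g). distinct xs \<and> set xs \<subseteq> X \<and> g \<in> G (length xs)}"

text \<open>Finitely supported coefficient functions on the basis. Since \<open>f\<close> is
  injective on \<open>X\<close>, a basis element at \<open>Y\<close> has at most one preimage, so
  pushing forward reads one coefficient instead of summing over a fibre.\<close>

definition free_fi ::
  "('k, 'r) ring_scheme \<Rightarrow> (nat \<Rightarrow> 'g set) \<Rightarrow> ('x, 'k, 'x list \<times> 'g \<Rightarrow> 'k) fi_mod" where
  "free_fi R G =
    \<lparr>obj = (\<lambda>X. \<lparr>carrier = {a. (\<forall>i. a i \<in> carrier R) \<and> finite {i. a i \<noteq> \<zero>\<^bsub>R\<^esub>} \<and>
         {i. a i \<noteq> \<zero>\<^bsub>R\<^esub>} \<subseteq> free_basis G X},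
       mult = undefined, one = undefined, zero = (\<lambda>i. \<zero>\<^bsub>R\<^esub>),
       add = (\<lambda>a b i. a i \<oplus>\<^bsub>R\<^esub> b i), smult = (\<lambda>r a i. r \<otimes>\<^bsub>R\<^esub> a i)\<rparr>),
     arr = (\<lambda>X Y f a (zs, g). if set zs \<subseteq> f ` X then a (map (inv_into X f) zs, g) else \<zero>\<^bsub>R\<^esub>)\<rparr>"

definition free_unit :: "('k, 'r) ring_scheme \<Rightarrow> 'i \<Rightarrow> 'i \<Rightarrow> 'k" where
  "free_unit R i = (\<lambda>j. if j = i then \<one>\<^bsub>R\<^esub> else \<zero>\<^bsub>R\<^esub>)"

lemma free_carrierI:
  assumes "\<And>i. a i \<in> carrier R" "{i. a i \<noteq> \<zero>\<^bsub>R\<^esub>} \<subseteq> S" "finite S" "S \<subseteq> free_basis G X"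
  shows "a \<in> carrier (obj (free_fi R G) X)"
  using assms finite_subset by (simp add: free_fi_def) blast

lemma free_carrierD:
  assumes "a \<in> carrier (obj (free_fi R G) X)"
  shows "a i \<in> carrier R" "finite {i. a i \<noteq> \<zero>\<^bsub>R\<^esub>}" "{i. a i \<noteq> \<zero>\<^bsub>R\<^esub>} \<subseteq> free_basis G X"
  using assms by (cases i, simp_all add: free_fi_def)

lemma free_fi_simps [simp]:
  "zero (obj (free_fi R G) X) = (\<lambda>i. \<zero>\<^bsub>R\<^esub>)"
  "add (obj (free_fi R G) X) a b = (\<lambda>i. a i \<oplus>\<^bsub>R\<^esub> b i)"
  "smult (obj (free_fi R G) X) r a = (\<lambda>i. r \<otimes>\<^bsub>R\<^esub> a i)"
  by (simp_all add: free_fi_def)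

lemma free_arr_map:
  assumes "inj_on f X" "set xs \<subseteq> X"
  shows "arr (free_fi R G) X Y f a (map f xs, g) = a (xs, g)"
proof -
  have "map (inv_into X f) (map f xs) = xs"
    using assms by (auto intro!: map_idI simp: comp_def)
  then show ?thesis using assms(2) by (auto simp: free_fi_def)
qed

lemma free_arr_notin:
  assumes "\<And>xs. set xs \<subseteq> X \<Longrightarrow> zs \<noteq> map f xs"
  shows "arr (free_fi R G) X Y f a (zs, g) = \<zero>\<^bsub>R\<^esub>"
proof -
  have "\<not> set zs \<subseteq> f ` X"
  proof
    assume *: "set zs \<subseteq> f ` X"
    then have "zs = map f (map (inv_into X f) zs)"
      by (auto intro!: map_idI[symmetric] simp: comp_def f_inv_into_f)
    moreover have "set (map (inv_into X f) zs) \<subseteq> X" using * by (auto intro: inv_into_into)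
    ultimately show False using assms by blast
  qed
  then show ?thesis by (simp add: free_fi_def)
qed

text \<open>Pushing forward is determined by its values on lists that come from \<open>X\<close> and
  its vanishing on all others. This spares the functor laws any reasoning about
  \<open>inv_into\<close>.\<close>

lemma free_arr_eqI:
  fixes a b :: "'x list \<times> 'g \<Rightarrow> 'k"
  assumes f: "inj_on f X"
    and 1: "\<And>xs g. set xs \<subseteq> X \<Longrightarrow> b (map f xs, g) = a (xs, g)"
    and 2: "\<And>zs g. (\<And>xs. set xs \<subseteq> X \<Longrightarrow> zs \<noteq> map f xs) \<Longrightarrow> b (zs, g) = \<zero>\<^bsub>R\<^esub>"
  shows "arr (free_fi R G) X Y f a = b"
proof
  fix i :: "'x list \<times> 'g"
  obtain zs g where i: "i = (zs, g)" by (cases i)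
  show "arr (free_fi R G) X Y f a i = b i"
  proof (cases "\<exists>xs. set xs \<subseteq> X \<and> zs = map f xs")
    case True
    then obtain xs where xs: "set xs \<subseteq> X" "zs = map f xs" by blast
    show ?thesis by (simp only: i xs(2) free_arr_map[OF f xs(1)] 1[OF xs(1)])
  next
    case False
    then have *: "zs \<noteq> map f xs" if "set xs \<subseteq> X" for xs using that by blast
    have "arr (free_fi R G) X Y f a (zs, g) = \<zero>\<^bsub>R\<^esub>" by (rule free_arr_notin) (rule *)
    moreover have "b (zs, g) = \<zero>\<^bsub>R\<^esub>" by (rule 2) (rule *)
    ultimately show ?thesis by (simp only: i)
  qed
qed

lemma free_arr_cases:
  fixes i :: "'x list \<times> 'g" and G :: "nat \<Rightarrow> 'g set"
  assumes "inj_on f X"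
  obtains xs g where "set xs \<subseteq> X" "i = (map f xs, g)" "arr (free_fi R G) X Y f a i = a (xs, g)"
    | "arr (free_fi R G) X Y f a i = \<zero>\<^bsub>R\<^esub>"
proof -
  obtain zs g where i: "i = (zs, g)" by (cases i)
  show thesis
  proof (cases "\<exists>xs. set xs \<subseteq> X \<and> zs = map f xs")
    case True
    then obtain xs where xs: "set xs \<subseteq> X" "zs = map f xs" by blast
    show ?thesis
      by (rule that(1)[OF xs(1)]) (simp_all only: i xs(2) free_arr_map[OF assms xs(1)])
  next
    case False
    then have *: "zs \<noteq> map f xs" if "set xs \<subseteq> X" for xs using that by blast
    show ?thesis by (rule that(2), unfold i, rule free_arr_notin, rule *)
  qed
qed

lemma free_arr_support:
  fixes a :: "'x list \<times> 'g \<Rightarrow> 'k"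
  assumes "inj_on f X"
  shows "{i. arr (free_fi R G) X Y f a i \<noteq> \<zero>\<^bsub>R\<^esub>} \<subseteq> (\<lambda>(xs, g). (map f xs, g)) ` {i. a i \<noteq> \<zero>\<^bsub>R\<^esub>}"
proof
  fix i :: "'x list \<times> 'g" assume i: "i \<in> {i. arr (free_fi R G) X Y f a i \<noteq> \<zero>\<^bsub>R\<^esub>}"
  show "i \<in> (\<lambda>(xs, g). (map f xs, g)) ` {i. a i \<noteq> \<zero>\<^bsub>R\<^esub>}"
  proof (cases rule: free_arr_cases[OF assms, where i = i and R = R and G = G and Y = Y and a = a])
    case (1 xs g)
    then have "(xs, g) \<in> {i. a i \<noteq> \<zero>\<^bsub>R\<^esub>}" using i by simp
    then show ?thesis unfolding 1(2) by (rule rev_image_eqI) simp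
  qed (use i in simp)
qed

lemma free_basis_map:
  assumes "f \<in> injections X Y" "(xs, g) \<in> free_basis G X"
  shows "(map f xs, g) \<in> free_basis G Y"
proof -
  have "inj_on f (set xs)" using assms by (auto simp: injections_def free_basis_def intro: inj_on_subset)
  then show ?thesis using assms by (auto simp: injections_def free_basis_def distinct_map)
qed

lemma fi_module_free:
  fixes R :: "('k, 'r) ring_scheme" and G :: "nat \<Rightarrow> 'g set"
  assumes "cring R"
  shows "fi_module R (free_fi R G :: ('x, 'k, 'x list \<times> 'g \<Rightarrow> 'k) fi_mod)"
proof -
  let ?F = "free_fi R G :: ('x, 'k, 'x list \<times> 'g \<Rightarrow> 'k) fi_mod"
  interpret R: cring R by fact
  have mod: "module R (obj ?F X)" for X
  proof (rule moduleI[OF assms abelian_groupI])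
    fix a b assume a: "a \<in> carrier (obj ?F X)" and b: "b \<in> carrier (obj ?F X)"
    note aD = free_carrierD[OF a] and bD = free_carrierD[OF b]
    show "a \<oplus>\<^bsub>obj ?F X\<^esub> b \<in> carrier (obj ?F X)"
      by (rule free_carrierI[where S = "{i. a i \<noteq> \<zero>\<^bsub>R\<^esub>} \<union> {i. b i \<noteq> \<zero>\<^bsub>R\<^esub>}"])
        (use aD bD in \<open>auto simp del: split_paired_All\<close>)
    show "a \<oplus>\<^bsub>obj ?F X\<^esub> b = b \<oplus>\<^bsub>obj ?F X\<^esub> a" using aD(1) bD(1) by (simp add: R.a_comm)
    fix c assume c: "c \<in> carrier (obj ?F X)"
    show "a \<oplus>\<^bsub>obj ?F X\<^esub> b \<oplus>\<^bsub>obj ?F X\<^esub> c = a \<oplus>\<^bsub>obj ?F X\<^esub> (b \<oplus>\<^bsub>obj ?F X\<^esub> c)"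
      using aD(1) bD(1) free_carrierD(1)[OF c] by (simp add: R.a_assoc)
  next
    fix r a assume r: "r \<in> carrier R" and a: "a \<in> carrier (obj ?F X)"
    note aD = free_carrierD[OF a]
    show "r \<odot>\<^bsub>obj ?F X\<^esub> a \<in> carrier (obj ?F X)"
      by (rule free_carrierI[where S = "{i. a i \<noteq> \<zero>\<^bsub>R\<^esub>}"])
        (use r aD in \<open>auto simp del: split_paired_All\<close>)
    fix b assume b: "b \<in> carrier (obj ?F X)"
    show "r \<odot>\<^bsub>obj ?F X\<^esub> (a \<oplus>\<^bsub>obj ?F X\<^esub> b) = r \<odot>\<^bsub>obj ?F X\<^esub> a \<oplus>\<^bsub>obj ?F X\<^esub> r \<odot>\<^bsub>obj ?F X\<^esub> b"
      using r aD(1) free_carrierD(1)[OF b] by (simp add: R.r_distr)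
  next
    fix r s a assume r: "r \<in> carrier R" "s \<in> carrier R" and a: "a \<in> carrier (obj ?F X)"
    note aD = free_carrierD[OF a]
    show "(r \<oplus>\<^bsub>R\<^esub> s) \<odot>\<^bsub>obj ?F X\<^esub> a = r \<odot>\<^bsub>obj ?F X\<^esub> a \<oplus>\<^bsub>obj ?F X\<^esub> s \<odot>\<^bsub>obj ?F X\<^esub> a"
      using r aD(1) by (simp add: R.l_distr)
    show "(r \<otimes>\<^bsub>R\<^esub> s) \<odot>\<^bsub>obj ?F X\<^esub> a = r \<odot>\<^bsub>obj ?F X\<^esub> (s \<odot>\<^bsub>obj ?F X\<^esub> a)"
      using r aD(1) by (simp add: R.m_assoc)
  next
    fix a assume a: "a \<in> carrier (obj ?F X)"
    note aD = free_carrierD[OF a]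
    have "(\<lambda>i. \<ominus>\<^bsub>R\<^esub> a i) \<in> carrier (obj ?F X)"
      by (rule free_carrierI[where S = "{i. a i \<noteq> \<zero>\<^bsub>R\<^esub>}"])
        (use aD in \<open>auto simp del: split_paired_All\<close>)
    moreover have "(\<lambda>i. \<ominus>\<^bsub>R\<^esub> a i) \<oplus>\<^bsub>obj ?F X\<^esub> a = \<zero>\<^bsub>obj ?F X\<^esub>" using aD(1) by (simp add: R.l_neg)
    ultimately show "\<exists>b\<in>carrier (obj ?F X). b \<oplus>\<^bsub>obj ?F X\<^esub> a = \<zero>\<^bsub>obj ?F X\<^esub>" by blast
    show "\<one>\<^bsub>R\<^esub> \<odot>\<^bsub>obj ?F X\<^esub> a = a" "\<zero>\<^bsub>obj ?F X\<^esub> \<oplus>\<^bsub>obj ?F X\<^esub> a = a" using aD(1) by simp_all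
  qed (rule free_carrierI[where S = "{}"], simp_all)
  have cl: "arr ?F X Y f a \<in> carrier (obj ?F Y)"
    if f: "f \<in> injections X Y" and a: "a \<in> carrier (obj ?F X)" for X Y f a
  proof (rule free_carrierI)
    have inj: "inj_on f X" using f by (simp add: injections_def)
    note aD = free_carrierD[OF a]
    show "{i. arr ?F X Y f a i \<noteq> \<zero>\<^bsub>R\<^esub>} \<subseteq> (\<lambda>(xs, g). (map f xs, g)) ` {i. a i \<noteq> \<zero>\<^bsub>R\<^esub>}"
      by (rule free_arr_support[OF inj])
    show "(\<lambda>(xs, g). (map f xs, g)) ` {i. a i \<noteq> \<zero>\<^bsub>R\<^esub>} \<subseteq> free_basis G Y"
    proof clarify
      fix xs g assume "a (xs, g) \<noteq> \<zero>\<^bsub>R\<^esub>"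
      then have "(xs, g) \<in> free_basis G X" using aD(3) by blast
      then show "(map f xs, g) \<in> free_basis G Y" by (rule free_basis_map[OF f])
    qed
    show "arr ?F X Y f a i \<in> carrier R" for i
      using aD(1) by (cases rule: free_arr_cases[OF inj, where i = i and R = R and G = G and Y = Y and a = a]) auto
    show "finite ((\<lambda>(xs, g). (map f xs, g)) ` {i. a i \<noteq> \<zero>\<^bsub>R\<^esub>})" using aD(2) by simp
  qed
  show ?thesis
  proof (rule fi_moduleI)
    fix X Y :: "'x set" and f assume f: "f \<in> injections X Y"
    have inj: "inj_on f X" using f by (simp add: injections_def)
    show "arr ?F X Y f \<in> linear_maps R (obj ?F X) (obj ?F Y)"
    proof (rule linear_mapsI)
      have z: "arr ?F X Y f c (zs, g) = \<zero>\<^bsub>R\<^esub>" if "\<And>xs. set xs \<subseteq> X \<Longrightarrow> zs \<noteq> map f xs" for zs g c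
        by (rule free_arr_notin) (rule that)
      fix a assume "a \<in> carrier (obj ?F X)"
      then show "arr ?F X Y f a \<in> carrier (obj ?F Y)" by (rule cl[OF f])
      show "arr ?F X Y f (r \<odot>\<^bsub>obj ?F X\<^esub> a) = r \<odot>\<^bsub>obj ?F Y\<^esub> arr ?F X Y f a" if "r \<in> carrier R" for r
      proof (rule free_arr_eqI[OF inj])
        fix zs g assume *: "\<And>xs. set xs \<subseteq> X \<Longrightarrow> zs \<noteq> map f xs"
        show "(r \<odot>\<^bsub>obj ?F Y\<^esub> arr ?F X Y f a) (zs, g) = \<zero>\<^bsub>R\<^esub>" using z[OF *] that by simp
      qed (simp add: free_arr_map[OF inj])
      fix b
      show "arr ?F X Y f (a \<oplus>\<^bsub>obj ?F X\<^esub> b) = arr ?F X Y f a \<oplus>\<^bsub>obj ?F Y\<^esub> arr ?F X Y f b"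
      proof (rule free_arr_eqI[OF inj])
        fix zs g assume *: "\<And>xs. set xs \<subseteq> X \<Longrightarrow> zs \<noteq> map f xs"
        show "(arr ?F X Y f a \<oplus>\<^bsub>obj ?F Y\<^esub> arr ?F X Y f b) (zs, g) = \<zero>\<^bsub>R\<^esub>" using z[OF *] by simp
      qed (simp add: free_arr_map[OF inj])
    qed
  next
    fix X Y :: "'x set" and f g a
    assume f: "f \<in> injections X Y" and g: "g \<in> injections X Y" and eq: "\<And>x. x \<in> X \<Longrightarrow> f x = g x"
    have inj: "inj_on f X" "inj_on g X" using f g by (simp_all add: injections_def)
    have m: "map f xs = map g xs" if "set xs \<subseteq> X" for xs using that eq by auto
    show "arr ?F X Y f a = arr ?F X Y g a"
    proof (rule free_arr_eqI[OF inj(1)])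
      fix xs h assume xs: "set xs \<subseteq> X"
      show "arr ?F X Y g a (map f xs, h) = a (xs, h)" by (simp only: m[OF xs] free_arr_map[OF inj(2) xs])
    next
      fix zs h assume *: "\<And>xs. set xs \<subseteq> X \<Longrightarrow> zs \<noteq> map f xs"
      show "arr ?F X Y g a (zs, h) = \<zero>\<^bsub>R\<^esub>"
        by (rule free_arr_notin) (simp only: m[symmetric] * not_False_eq_True)
    qed
  next
    fix X :: "'x set" and a assume a: "a \<in> carrier (obj ?F X)"
    show "arr ?F X X id a = a"
    proof (rule free_arr_eqI)
      fix zs g assume "\<And>xs. set xs \<subseteq> X \<Longrightarrow> zs \<noteq> map id xs"
      then have "(zs, g) \<notin> free_basis G X" by (auto simp: free_basis_def)
      then show "a (zs, g) = \<zero>\<^bsub>R\<^esub>" using free_carrierD(3)[OF a] by blast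
    qed simp_all
  next
    fix X Y Z :: "'x set" and f g a
    assume f: "f \<in> injections X Y" and g: "g \<in> injections Y Z"
    have inj: "inj_on f X" "inj_on g Y" "inj_on (g \<circ> f) X"
      using f g injections_comp[OF f g] by (simp_all add: injections_def)
    have fX: "set (map f xs) \<subseteq> Y" if "set xs \<subseteq> X" for xs using f that by (auto simp: injections_def)
    show "arr ?F X Z (g \<circ> f) a = arr ?F Y Z g (arr ?F X Y f a)"
    proof (rule free_arr_eqI[OF inj(3)])
      fix xs h assume xs: "set xs \<subseteq> X"
      show "arr ?F Y Z g (arr ?F X Y f a) (map (g \<circ> f) xs, h) = a (xs, h)"
        by (simp only: map_map[symmetric] free_arr_map[OF inj(2) fX[OF xs]] free_arr_map[OF inj(1) xs])
    next
      fix zs h assume *: "\<And>xs. set xs \<subseteq> X \<Longrightarrow> zs \<noteq> map (g \<circ> f) xs"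
      show "arr ?F Y Z g (arr ?F X Y f a) (zs, h) = \<zero>\<^bsub>R\<^esub>"
      proof (cases "\<exists>ys. set ys \<subseteq> Y \<and> zs = map g ys")
        case True
        then obtain ys where ys: "set ys \<subseteq> Y" "zs = map g ys" by blast
        have "ys \<noteq> map f xs" if "set xs \<subseteq> X" for xs using *[OF that] ys(2) by auto
        then show ?thesis unfolding ys(2) free_arr_map[OF inj(2) ys(1)] by (rule free_arr_notin)
      next
        case False
        then show ?thesis by (intro free_arr_notin) blast
      qed
    qed
  qed (rule mod)
qed

lemma linear_finsum:
  assumes f: "f \<in> linear_maps R M N" and M: "module R M" and N: "module R N"
    and S: "finite S" and u: "\<And>i. i \<in> S \<Longrightarrow> u i \<in> carrier M"
  shows "f (finsum M u S) = finsum N (\<lambda>i. f (u i)) S"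
proof -
  interpret M: module R M by fact
  interpret N: module R N by fact
  show ?thesis
    using S u
  proof induction
    case empty
    show ?case by (simp add: linear_zero[OF f M N])
  next
    case (insert i S)
    then show ?case
      by (simp add: Pi_iff linear_add[OF f] linear_closed[OF f])
  qed
qed

section \<open>The universal property of free FI-modules\<close>

definition free_ext ::
  "('k, 'r) ring_scheme \<Rightarrow> ('x, 'k, 'm) fi_mod \<Rightarrow> ('x set \<Rightarrow> 'i \<Rightarrow> 'm) \<Rightarrow> 'x set \<Rightarrow> ('i \<Rightarrow> 'k) \<Rightarrow> 'm" where
  "free_ext R A b X a = finsum (obj A X) (\<lambda>i. a i \<odot>\<^bsub>obj A X\<^esub> b X i) {i. a i \<noteq> \<zero>\<^bsub>R\<^esub>}"

text \<open>Supports vary with the element, so sums are compared over a common finite index set; the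
  extra terms are zero.\<close>

lemma free_ext_superset:
  assumes A: "fi_module R A" and X: "finite X" and S: "finite S" "{i. a i \<noteq> \<zero>\<^bsub>R\<^esub>} \<subseteq> S"
    and a: "\<And>i. a i \<in> carrier R" and b: "\<And>i. i \<in> S \<Longrightarrow> b X i \<in> carrier (obj A X)"
  shows "free_ext R A b X a = finsum (obj A X) (\<lambda>i. a i \<odot>\<^bsub>obj A X\<^esub> b X i) S"
proof -
  interpret A: module R "obj A X" by (rule fi_obj[OF A X])
  show ?thesis unfolding free_ext_def
    using S a b by (intro A.add.finprod_mono_neutral_cong_left) auto
qed

lemma free_ext_unit:
  assumes A: "fi_module R A" and X: "finite X" and b: "b X i \<in> carrier (obj A X)"
  shows "free_ext R A b X (free_unit R i) = b X i"
proof -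
  interpret A: module R "obj A X" by (rule fi_obj[OF A X])
  have "free_ext R A b X (free_unit R i) = finsum (obj A X) (\<lambda>j. free_unit R i j \<odot>\<^bsub>obj A X\<^esub> b X j) {i}"
    using b by (intro free_ext_superset[OF A X]) (auto simp: free_unit_def)
  then show ?thesis using b by (simp add: free_unit_def)
qed

lemma fi_hom_free_ext:
  fixes A :: "('x, 'k, 'm) fi_mod" and G :: "nat \<Rightarrow> 'g set"
  assumes A: "fi_module R A"
    and b: "\<And>X i. finite X \<Longrightarrow> i \<in> free_basis G X \<Longrightarrow> b X i \<in> carrier (obj A X)"
    and nat: "\<And>X Y f xs g. finite X \<Longrightarrow> finite Y \<Longrightarrow> f \<in> injections X Y \<Longrightarrow> (xs, g) \<in> free_basis G X \<Longrightarrow>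
      arr A X Y f (b X (xs, g)) = b Y (map f xs, g)"
  shows "fi_hom R (free_fi R G) A (free_ext R A b)"
proof -
  have R: "cring R" using module.axioms(1)[OF fi_obj[OF A, of "{}"]] by simp
  interpret R: cring R by (rule R)
  let ?F = "free_fi R G :: ('x, 'k, 'x list \<times> 'g \<Rightarrow> 'k) fi_mod"
  note F = fi_module_free[OF R, of G, where 'x = 'x]
  show ?thesis
  proof (rule fi_homI[OF F A linear_mapsI])
    fix X :: "'x set" and a assume X: "finite X" and a: "a \<in> carrier (obj ?F X)"
    interpret A: module R "obj A X" by (rule fi_obj[OF A X])
    interpret F: module R "obj ?F X" by (rule fi_obj[OF F X])
    note aD = free_carrierD[OF a]
    have bc: "b X i \<in> carrier (obj A X)" if "a i \<noteq> \<zero>\<^bsub>R\<^esub>" for i using aD(3) b[OF X] that by blast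
    show "free_ext R A b X a \<in> carrier (obj A X)"
      unfolding free_ext_def using aD(1) bc by (intro A.finsum_closed) (simp add: Pi_iff)
    show "free_ext R A b X (r \<odot>\<^bsub>obj ?F X\<^esub> a) = r \<odot>\<^bsub>obj A X\<^esub> free_ext R A b X a"
      if r: "r \<in> carrier R" for r
    proof -
      have "free_ext R A b X (r \<odot>\<^bsub>obj ?F X\<^esub> a) =
          finsum (obj A X) (\<lambda>i. (r \<otimes>\<^bsub>R\<^esub> a i) \<odot>\<^bsub>obj A X\<^esub> b X i) {i. a i \<noteq> \<zero>\<^bsub>R\<^esub>}"
        using aD(1,2) r bc by (subst free_ext_superset[OF A X, where S = "{i. a i \<noteq> \<zero>\<^bsub>R\<^esub>}"]) (auto simp del: split_paired_All)
      also have "\<dots> = finsum (obj A X) (\<lambda>i. r \<odot>\<^bsub>obj A X\<^esub> (a i \<odot>\<^bsub>obj A X\<^esub> b X i)) {i. a i \<noteq> \<zero>\<^bsub>R\<^esub>}"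
        by (rule A.add.finprod_cong'[OF refl]) (use aD(1) r bc in \<open>simp_all add: A.smult_assoc1 Pi_iff\<close>)
      also have "\<dots> = r \<odot>\<^bsub>obj A X\<^esub> free_ext R A b X a"
        unfolding free_ext_def using aD(1,2) r bc by (intro A.finsum_smult_ldistr[symmetric]) (simp_all add: Pi_iff)
      finally show ?thesis .
    qed
    fix a' assume a': "a' \<in> carrier (obj ?F X)"
    note aD' = free_carrierD[OF a']
    have bc': "b X i \<in> carrier (obj A X)" if "a' i \<noteq> \<zero>\<^bsub>R\<^esub>" for i using aD'(3) b[OF X] that by blast
    let ?S = "{i. a i \<noteq> \<zero>\<^bsub>R\<^esub>} \<union> {i. a' i \<noteq> \<zero>\<^bsub>R\<^esub>}"
    have bS: "b X i \<in> carrier (obj A X)" if "i \<in> ?S" for i using that bc bc' by blast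
    have fS: "finite ?S" using aD(2) aD'(2) by simp
    have e: "free_ext R A b X c = finsum (obj A X) (\<lambda>i. c i \<odot>\<^bsub>obj A X\<^esub> b X i) ?S"
      if "{i. c i \<noteq> \<zero>\<^bsub>R\<^esub>} \<subseteq> ?S" "\<And>i. c i \<in> carrier R" for c
      by (rule free_ext_superset[OF A X fS that(1)]) (rule that(2), rule bS)
    have "free_ext R A b X (a \<oplus>\<^bsub>obj ?F X\<^esub> a') =
        finsum (obj A X) (\<lambda>i. (a i \<oplus>\<^bsub>R\<^esub> a' i) \<odot>\<^bsub>obj A X\<^esub> b X i) ?S"
      using aD(1) aD'(1) by (subst e) (auto simp del: split_paired_All)
    also have "\<dots> = finsum (obj A X) (\<lambda>i. a i \<odot>\<^bsub>obj A X\<^esub> b X i \<oplus>\<^bsub>obj A X\<^esub> a' i \<odot>\<^bsub>obj A X\<^esub> b X i) ?S"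
      by (rule A.add.finprod_cong'[OF refl]) (use aD(1) aD'(1) bS in \<open>simp_all add: A.smult_l_distr Pi_iff del: Un_iff\<close>)
    also have "\<dots> = finsum (obj A X) (\<lambda>i. a i \<odot>\<^bsub>obj A X\<^esub> b X i) ?S \<oplus>\<^bsub>obj A X\<^esub>
        finsum (obj A X) (\<lambda>i. a' i \<odot>\<^bsub>obj A X\<^esub> b X i) ?S"
      using aD(1) aD'(1) bS by (intro A.finsum_addf) (simp_all add: Pi_iff del: Un_iff)
    also have "\<dots> = free_ext R A b X a \<oplus>\<^bsub>obj A X\<^esub> free_ext R A b X a'"
      using e[of a] e[of a'] aD(1) aD'(1) by auto
    finally show "free_ext R A b X (a \<oplus>\<^bsub>obj ?F X\<^esub> a') = free_ext R A b X a \<oplus>\<^bsub>obj A X\<^esub> free_ext R A b X a'" .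
  next
    fix X Y :: "'x set" and f a
    assume X: "finite X" and Y: "finite Y" and f: "f \<in> injections X Y" and a: "a \<in> carrier (obj ?F X)"
    interpret AX: module R "obj A X" by (rule fi_obj[OF A X])
    interpret AY: module R "obj A Y" by (rule fi_obj[OF A Y])
    have inj: "inj_on f X" using f by (simp add: injections_def)
    note l = fi_arr[OF A X Y f]
    let ?m = "\<lambda>(xs, g). (map f xs, g)" and ?S = "{i. a i \<noteq> \<zero>\<^bsub>R\<^esub>}"
    note aD = free_carrierD[OF a] and S = free_carrierD(2,3)[OF a]
    have bS: "b X i \<in> carrier (obj A X)" if "i \<in> ?S" for i using S(2) b[OF X] that by blast
    have mS: "?m i \<in> free_basis G Y" "arr A X Y f (b X i) = b Y (?m i)" "arr ?F X Y f a (?m i) = a i"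
      if "i \<in> ?S" for i
    proof -
      obtain xs g where i: "i = (xs, g)" by (cases i)
      have *: "(xs, g) \<in> free_basis G X" using that S i by blast
      then have xs: "set xs \<subseteq> X" by (simp add: free_basis_def)
      show "?m i \<in> free_basis G Y" "arr A X Y f (b X i) = b Y (?m i)" "arr ?F X Y f a (?m i) = a i"
        unfolding i prod.case
        by (rule free_basis_map[OF f *], rule nat[OF X Y f *], rule free_arr_map[OF inj xs])
    qed
    \<comment> \<open>This allows the sum over the image of the support to be reindexed by the
      support.\<close>
    have injm: "inj_on ?m ?S"
    proof (rule inj_onI)
      fix i j assume i: "i \<in> ?S" and j: "j \<in> ?S" and eq: "?m i = ?m j"
      obtain xs g xs' g' where ij: "i = (xs, g)" "j = (xs', g')" by (cases i, cases j)
      have "(xs, g) \<in> free_basis G X" "(xs', g') \<in> free_basis G X"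
        using subsetD[OF S(2) i] subsetD[OF S(2) j] by (simp_all only: ij)
      then have "inj_on f (set xs \<union> set xs')"
        by (auto simp: free_basis_def intro: inj_on_subset[OF inj])
      moreover have "map f xs = map f xs'" "g = g'" using eq by (simp_all add: ij)
      ultimately show "i = j" using map_inj_on by (auto simp: ij)
    qed
    have bY: "b Y (?m i) \<in> carrier (obj A Y)" if "i \<in> ?S" for i by (rule b[OF Y mS(1)[OF that]])
    note sub = free_arr_support[OF inj, where R = R and G = G and Y = Y and a = a]
    note ac = free_carrierD(1)[OF fi_arr_closed[OF F X Y f a]]
    have "free_ext R A b Y (arr ?F X Y f a) =
        finsum (obj A Y) (\<lambda>j. arr ?F X Y f a j \<odot>\<^bsub>obj A Y\<^esub> b Y j) (?m ` ?S)"
      by (rule free_ext_superset[OF A Y finite_imageI[OF S(1)] sub ac]) (erule imageE, simp only: bY)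
    also have "\<dots> = finsum (obj A Y) (\<lambda>i. arr ?F X Y f a (?m i) \<odot>\<^bsub>obj A Y\<^esub> b Y (?m i)) ?S"
      by (rule AY.finsum_reindex[OF _ injm]) (rule Pi_I, erule imageE, simp only: AY.smult_closed[OF ac bY])
    also have "\<dots> = finsum (obj A Y) (\<lambda>i. arr A X Y f (a i \<odot>\<^bsub>obj A X\<^esub> b X i)) ?S"
    proof (rule AY.add.finprod_cong'[OF refl])
      show "(\<lambda>i. arr A X Y f (a i \<odot>\<^bsub>obj A X\<^esub> b X i)) \<in> ?S \<rightarrow> carrier (obj A Y)"
        by (rule Pi_I, rule linear_closed[OF l], rule AX.smult_closed[OF aD(1) bS])
      fix i assume i: "i \<in> ?S"
      note bS[OF i]
      then show "arr ?F X Y f a (?m i) \<odot>\<^bsub>obj A Y\<^esub> b Y (?m i) = arr A X Y f (a i \<odot>\<^bsub>obj A X\<^esub> b X i)"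
        by (simp only: mS(2)[OF i, symmetric] mS(3)[OF i] linear_smult[OF l aD(1)])
    qed
    also have "\<dots> = arr A X Y f (free_ext R A b X a)"
      unfolding free_ext_def
      by (rule linear_finsum[OF l fi_obj[OF A X] fi_obj[OF A Y] S(1) AX.smult_closed[OF aD(1) bS], symmetric])
    finally show "free_ext R A b Y (arr ?F X Y f a) = arr A X Y f (free_ext R A b X a)" .
  qed
qed

lemma free_unit_closed:
  assumes "cring R" "i \<in> free_basis G X"
  shows "free_unit R i \<in> carrier (obj (free_fi R G) X)"
proof -
  interpret cring R by fact
  show ?thesis
    by (rule free_carrierI[where S = "{i}"]) (use assms(2) in \<open>auto simp: free_unit_def\<close>)
qed

lemma free_arr_unit:
  assumes "f \<in> injections X Y" "set xs \<subseteq> X"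
  shows "arr (free_fi R G) X Y f (free_unit R (xs, g)) = free_unit R (map f xs, g)"
proof (rule free_arr_eqI)
  show inj: "inj_on f X" using assms by (simp add: injections_def)
  fix zs h assume zs: "set zs \<subseteq> X"
  have "inj_on f (set zs \<union> set xs)" using zs assms(2) by (auto intro: inj_on_subset[OF inj])
  then have "map f zs = map f xs \<longleftrightarrow> zs = xs" using map_inj_on by blast
  then show "free_unit R (map f xs, g) (map f zs, h) = free_unit R (xs, g) (zs, h)"
    by (simp add: free_unit_def)
next
  fix zs h assume "\<And>us. set us \<subseteq> X \<Longrightarrow> zs \<noteq> map f us"
  then have "zs \<noteq> map f xs" using assms(2) by blast
  then show "free_unit R (map f xs, g) (zs, h) = \<zero>\<^bsub>R\<^esub>" by (simp add: free_unit_def)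
qed

lemma free_hom_expand:
  fixes B :: "('x, 'k, 'm) fi_mod" and G :: "nat \<Rightarrow> 'g set"
  assumes h: "fi_hom R (free_fi R G) B h" and X: "finite X"
    and a: "a \<in> carrier (obj (free_fi R G) X)"
  shows "h X a = free_ext R B (\<lambda>X i. h X (free_unit R i)) X a"
proof -
  let ?F = "free_fi R G :: ('x, 'k, 'x list \<times> 'g \<Rightarrow> 'k) fi_mod"
  interpret B: module R "obj B X" by (rule fi_obj[OF fi_hom_cod[OF h] X])
  interpret F: module R "obj ?F X" by (rule fi_obj[OF fi_hom_dom[OF h] X])
  have R: "cring R" by (rule B.is_cring)
  \<comment> \<open>\<open>?a S\<close> is \<open>a\<close> truncated to \<open>S\<close>. The
    induction adds one basis element at a time and is finally applied to the support of
    \<open>a\<close>.\<close>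
  let ?a = "\<lambda>S i. if i \<in> S then a i else \<zero>\<^bsub>R\<^esub>"
  note ac = free_carrierD(1)[OF a]
  have "?a S \<in> carrier (obj ?F X) \<and> h X (?a S) = finsum (obj B X) (\<lambda>i. a i \<odot>\<^bsub>obj B X\<^esub> h X (free_unit R i)) S"
    if "finite S" "S \<subseteq> free_basis G X" for S
    using that
  proof induction
    case empty
    show ?case using fi_hom_zero[OF h X] F.zero_closed by simp
  next
    case (insert i S)
    have i: "free_unit R i \<in> carrier (obj ?F X)" using insert.prems by (intro free_unit_closed[OF R]) auto
    have u: "free_unit R j \<in> carrier (obj ?F X)" if "j \<in> S" for j
      using insert.prems that by (intro free_unit_closed[OF R]) auto
    have S: "?a S \<in> carrier (obj ?F X)"
      "h X (?a S) = finsum (obj B X) (\<lambda>i. a i \<odot>\<^bsub>obj B X\<^esub> h X (free_unit R i)) S"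
      using insert.IH insert.prems by auto
    have eq: "?a (insert i S) = a i \<odot>\<^bsub>obj ?F X\<^esub> free_unit R i \<oplus>\<^bsub>obj ?F X\<^esub> ?a S"
      using insert.hyps ac by (auto simp: free_unit_def fun_eq_iff)
    have ai: "a i \<odot>\<^bsub>obj ?F X\<^esub> free_unit R i \<in> carrier (obj ?F X)" by (rule F.smult_closed[OF ac i])
    have "h X (?a (insert i S)) = a i \<odot>\<^bsub>obj B X\<^esub> h X (free_unit R i) \<oplus>\<^bsub>obj B X\<^esub> h X (?a S)"
      unfolding eq fi_hom_add[OF h X ai S(1)] fi_hom_smult[OF h X ac i] ..
    also have "\<dots> = finsum (obj B X) (\<lambda>i. a i \<odot>\<^bsub>obj B X\<^esub> h X (free_unit R i)) (insert i S)"
      unfolding S(2) using insert.hyps fi_hom_closed[OF h X u] fi_hom_closed[OF h X i] ac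
      by (intro B.finsum_insert[symmetric]) auto
    finally have "h X (?a (insert i S)) = finsum (obj B X) (\<lambda>i. a i \<odot>\<^bsub>obj B X\<^esub> h X (free_unit R i)) (insert i S)" .
    moreover have "?a (insert i S) \<in> carrier (obj ?F X)" unfolding eq by (rule F.a_closed[OF ai S(1)])
    ultimately show ?case by blast
  qed
  from this[OF free_carrierD(2,3)[OF a]]
  have "h X (?a {i. a i \<noteq> \<zero>\<^bsub>R\<^esub>}) = free_ext R B (\<lambda>X i. h X (free_unit R i)) X a"
    by (simp add: free_ext_def)
  moreover have "?a {i. a i \<noteq> \<zero>\<^bsub>R\<^esub>} = a" by auto
  ultimately show ?thesis by simp
qed

lemma free_ext_cong:
  assumes A: "fi_module R A" and X: "finite X" and a: "a \<in> carrier (obj (free_fi R G) X)"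
    and b: "\<And>i. i \<in> free_basis G X \<Longrightarrow> b X i \<in> carrier (obj A X)"
    and eq: "\<And>i. i \<in> free_basis G X \<Longrightarrow> b' X i = b X i"
  shows "free_ext R A b' X a = free_ext R A b X a"
proof -
  interpret A: module R "obj A X" by (rule fi_obj[OF A X])
  note aD = free_carrierD[OF a]
  show ?thesis unfolding free_ext_def
  proof (rule A.add.finprod_cong'[OF refl])
    fix i assume "i \<in> {i. a i \<noteq> \<zero>\<^bsub>R\<^esub>}"
    then have "i \<in> free_basis G X" by (rule subsetD[OF aD(3)])
    then show "a i \<odot>\<^bsub>obj A X\<^esub> b' X i = a i \<odot>\<^bsub>obj A X\<^esub> b X i" by (simp only: eq)
  next
    show "(\<lambda>i. a i \<odot>\<^bsub>obj A X\<^esub> b X i) \<in> {i. a i \<noteq> \<zero>\<^bsub>R\<^esub>} \<rightarrow> carrier (obj A X)"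
      by (rule Pi_I, rule A.smult_closed[OF aD(1) b], erule subsetD[OF aD(3)])
  qed
qed

lemma free_hom_eqI:
  assumes h: "fi_hom R (free_fi R G) B h" and h': "fi_hom R (free_fi R G) B h'"
    and X: "finite X" and a: "a \<in> carrier (obj (free_fi R G) X)"
    and eq: "\<And>i. i \<in> free_basis G X \<Longrightarrow> h' X (free_unit R i) = h X (free_unit R i)"
  shows "h' X a = h X a"
proof -
  note B = fi_hom_cod[OF h]
  have R: "cring R" using module.axioms(1)[OF fi_obj[OF B X]] .
  show ?thesis
    unfolding free_hom_expand[OF h X a] free_hom_expand[OF h' X a]
    by (rule free_ext_cong[OF B X a]) (rule fi_hom_closed[OF h X free_unit_closed[OF R]], assumption, rule eq)
qed

text \<open>Translates the list form of an injection, as it occurs in basis elements, into a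
  morphism out of the set listed by \<open>ys\<close>.\<close>

definition list_inj :: "'a list \<Rightarrow> 'b list \<Rightarrow> 'a \<Rightarrow> 'b" where
  "list_inj ys xs y = the (map_of (zip ys xs) y)"

lemma map_list_inj:
  assumes "distinct ys" "length xs = length ys"
  shows "map (list_inj ys xs) ys = xs"
  using assms by (intro nth_equalityI) (simp_all add: list_inj_def map_of_zip_nth)

lemma list_inj_injections:
  assumes "distinct ys" "length xs = length ys" "distinct xs" "set xs \<subseteq> X"
  shows "list_inj ys xs \<in> injections (set ys) X"
proof -
  note m = map_list_inj[OF assms(1,2)]
  have "list_inj ys xs ` set ys = set xs" by (simp only: set_map[symmetric] m)
  moreover have "inj_on (list_inj ys xs) (set ys)"
    using assms(3) distinct_map[of "list_inj ys xs" ys] by (simp add: m)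
  ultimately show ?thesis using assms(4) by (auto simp: injections_def)
qed

text \<open>The Yoneda lemma on the basis: with \<open>n\<close> the length of \<open>xs\<close>,
  the element \<open>(xs, g)\<close> is the image of the universal \<open>(ys n, g)\<close> under
  the injection that \<open>xs\<close> describes, so a homomorphism is determined by its values
  \<open>w n g\<close> at the standard sets.\<close>

definition free_gen_map ::
  "(nat \<Rightarrow> 'x list) \<Rightarrow> ('x, 'k, 'm) fi_mod \<Rightarrow> (nat \<Rightarrow> 'g \<Rightarrow> 'm) \<Rightarrow> 'x set \<Rightarrow> 'x list \<times> 'g \<Rightarrow> 'm" where
  "free_gen_map ys A w X = (\<lambda>(xs, g). arr A (set (ys (length xs))) X (list_inj (ys (length xs)) xs) (w (length xs) g))"

lemma free_gen_map:
  fixes A :: "('x, 'k, 'm) fi_mod" and G :: "nat \<Rightarrow> 'g set" and ys :: "nat \<Rightarrow> 'x list"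
  assumes A: "fi_module R A" and ys: "\<And>n. distinct (ys n)" "\<And>n. length (ys n) = n"
    and w: "\<And>n g. g \<in> G n \<Longrightarrow> w n g \<in> carrier (obj A (set (ys n)))"
  shows free_gen_map_closed:
      "finite X \<Longrightarrow> i \<in> free_basis G X \<Longrightarrow> free_gen_map ys A w X i \<in> carrier (obj A X)"
    and fi_hom_free_gen_map: "fi_hom R (free_fi R G) A (free_ext R A (free_gen_map ys A w))"
proof -
  have i: "list_inj (ys (length xs)) xs \<in> injections (set (ys (length xs))) X"
    "g \<in> G (length xs)" if "(xs, g) \<in> free_basis G X" for X xs g
    using that by (auto simp: free_basis_def ys intro!: list_inj_injections)
  have c: "free_gen_map ys A w X i \<in> carrier (obj A X)" if "finite X" "i \<in> free_basis G X" for X i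
  proof -
    obtain xs g where xg: "i = (xs, g)" by (cases i)
    show ?thesis
      unfolding xg free_gen_map_def prod.case
      by (rule fi_arr_closed[OF A finite_set that(1) i(1) w[OF i(2)]]) (use that(2) xg in simp_all)
  qed
  then show "finite X \<Longrightarrow> i \<in> free_basis G X \<Longrightarrow> free_gen_map ys A w X i \<in> carrier (obj A X)" .
  show "fi_hom R (free_fi R G) A (free_ext R A (free_gen_map ys A w))"
  proof (rule fi_hom_free_ext[OF A])
    fix X Y :: "'x set" and f xs and g :: 'g
    assume X: "finite X" and Y: "finite Y" and f: "f \<in> injections X Y" and xs: "(xs, g) \<in> free_basis G X"
    note fxs = free_basis_map[OF f xs]
    let ?n = "length xs"
    have i': "list_inj (ys ?n) (map f xs) \<in> injections (set (ys ?n)) Y" using i(1)[OF fxs] by simp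
    have "f (list_inj (ys ?n) xs y) = list_inj (ys ?n) (map f xs) y" if y: "y \<in> set (ys ?n)" for y
    proof -
      have "map (list_inj (ys ?n) (map f xs)) (ys ?n) = map f (map (list_inj (ys ?n) xs) (ys ?n))"
        by (simp only: map_list_inj[OF ys(1)] ys(2) length_map)
      then have "\<forall>y \<in> set (ys ?n). list_inj (ys ?n) (map f xs) y = (f \<circ> list_inj (ys ?n) xs) y"
        by (simp only: map_map map_eq_conv)
      from bspec[OF this y] show ?thesis by (simp only: comp_apply)
    qed
    then show "arr A X Y f (free_gen_map ys A w X (xs, g)) = free_gen_map ys A w Y (map f xs, g)"
      unfolding free_gen_map_def prod.case length_map
      by (rule fi_arr_comp_eq'[OF A finite_set X Y i(1)[OF xs] f i' _ w[OF i(2)[OF xs]]])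
  qed (rule c)
qed

text \<open>Free FI-modules have the lifting property over arbitrary element types: it is enough to
  choose preimages of the values on the universal generators, and homomorphisms that agree on basis
  elements agree.\<close>

lemma free_lift:
  fixes A :: "('x, 'k, 'a) fi_mod" and B :: "('x, 'k, 'b) fi_mod" and G :: "nat \<Rightarrow> 'g set"
    and ys :: "nat \<Rightarrow> 'x list"
  assumes ys: "\<And>n. distinct (ys n)" "\<And>n. length (ys n) = n"
    and g: "fi_epi R A B g" and h: "fi_hom R (free_fi R G) B h"
  obtains l where "fi_hom R (free_fi R G) A l"
    "\<And>X a. finite X \<Longrightarrow> a \<in> carrier (obj (free_fi R G) X) \<Longrightarrow> g X (l X a) = h X a"
proof -
  note gh = fi_epi_hom[OF g]
  note A = fi_hom_dom[OF gh] and B = fi_hom_cod[OF gh]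
  have R: "cring R" using module.axioms(1)[OF fi_obj[OF A, of "{}"]] by simp
  define w where "w n \<gamma> = inv_into (carrier (obj A (set (ys n)))) (g (set (ys n)))
      (h (set (ys n)) (free_unit R (ys n, \<gamma>)))" for n \<gamma>
  have gen: "(ys n, \<gamma>) \<in> free_basis G (set (ys n))" if "\<gamma> \<in> G n" for n \<gamma>
    using that by (simp add: free_basis_def ys)
  note u = free_unit_closed[OF R gen]
  have im: "h (set (ys n)) (free_unit R (ys n, \<gamma>)) \<in> g (set (ys n)) ` carrier (obj A (set (ys n)))"
    if "\<gamma> \<in> G n" for n \<gamma>
    unfolding fi_epi_surj[OF g finite_set] by (rule fi_hom_closed[OF h finite_set u[OF that]])
  have w: "w n \<gamma> \<in> carrier (obj A (set (ys n)))" if "\<gamma> \<in> G n" for n \<gamma>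
    unfolding w_def by (rule inv_into_into[OF im[OF that]])
  have gw: "g (set (ys n)) (w n \<gamma>) = h (set (ys n)) (free_unit R (ys n, \<gamma>))" if "\<gamma> \<in> G n" for n \<gamma>
    unfolding w_def by (rule f_inv_into_f[OF im[OF that]])
  let ?b = "free_gen_map ys A w"
  have bc: "?b X i \<in> carrier (obj A X)" if "finite X" "i \<in> free_basis G X" for X i
    by (rule free_gen_map_closed[OF A ys w that])
  have l: "fi_hom R (free_fi R G) A (free_ext R A ?b)"
    by (rule fi_hom_free_gen_map[OF A ys w])
  have "g X (free_ext R A ?b X a) = h X a" if X: "finite X" and a: "a \<in> carrier (obj (free_fi R G) X)" for X a
  proof (rule free_hom_eqI[OF h fi_hom_comp[OF l gh] X a])
    fix i assume i: "i \<in> free_basis G X"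
    obtain xs \<gamma> where xg: "i = (xs, \<gamma>)" by (cases i)
    have xs: "distinct xs" "set xs \<subseteq> X" "\<gamma> \<in> G (length xs)" using i xg by (auto simp: free_basis_def)
    let ?n = "length xs"
    have f: "list_inj (ys ?n) xs \<in> injections (set (ys ?n)) X"
      by (rule list_inj_injections) (simp_all add: ys xs)
    have "g X (free_ext R A ?b X (free_unit R i)) = g X (?b X i)"
      by (simp only: free_ext_unit[OF A X, of "?b" i, OF bc[OF X i]])
    also have "\<dots> = g X (arr A (set (ys ?n)) X (list_inj (ys ?n) xs) (w ?n \<gamma>))"
      by (simp add: free_gen_map_def xg)
    also have "\<dots> = arr B (set (ys ?n)) X (list_inj (ys ?n) xs) (h (set (ys ?n)) (free_unit R (ys ?n, \<gamma>)))"
      by (simp only: fi_hom_arr[OF gh finite_set X f w[OF xs(3)]] gw[OF xs(3)])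
    also have "\<dots> = h X (arr (free_fi R G) (set (ys ?n)) X (list_inj (ys ?n) xs) (free_unit R (ys ?n, \<gamma>)))"
      by (rule fi_hom_arr[OF h finite_set X f u[OF xs(3)], symmetric])
    also have "\<dots> = h X (free_unit R i)"
      by (simp only: free_arr_unit[OF f subset_refl] map_list_inj ys xg)
    finally show "g X (free_ext R A ?b X (free_unit R i)) = h X (free_unit R i)" .
  qed
  with l that show thesis by blast
qed

text \<open>All elements of \<open>V\<close> at the standard sets serve as generators. Generators
  thus have the element type of \<open>V\<close>, which is what an encoding of \<open>V\<close> into
  lists can handle.\<close>

lemma free_cover:
  fixes V :: "('x, 'k, 'g) fi_mod" and ys :: "nat \<Rightarrow> 'x list"
  assumes V: "fi_module R V" and ys: "\<And>n. distinct (ys n)" "\<And>n. length (ys n) = n"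
  defines "G \<equiv> \<lambda>n. carrier (obj V (set (ys n)))"
  shows "fi_epi R (free_fi R G) V (free_ext R V (free_gen_map ys V (\<lambda>n v. v)))"
proof -
  let ?b = "free_gen_map ys V (\<lambda>n v. v)"
  have R: "cring R" using module.axioms(1)[OF fi_obj[OF V, of "{}"]] by simp
  have w: "\<And>n g. g \<in> G n \<Longrightarrow> g \<in> carrier (obj V (set (ys n)))" by (simp add: G_def)
  have h: "fi_hom R (free_fi R G) V (free_ext R V ?b)"
    by (rule fi_hom_free_gen_map[OF V ys w])
  have "v \<in> free_ext R V ?b X ` carrier (obj (free_fi R G) X)"
    if X: "finite X" and v: "v \<in> carrier (obj V X)" for X v
  proof -
    obtain xs where xs: "set xs = X" "distinct xs" using finite_distinct_list[OF X] by blast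
    let ?n = "length xs"
    have f: "list_inj xs (ys ?n) \<in> injections X (set (ys ?n))"
      using list_inj_injections[of xs "ys ?n"] xs ys by simp
    have f': "list_inj (ys ?n) xs \<in> injections (set (ys ?n)) X"
      using list_inj_injections[of "ys ?n" xs] xs ys by simp
    \<comment> \<open>A bijection with the standard set of the same size carries \<open>v\<close> to
      a generator \<open>v'\<close>. The basis element \<open>(xs, v')\<close> undoes the bijection,
      so it is sent to \<open>v\<close>.\<close>
    define v' where "v' = arr V X (set (ys ?n)) (list_inj xs (ys ?n)) v"
    have v': "v' \<in> G ?n" unfolding v'_def G_def by (rule fi_arr_closed[OF V X finite_set f v])
    have i: "(xs, v') \<in> free_basis G X" using v' xs by (simp add: free_basis_def)
    have idX: "id \<in> injections X X" by (simp add: injections_def)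
    have "list_inj (ys ?n) xs (list_inj xs (ys ?n) x) = id x" if x: "x \<in> X" for x
    proof -
      have "map (list_inj (ys ?n) xs) (map (list_inj xs (ys ?n)) xs) = map id xs"
        by (simp only: map_list_inj xs(2) ys list.map_id)
      then have "\<forall>x \<in> set xs. (list_inj (ys ?n) xs \<circ> list_inj xs (ys ?n)) x = id x"
        by (simp only: map_map map_eq_conv)
      from bspec[OF this] x show ?thesis by (simp only: comp_apply xs(1))
    qed
    then have "arr V (set (ys ?n)) X (list_inj (ys ?n) xs) v' = arr V X X id v"
      unfolding v'_def
      by (rule fi_arr_comp_eq'[OF V X finite_set X f f' idX _ v])
    then have "?b X (xs, v') = v" by (simp add: free_gen_map_def fi_arr_id[OF V X v])
    then have "free_ext R V ?b X (free_unit R (xs, v')) = v"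
      using free_ext_unit[OF V X, of ?b "(xs, v')"] v by simp
    then show ?thesis by (rule image_eqI[OF sym free_unit_closed[OF R i]])
  qed
  then show ?thesis unfolding fi_epi_def using h fi_hom_closed[OF h] by blast
qed

section \<open>Existence of projective covers and resolutions\<close>

lemma infinite_of_option_inj:
  assumes "inj (e :: 'x option \<Rightarrow> 'x)"
  shows "infinite (UNIV :: 'x set)"
proof
  assume fin: "finite (UNIV :: 'x set)"
  have "card (add_point e UNIV) \<le> card (UNIV :: 'x set)" by (rule card_mono[OF fin]) simp
  then show False using card_add_point[OF assms fin] by simp
qed

text \<open>The elements of the free cover are coefficient functions; an injective encoding
  transports them to the element type prescribed for the chosen resolutions. The injection
  \<open>e\<close> makes \<open>'x\<close> infinite, so that standard sets of every size
  exist.\<close>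

lemma projective_cover:
  fixes V :: "('x, 'k, 'g) fi_mod" and c\<^sub>0 :: "'g \<Rightarrow> ('x + 'k + 'm) list"
  assumes V: "fi_module R V" and e: "inj (e :: 'x option \<Rightarrow> 'x)" and c\<^sub>0: "inj c\<^sub>0"
  shows "\<exists>(P :: ('x, 'k, ('x + 'k + 'm) list) fi_mod) p. fi_projective R P \<and> fi_epi R P V p"
proof -
  have "\<exists>l :: 'x list. distinct l \<and> length l = n" for n
  proof -
    obtain S :: "'x set" where S: "finite S" "card S = n"
      using infinite_arbitrarily_large[OF infinite_of_option_inj[OF e], of n] by blast
    obtain l where "set l = S" "distinct l" using finite_distinct_list[OF S(1)] by blast
    then show ?thesis using distinct_card[of l] S(2) by auto
  qed
  then obtain ys :: "nat \<Rightarrow> 'x list" where ys: "\<And>n. distinct (ys n)" "\<And>n. length (ys n) = n" by metis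
  define G where "G n = carrier (obj V (set (ys n)))" for n
  let ?F = "free_fi R G"
  have cov: "fi_epi R ?F V (free_ext R V (free_gen_map ys V (\<lambda>n v. v)))"
    unfolding G_def[abs_def] by (rule free_cover[OF V ys])
  note F = fi_hom_dom[OF fi_epi_hom[OF cov]]
  have ts: "Inl undefined \<noteq> (Inr (Inl undefined) :: 'x + 'k + 'm)" by simp
  obtain E :: "('x + 'k + 'm) list list \<Rightarrow> ('x + 'k + 'm) list" where E: "inj E"
    using inj_list_list_code[OF ts] by blast
  have 1: "inj (\<lambda>(xs, g). E [map Inl xs, c\<^sub>0 g])"
  proof (rule injI, clarify)
    fix xs g xs' g' assume "E [map Inl xs, c\<^sub>0 g] = E [map Inl xs', c\<^sub>0 g']"
    from injD[OF E this] have "map (Inl :: 'x \<Rightarrow> 'x + 'k + 'm) xs = map Inl xs'" "c\<^sub>0 g = c\<^sub>0 g'" by simp_all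
    then show "xs = xs' \<and> g = g'" using injD[OF c\<^sub>0] inj_map_eq_map[OF inj_Inl] by blast
  qed
  have 2: "inj (\<lambda>k :: 'k. [Inr (Inl k) :: 'x + 'k + 'm])" by (rule injI) simp
  obtain c :: "('x list \<times> 'g \<Rightarrow> 'k) \<Rightarrow> ('x + 'k + 'm) list"
    where c: "inj_on c {f. finite {i. f i \<noteq> \<zero>\<^bsub>R\<^esub>}}"
    using finite_support_code[OF ts 1 2] by blast
  have ci: "inj_on c (carrier (obj ?F X))" for X
    by (rule inj_on_subset[OF c]) (use free_carrierD(2) in blast)
  let ?P = "fi_transport (\<lambda>X. c) ?F" and ?d = "\<lambda>X. inv_into (carrier (obj ?F X)) c"
  have t: "fi_epi R ?F ?P (\<lambda>X. c)" and d: "fi_hom R ?P ?F ?d"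
    by (rule fi_epi_transport[OF F ci], rule fi_hom_transport_inv[OF F ci])
  have dc: "?d X (c a) = a" if "a \<in> carrier (obj ?F X)" for X a
    by (rule inv_into_f_f[OF ci that])
  have cd: "c (?d X p) = p" if "finite X" "p \<in> carrier (obj ?P X)" for X p
    using that(2) unfolding fi_epi_surj[OF t that(1), symmetric] by (rule f_inv_into_f)
  have de: "fi_epi R ?P ?F ?d"
    unfolding fi_epi_def
  proof (intro conjI allI impI d)
    fix X :: "'x set" assume X: "finite X"
    show "?d X ` carrier (obj ?P X) = carrier (obj ?F X)"
      using dc by (simp add: fi_epi_surj[OF t X, symmetric] image_image)
  qed
  have "fi_projective R ?P"
    unfolding fi_projective_def
  proof (intro conjI allI impI)
    show "fi_module R ?P" by (rule fi_hom_dom[OF d])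
    fix A B :: "('x, 'k, ('x + 'k + 'm) list) fi_mod" and g h
    assume g: "fi_epi R A B g" and h: "fi_hom R ?P B h"
    obtain l where l: "fi_hom R ?F A l"
      "\<And>X a. finite X \<Longrightarrow> a \<in> carrier (obj ?F X) \<Longrightarrow> g X (l X a) = h X (c a)"
      using free_lift[OF ys g fi_hom_comp[OF fi_epi_hom[OF t] h]] by blast
    have "g X (l X (?d X p)) = h X p" if "finite X" "p \<in> carrier (obj ?P X)" for X p
      by (simp only: l(2)[OF that(1) fi_hom_closed[OF d that]] cd[OF that])
    then show "\<exists>l. fi_hom R ?P A l \<and> (\<forall>X. finite X \<longrightarrow> (\<forall>v\<in>carrier (obj ?P X). g X (l X v) = h X v))"
      using fi_hom_comp[OF d l(1)] by (intro exI[where x = "\<lambda>X p. l X (?d X p)"]) simp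
  qed
  then show ?thesis using fi_epi_comp[OF de cov] by blast
qed

text \<open>One step of a resolution: a projective cover of the kernel of \<phi>.\<close>

lemma exact_cover:
  fixes A :: "('x, 'k, ('x + 'k + 'm) list) fi_mod" and B :: "('x, 'k, 'b) fi_mod"
  assumes \<phi>: "fi_hom R A B \<phi>" and e: "inj (e :: 'x option \<Rightarrow> 'x)"
  shows "\<exists>(P :: ('x, 'k, ('x + 'k + 'm) list) fi_mod) g. fi_projective R P \<and> fi_exact R P A B g \<phi>"
proof -
  note A = fi_hom_dom[OF \<phi>] and K = fi_submodule_kernel[OF \<phi>]
  obtain P :: "('x, 'k, ('x + 'k + 'm) list) fi_mod" and g
    where P: "fi_projective R P" and g: "fi_epi R P (fi_sub A (fi_kernel A B \<phi>)) g"
    using projective_cover[OF fi_module_sub[OF A K] e, of "\<lambda>x. x"] by auto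
  have "fi_hom R P A g"
    by (rule fi_hom_comp[OF fi_epi_hom[OF g] fi_hom_from_sub[OF fi_hom_id[OF A] K]])
  then have "fi_exact R P A B g \<phi>"
    using \<phi> fi_epi_surj[OF g] by (simp add: fi_exact_def fi_image_def)
  then show ?thesis using P by blast
qed

lemma projective_resolution_exists:
  fixes V :: "('x, 'k, 'm) fi_mod"
  assumes V: "fi_module R V" and e: "inj (e :: 'x option \<Rightarrow> 'x)"
  shows "\<exists>P :: ('x, 'k, 'm, ('x + 'k + 'm) list) resolution. projective_resolution R V P"
proof -
  have "inj (\<lambda>v :: 'm. [Inr (Inr v) :: 'x + 'k + 'm])" by (rule injI) simp
  then obtain P0 :: "('x, 'k, ('x + 'k + 'm) list) fi_mod" and \<epsilon>
    where P0: "fi_projective R P0" and \<epsilon>: "fi_epi R P0 V \<epsilon>"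
    using projective_cover[OF V e] by blast
  obtain P1 :: "('x, 'k, ('x + 'k + 'm) list) fi_mod" and d0
    where P1: "fi_projective R P1" and d0: "fi_exact R P1 P0 V d0 \<epsilon>"
    using exact_cover[OF fi_epi_hom[OF \<epsilon>] e] by blast
  \<comment> \<open>A state holds two consecutive terms and the map between them, since the next
    term has to cover the kernel of that map. The clause for \<open>n = 0\<close> fixes the start,
    so that the augmentation \<epsilon> can be attached.\<close>
  let ?good = "\<lambda>n :: nat. \<lambda>(A :: ('x, 'k, ('x + 'k + 'm) list) fi_mod, B, g). fi_projective R A \<and> fi_projective R B \<and> fi_hom R A B g \<and>
      (n = 0 \<longrightarrow> A = P1 \<and> B = P0 \<and> g = d0)"
  let ?next = "\<lambda>n :: nat. \<lambda>(A :: ('x, 'k, ('x + 'k + 'm) list) fi_mod, B, g) (A', B', g'). B' = A \<and> fi_exact R A' A B g' g"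
  have "\<exists>s. \<forall>n. ?good n (s n) \<and> ?next n (s n) (s (Suc n))"
  proof (rule dependent_nat_choice)
    have "fi_hom R P1 P0 d0" using d0 by (simp add: fi_exact_def)
    then show "\<exists>s. ?good 0 s" using P0 P1 by (intro exI[where x = "(P1, P0, d0)"]) simp
  next
    fix s n assume "?good n s"
    then obtain A B g where s: "s = (A, B, g)" "fi_projective R A" "fi_hom R A B g" by auto
    obtain P :: "('x, 'k, ('x + 'k + 'm) list) fi_mod" and g'
      where P: "fi_projective R P" "fi_exact R P A B g' g"
      using exact_cover[OF s(3) e] by blast
    then have "fi_hom R P A g'" by (simp add: fi_exact_def)
    then show "\<exists>s'. ?good (Suc n) s' \<and> ?next n s s'"
      using P s by (intro exI[where x = "(P, A, g')"]) simp
  qed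
  then obtain s where *: "\<forall>n. ?good n (s n) \<and> ?next n (s n) (s (Suc n))" by (rule exE)
  note s = *[THEN spec, THEN conjunct1] *[THEN spec, THEN conjunct2]
  define A where "A n = fst (s n)" for n
  define B where "B n = fst (snd (s n))" for n
  define g where "g n = snd (snd (s n))" for n
  have sn: "s n = (A n, B n, g n)" for n by (simp add: A_def B_def g_def)
  have good: "fi_projective R (B n)" "A 0 = P1" "B 0 = P0" "g 0 = d0" for n
    using s(1)[of n] s(1)[of 0] by (simp_all add: sn)
  have nxt: "B (Suc n) = A n" "fi_exact R (A (Suc n)) (A n) (B n) (g (Suc n)) (g n)" for n
    using s(2)[of n] by (simp_all add: sn)
  have "projective_resolution R V \<lparr>res_term = B, res_diff = g, res_aug = \<epsilon>\<rparr>"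
    unfolding projective_resolution_def using good nxt d0 \<epsilon> by simp
  then show ?thesis by blast
qed

section \<open>The long exact sequence\<close>

lemma cycles_Suc: "fi_cycles R P (Suc m) X =
    {v \<in> carrier (obj (res_term P (Suc m)) X). res_diff P m X v \<in> fi_J R (res_term P m) X}"
  by (simp add: fi_cycles_def)

text \<open>As the sum of \<open>J\<close> and the image of the differential, the boundaries are a
  submodule, which their definition by differences hides.\<close>

lemma fi_boundaries_iff:
  assumes P: "projective_resolution R V P" and X: "finite X"
  shows "fi_boundaries R P n X = {j \<oplus>\<^bsub>obj (res_term P n) X\<^esub> b | j b.
    j \<in> fi_J R (res_term P n) X \<and> b \<in> res_diff P n X ` carrier (obj (res_term P (Suc n)) X)}"
    (is "_ = ?S")
proof -
  interpret M: module R "obj (res_term P n) X" by (rule fi_obj[OF res_module[OF P] X])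
  note J = fi_J_closed[OF res_module[OF P] X] and d = fi_hom_closed[OF res_hom[OF P] X]
  show ?thesis
  proof (intro equalityI subsetI)
    fix v assume "v \<in> fi_boundaries R P n X"
    then obtain w where v: "v \<in> carrier (obj (res_term P n) X)"
      and w: "w \<in> carrier (obj (res_term P (Suc n)) X)"
      "v \<ominus>\<^bsub>obj (res_term P n) X\<^esub> res_diff P n X w \<in> fi_J R (res_term P n) X"
      by (auto simp: fi_boundaries_def)
    have "v = (v \<ominus>\<^bsub>obj (res_term P n) X\<^esub> res_diff P n X w) \<oplus>\<^bsub>obj (res_term P n) X\<^esub> res_diff P n X w"
      using v d[OF w(1)] by (simp add: a_minus_def M.a_assoc M.l_neg)
    then show "v \<in> ?S" using w by blast
  next
    fix v assume "v \<in> ?S"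
    then obtain j w where v: "v = j \<oplus>\<^bsub>obj (res_term P n) X\<^esub> res_diff P n X w"
      and j: "j \<in> fi_J R (res_term P n) X" and w: "w \<in> carrier (obj (res_term P (Suc n)) X)" by blast
    have "v \<ominus>\<^bsub>obj (res_term P n) X\<^esub> res_diff P n X w = j"
      using J[OF j] d[OF w] by (simp add: v a_minus_def M.a_assoc M.r_neg)
    then have "v \<ominus>\<^bsub>obj (res_term P n) X\<^esub> res_diff P n X w \<in> fi_J R (res_term P n) X" using j by simp
    moreover have "v \<in> carrier (obj (res_term P n) X)" using J[OF j] d[OF w] by (simp add: v)
    ultimately show "v \<in> fi_boundaries R P n X" unfolding fi_boundaries_def using w by blast
  qed
qed

lemma boundaries_facts:
  assumes P: "projective_resolution R V P" and X: "finite X"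
  shows submodule_boundaries: "submodule (fi_boundaries R P n X) R (obj (res_term P n) X)"
    and J_boundaries: "v \<in> fi_J R (res_term P n) X \<Longrightarrow> v \<in> fi_boundaries R P n X"
    and diff_boundaries: "w \<in> carrier (obj (res_term P (Suc n)) X) \<Longrightarrow> res_diff P n X w \<in> fi_boundaries R P n X"
    and boundaries_cycles: "v \<in> fi_boundaries R P n X \<Longrightarrow> v \<in> fi_cycles R P n X"
proof -
  interpret M: module R "obj (res_term P n) X" by (rule fi_obj[OF res_module[OF P] X])
  note J = fi_J_submodule_obj[OF res_module[OF P] X] and d = fi_hom_closed[OF res_hom[OF P] X]
  have D: "submodule (res_diff P n X ` carrier (obj (res_term P (Suc n)) X)) R (obj (res_term P n) X)"
    by (rule fi_submodule_obj[OF fi_submodule_image[OF res_hom[OF P] fi_submodule_carrier[OF res_module[OF P]]] X])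
  show B: "submodule (fi_boundaries R P n X) R (obj (res_term P n) X)"
    unfolding fi_boundaries_iff[OF P X] by (rule submodule_sum[OF M.module_axioms J D])
  show "v \<in> fi_boundaries R P n X" if v: "v \<in> fi_J R (res_term P n) X"
  proof -
    have "v = v \<oplus>\<^bsub>obj (res_term P n) X\<^esub> \<zero>\<^bsub>obj (res_term P n) X\<^esub>"
      using submodule_closed[OF J v] by simp
    then show ?thesis unfolding fi_boundaries_iff[OF P X] using v submodule_zero[OF D] by blast
  qed
  show "res_diff P n X w \<in> fi_boundaries R P n X" if w: "w \<in> carrier (obj (res_term P (Suc n)) X)"
  proof -
    have "res_diff P n X w = \<zero>\<^bsub>obj (res_term P n) X\<^esub> \<oplus>\<^bsub>obj (res_term P n) X\<^esub> res_diff P n X w"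
      using d[OF w] by simp
    then show ?thesis unfolding fi_boundaries_iff[OF P X] using w submodule_zero[OF J] by blast
  qed
  show "v \<in> fi_cycles R P n X" if v: "v \<in> fi_boundaries R P n X"
  proof -
    obtain j w where jw: "v = j \<oplus>\<^bsub>obj (res_term P n) X\<^esub> res_diff P n X w"
      "j \<in> fi_J R (res_term P n) X" "w \<in> carrier (obj (res_term P (Suc n)) X)"
      using v unfolding fi_boundaries_iff[OF P X] by blast
    note jc = submodule_closed[OF J jw(2)]
    have "res_diff P m X v \<in> fi_J R (res_term P m) X" if n: "n = Suc m" for m
    proof -
      interpret N: module R "obj (res_term P m) X" by (rule fi_obj[OF res_module[OF P] X])
      have h: "fi_hom R (res_term P n) (res_term P m) (res_diff P m)" using res_hom[OF P, of m] n by simp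
      have "res_diff P m X (res_diff P n X w) = \<zero>\<^bsub>obj (res_term P m) X\<^esub>"
        using res_diff_diff[OF P X, of w m] jw(3) n by simp
      then have "res_diff P m X v = res_diff P m X j"
        using fi_hom_add[OF h X jc d[OF jw(3)]] fi_hom_closed[OF h X jc] jw(1) by simp
      then show ?thesis using fi_J_hom[OF h X jw(2)] by simp
    qed
    then show ?thesis using submodule_closed[OF B v] by (simp add: fi_cycles_def)
  qed
qed

text \<open>Serves to pass between maps that agree only up to boundaries or up to
  \<open>J\<close>.\<close>

lemma submodule_diff_cancel:
  assumes "module R M" "submodule N R M" "u \<in> carrier M" "v \<in> carrier M" "u \<ominus>\<^bsub>M\<^esub> v \<in> N"
  shows "u \<in> N \<longleftrightarrow> v \<in> N"
proof -
  interpret M: module R M by fact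
  have "(u \<ominus>\<^bsub>M\<^esub> v) \<oplus>\<^bsub>M\<^esub> v = u" "u \<ominus>\<^bsub>M\<^esub> (u \<ominus>\<^bsub>M\<^esub> v) = v"
    using assms(3,4) by (simp_all add: a_minus_def M.a_assoc M.l_neg M.minus_add M.r_neg1 M.r_neg2)
  then show ?thesis
    using submodule_add[OF assms(2,5), of v] submodule_minus[OF assms(2), of u, OF _ assms(5)] by auto
qed

lemma fi_class_eqI:
  assumes P: "projective_resolution R V P" and X: "finite X"
    and u: "u \<in> fi_cycles R P n X" and v: "v \<in> fi_cycles R P n X"
    and uv: "u \<ominus>\<^bsub>obj (res_term P n) X\<^esub> v \<in> fi_boundaries R P n X"
  shows "fi_class R P n X u = fi_class R P n X v"
proof -
  let ?A = "fi_sub (res_term P n) (fi_cycles R P n)" and ?H = "homology (F_terms R P) (F_diffs R P) n"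
  note h = fi_epi_hom[OF fi_epi_class[OF P, of n]]
  interpret H: module R "obj ?H X" by (rule fi_obj[OF fi_hom_cod[OF h] X])
  interpret M: module R "obj (res_term P n) X" by (rule fi_obj[OF res_module[OF P] X])
  interpret A: module R "obj ?A X" by (rule fi_obj[OF fi_hom_dom[OF h] X])
  note C = fi_submodule_obj[OF fi_submodule_cycles[OF P] X, of n]
  have u': "u \<in> carrier (obj ?A X)" and v': "v \<in> carrier (obj ?A X)" using u v by simp_all
  \<comment> \<open>Negation is defined through the carrier, so differences in the submodule of
    cycles and in the ambient module must be identified before the class map is applied.\<close>
  note uc = submodule_closed[OF C u] and vc = submodule_closed[OF C v]
  have "\<ominus>\<^bsub>obj ?A X\<^esub> v = \<ominus>\<^bsub>obj (res_term P n) X\<^esub> v"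
    using A.minus_equality[of "\<ominus>\<^bsub>obj (res_term P n) X\<^esub> v" v] submodule_neg[OF C v] v vc
    by (simp add: M.l_neg)
  then have "u \<ominus>\<^bsub>obj ?A X\<^esub> v = u \<ominus>\<^bsub>obj (res_term P n) X\<^esub> v" by (simp add: a_minus_def)
  then have "fi_class R P n X (u \<ominus>\<^bsub>obj ?A X\<^esub> v) = \<zero>\<^bsub>obj ?H X\<^esub>"
    using fi_class_zero_iff[OF P X boundaries_cycles[OF P X uv]] uv by simp
  then show ?thesis
    using fi_hom_minus[OF h X u' v'] H.minus_eq_zero_iff fi_hom_closed[OF h X u'] fi_hom_closed[OF h X v']
    by simp
qed

lemma fi_class_surj:
  assumes P: "projective_resolution R V P" and X: "finite X"
  shows "carrier (obj (homology (F_terms R P) (F_diffs R P) n) X) = fi_class R P n X ` fi_cycles R P n X"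
  using fi_epi_surj[OF fi_epi_class[OF P] X] by simp

section \<open>The shifted resolution and the maps of the long exact sequence\<close>

definition shift_resolution ::
  "('x option \<Rightarrow> 'x) \<Rightarrow> ('x, 'k, 'm, 'u) resolution \<Rightarrow> ('x, 'k, 'm, 'u) resolution" where
  "shift_resolution e P = \<lparr>res_term = (\<lambda>n. shift e (res_term P n)),
     res_diff = (\<lambda>n X. res_diff P n (add_point e X)), res_aug = (\<lambda>X. res_aug P (add_point e X))\<rparr>"

lemma shift_resolution_simps [simp]:
  "res_term (shift_resolution e P) n = shift e (res_term P n)"
  "res_diff (shift_resolution e P) n X = res_diff P n (add_point e X)"
  "res_aug (shift_resolution e P) X = res_aug P (add_point e X)"
  by (simp_all add: shift_resolution_def)

lemma projective_resolution_shift: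
  fixes P :: "('x, 'k, 'm, 'u) resolution"
  assumes P: "projective_resolution R V P" and e: "inj e"
    and c: "coind_code (c :: ('x option \<Rightarrow> 'u) \<Rightarrow> 'u)"
  shows "projective_resolution R (shift e V) (shift_resolution e P)"
proof -
  note * = P[unfolded projective_resolution_def]
  note ex = *[THEN conjunct2, THEN conjunct1, THEN spec]
    *[THEN conjunct2, THEN conjunct2, THEN conjunct1]
  have 1: "(\<lambda>X. res_diff P n (add_point e X)) = res_diff (shift_resolution e P) n" for n
    by (simp add: shift_resolution_def)
  have 2: "(\<lambda>X. res_aug P (add_point e X)) = res_aug (shift_resolution e P)"
    by (simp add: shift_resolution_def)
  show ?thesis
    unfolding projective_resolution_def shift_resolution_simps(1)
    by (intro conjI allI fi_projective_shift[OF res_projective[OF P] e c]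
        fi_exact_shift[OF ex(1) e, unfolded 1] fi_exact_shift[OF ex(2) e, unfolded 1 2]
        fi_epi_shift[OF res_aug_epi[OF P] e, unfolded 2])
qed

lemma is_lift_shift_incl:
  fixes P :: "('x, 'k, 'm, 'u) resolution"
  assumes P: "projective_resolution R V P" and e: "inj e"
  shows "is_lift R P (shift_resolution e P) (shift_incl e V) (\<lambda>n. shift_incl e (res_term P n))"
  unfolding is_lift_def shift_resolution_simps
  using shift_incl_natural[OF res_hom[OF P] e] shift_incl_natural[OF fi_epi_hom[OF res_aug_epi[OF P]] e]
    fi_hom_shift_incl[OF res_module[OF P] e] by simp

lemma fi_sub_shift: "fi_sub (shift e V) (\<lambda>X. N (add_point e X)) = shift e (fi_sub V N)"
  by (simp add: fi_sub_def shift_def)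

text \<open>\<open>P\<close> and \<open>Q\<close> stand for the chosen resolutions of
  \<open>V\<close> and \<open>S V\<close>, \<Phi> for the chosen lift of \<iota>; \<alpha> and
  \<beta> compare \<open>S P\<close> with \<open>Q\<close> over the identity. The retractions
  \<open>\<rho> n\<close> are given degree by degree, with no relation to the differentials.\<close>

locale shifted_resolution =
  fixes R :: "('k, 'r) ring_scheme" and V :: "('x, 'k, 'm) fi_mod" and e :: "'x option \<Rightarrow> 'x"
    and P Q :: "('x, 'k, 'm, 'u) resolution"
    and \<rho> \<alpha> \<beta> \<Phi> :: "nat \<Rightarrow> 'x set \<Rightarrow> 'u \<Rightarrow> 'u"
  assumes e: "inj e"
    and P: "projective_resolution R V P"
    and Q: "projective_resolution R (shift e V) Q"
    and SP: "projective_resolution R (shift e V) (shift_resolution e P)"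
    and \<rho>: "\<And>n. fi_hom R (shift e (res_term P n)) (res_term P n) (\<rho> n)"
    and \<rho>_incl: "\<And>n X v. finite X \<Longrightarrow> v \<in> carrier (obj (res_term P n) X) \<Longrightarrow>
      \<rho> n X (shift_incl e (res_term P n) X v) = v"
    and \<alpha>: "is_lift R (shift_resolution e P) Q (\<lambda>X v. v) \<alpha>"
    and \<beta>: "is_lift R Q (shift_resolution e P) (\<lambda>X v. v) \<beta>"
    and \<Phi>: "is_lift R P Q (shift_incl e V) \<Phi>"
begin

abbreviation \<iota> :: "nat \<Rightarrow> 'x set \<Rightarrow> 'u \<Rightarrow> 'u" where "\<iota> n \<equiv> shift_incl e (res_term P n)"
abbreviation S :: "('x, 'k, 'm, 'u) resolution" where "S \<equiv> shift_resolution e P"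
abbreviation HP :: "nat \<Rightarrow> ('x, 'k, 'u set set) fi_mod" where "HP n \<equiv> homology (F_terms R P) (F_diffs R P) n"
abbreviation HQ :: "nat \<Rightarrow> ('x, 'k, 'u set set) fi_mod" where "HQ n \<equiv> homology (F_terms R Q) (F_diffs R Q) n"
abbreviation H\<Phi> :: "nat \<Rightarrow> 'x set \<Rightarrow> 'u set set \<Rightarrow> 'u set set" where
  "H\<Phi> n \<equiv> homology_map (F_terms R Q) (F_diffs R Q) n (fi_F_map R (res_term Q n) (\<Phi> n))"

lemmas P_obj = fi_obj[OF res_module[OF P]] and Q_obj = fi_obj[OF res_module[OF Q]]
  and S_obj = fi_obj[OF res_module[OF SP]]

lemma \<iota>: "is_lift R P S (shift_incl e V) \<iota>"
  by (rule is_lift_shift_incl[OF P e])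

lemma \<iota>_closed: "finite X \<Longrightarrow> v \<in> carrier (obj (res_term P n) X) \<Longrightarrow>
    \<iota> n X v \<in> carrier (obj (res_term P n) (add_point e X))"
  using fi_hom_closed[OF lift_hom[OF \<iota>]] by simp

text \<open>On representatives the map \<open>F (S P) \<rightarrow> S (F P)\<close> is the identity,
  and \<open>J (S P\<^sub>n)\<close> lies in the shift of \<open>J P\<^sub>n\<close>.\<close>

lemma S_cycles: 
  assumes X: "finite X" and v: "v \<in> fi_cycles R S n X"
  shows "v \<in> fi_cycles R P n (add_point e X)"
  using v fi_J_shift_subset[OF res_module[OF P] e X] by (simp add: fi_cycles_def)

lemma S_boundaries:
  assumes X: "finite X" and v: "v \<in> fi_boundaries R S n X"
  shows "v \<in> fi_boundaries R P n (add_point e X)"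
  using v fi_J_shift_subset[OF res_module[OF P] e X] unfolding fi_boundaries_def by auto

text \<open>Write \<open>v = j + \<iota> u\<close> with \<open>j\<close> in
  \<open>J (S P\<^sub>n)\<close>. Then \<open>\<rho> v = \<rho> j + u\<close>, so
  \<open>v - \<iota> (\<rho> v) = j - \<iota> (\<rho> j)\<close>. Thus \<rho> extracts the component
  of \<open>v\<close> from \<open>P\<^sub>n\<close>, up to \<open>J\<close>, by a
  homomorphism.\<close>

lemma J_shift_diff:
  assumes X: "finite X" and v: "v \<in> fi_J R (res_term P n) (add_point e X)"
  shows "v \<ominus>\<^bsub>obj (res_term P n) (add_point e X)\<^esub> \<iota> n X (\<rho> n X v) \<in> fi_J R (shift e (res_term P n)) X"
proof -
  note X' = finite_add_point[OF X, of e]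
  interpret M: module R "obj (res_term P n) (add_point e X)" by (rule P_obj[OF X'])
  interpret N: module R "obj (res_term P n) X" by (rule P_obj[OF X])
  note SM = fi_module_shift[OF res_module[OF P, of n] e]
  note i = fi_hom_shift_incl[OF res_module[OF P, of n] e]
  obtain j u where j: "j \<in> fi_J R (shift e (res_term P n)) X" and u: "u \<in> carrier (obj (res_term P n) X)"
    and v: "v = j \<oplus>\<^bsub>obj (res_term P n) (add_point e X)\<^esub> \<iota> n X u"
    using fi_J_add_point[OF res_module[OF P] e X v] by blast
  have jc: "j \<in> carrier (obj (shift e (res_term P n)) X)" by (rule fi_J_closed[OF SM X j])
  have iu: "\<iota> n X u \<in> carrier (obj (shift e (res_term P n)) X)" by (rule fi_hom_closed[OF i X u])
  have rj: "\<rho> n X j \<in> fi_J R (res_term P n) X" by (rule fi_J_hom[OF \<rho> X j])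
  have rjc: "\<rho> n X j \<in> carrier (obj (res_term P n) X)" by (rule fi_hom_closed[OF \<rho> X jc])
  have irj: "\<iota> n X (\<rho> n X j) \<in> fi_J R (shift e (res_term P n)) X" by (rule fi_J_hom[OF i X rj])
  have irjc: "\<iota> n X (\<rho> n X j) \<in> carrier (obj (shift e (res_term P n)) X)" by (rule fi_J_closed[OF SM X irj])
  have "\<rho> n X v = \<rho> n X j \<oplus>\<^bsub>obj (res_term P n) X\<^esub> u"
    using fi_hom_add[OF \<rho> X jc iu] by (simp add: v \<rho>_incl[OF X u])
  then have "\<iota> n X (\<rho> n X v) = \<iota> n X (\<rho> n X j) \<oplus>\<^bsub>obj (res_term P n) (add_point e X)\<^esub> \<iota> n X u"
    using fi_hom_add[OF i X rjc u] by simp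
  then have "v \<ominus>\<^bsub>obj (res_term P n) (add_point e X)\<^esub> \<iota> n X (\<rho> n X v) =
      j \<ominus>\<^bsub>obj (res_term P n) (add_point e X)\<^esub> \<iota> n X (\<rho> n X j)"
    using jc iu irjc
    by (simp add: v a_minus_def M.minus_add M.a_ac M.r_neg1 M.r_neg2 M.r_neg)
  then show ?thesis using submodule_minus[OF fi_J_submodule_obj[OF SM X] j irj] by simp
qed

text \<open>The injectivity of \<open>F P\<^sub>n \<rightarrow> F (S P\<^sub>n)\<close>, supplied by
  the retraction.\<close>

lemma \<rho>_J:
  assumes X: "finite X" and y: "y \<in> carrier (obj (res_term P n) X)"
    and iy: "\<iota> n X y \<in> fi_J R (shift e (res_term P n)) X"
  shows "y \<in> fi_J R (res_term P n) X"
  using fi_J_hom[OF \<rho> X iy] \<rho>_incl[OF X y] by simp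

text \<open>As \<iota> commutes with the differentials, \<open>\<rho>_J\<close> applies to the
  differential of \<open>y\<close>.\<close>

lemma incl_cycle:
  assumes X: "finite X" and y: "y \<in> carrier (obj (res_term P n) X)"
    and iy: "\<iota> n X y \<in> fi_cycles R S n X"
  shows "y \<in> fi_cycles R P n X"
proof -
  have "res_diff P m X y \<in> fi_J R (res_term P m) X" if n: "n = Suc m" for m
  proof (rule \<rho>_J[OF X])
    have y': "y \<in> carrier (obj (res_term P (Suc m)) X)" using y by (simp only: n)
    show "res_diff P m X y \<in> carrier (obj (res_term P m) X)" by (rule fi_hom_closed[OF res_hom[OF P] X y'])
    have "\<iota> (Suc m) X y \<in> fi_cycles R S (Suc m) X" using iy by (simp only: n)
    then have "res_diff S m X (\<iota> (Suc m) X y) \<in> fi_J R (res_term S m) X" by (simp only: cycles_Suc mem_Collect_eq)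
    then show "\<iota> m X (res_diff P m X y) \<in> fi_J R (shift e (res_term P m)) X"
      by (simp only: lift_diff[OF \<iota> X y'] shift_resolution_simps(1))
  qed
  then show ?thesis using y by (simp add: fi_cycles_def)
qed

text \<open>
  A cycle \<open>q\<close> of \<open>P\<^sub>a\<^sub>+\<^sub>1\<close> at \<open>X \<squnion> {\<star>}\<close> has \<open>d q = j + \<iota> y\<close> with \<open>j \<in> J (S P\<^sub>a)\<close>, and the connecting map sends
  the class of \<open>q\<close> to that of \<open>y\<close>.  As \<open>\<rho> (d q) - y \<in> J P\<^sub>a\<close>, one may take \<open>y = \<rho> (d q)\<close>.
\<close>

definition conn :: "nat \<Rightarrow> 'x set \<Rightarrow> 'u \<Rightarrow> 'u" where
  "conn a X q = \<rho> a X (res_diff P a (add_point e X) q)"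

text \<open>In \<open>F (S P)\<close> the element \<open>\<iota> (conn q)\<close> agrees with
  \<open>d q\<close> modulo \<open>J\<close>, so it is a boundary, in particular a cycle;
  \<open>incl_cycle\<close> then brings the cycle condition back to \<open>P\<close>.\<close>

lemma conn:
  assumes X: "finite X" and q: "q \<in> fi_cycles R P (Suc a) (add_point e X)"
  shows conn_closed: "conn a X q \<in> carrier (obj (res_term P a) X)"
    and conn_diff: "res_diff P a (add_point e X) q \<ominus>\<^bsub>obj (res_term P a) (add_point e X)\<^esub> \<iota> a X (conn a X q)
      \<in> fi_J R (shift e (res_term P a)) X"
    and conn_incl: "\<iota> a X (conn a X q) \<in> fi_boundaries R S a X"
    and conn_cycle: "conn a X q \<in> fi_cycles R P a X"
proof -
  note X' = finite_add_point[OF X, of e]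
  interpret M: module R "obj (res_term P a) (add_point e X)" by (rule P_obj[OF X'])
  have qc: "q \<in> carrier (obj (res_term P (Suc a)) (add_point e X))"
    and dq: "res_diff P a (add_point e X) q \<in> fi_J R (res_term P a) (add_point e X)"
    using q by (simp_all add: fi_cycles_def)
  have dqc: "res_diff P a (add_point e X) q \<in> carrier (obj (res_term P a) (add_point e X))"
    by (rule fi_hom_closed[OF res_hom[OF P] X' qc])
  then show c: "conn a X q \<in> carrier (obj (res_term P a) X)"
    unfolding conn_def by (intro fi_hom_closed[OF \<rho> X]) simp
  note ic = \<iota>_closed[OF X c]
  show d: "res_diff P a (add_point e X) q \<ominus>\<^bsub>obj (res_term P a) (add_point e X)\<^esub> \<iota> a X (conn a X q)
      \<in> fi_J R (shift e (res_term P a)) X"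
    unfolding conn_def by (rule J_shift_diff[OF X dq])
  have 1: "res_diff S a X q \<ominus>\<^bsub>obj (res_term S a) X\<^esub> \<iota> a X (conn a X q) \<in> fi_boundaries R S a X"
    by (rule J_boundaries[OF SP X]) (use d in simp)
  have 2: "res_diff S a X q \<in> fi_boundaries R S a X"
    by (rule diff_boundaries[OF SP X]) (use qc in simp)
  show b: "\<iota> a X (conn a X q) \<in> fi_boundaries R S a X"
    by (rule iffD1[OF submodule_diff_cancel[OF S_obj[OF X] submodule_boundaries[OF SP X] _ _ 1] 2])
      (use ic dqc in simp_all)
  show "conn a X q \<in> fi_cycles R P a X"
    by (rule incl_cycle[OF X c boundaries_cycles[OF SP X b]])
qed

text \<open>In each case two lifts of the same map are compared by \<open>lifts_agree\<close>. On
  homology \<alpha> and \<beta> are therefore inverse to each other, and \<Phi> may be replaced by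
  \<iota> followed by \<alpha>.\<close>

lemma agree:
  assumes X: "finite X"
  shows agree_\<Phi>: "y \<in> fi_cycles R P n X \<Longrightarrow>
      \<Phi> n X y \<ominus>\<^bsub>obj (res_term Q n) X\<^esub> \<alpha> n X (\<iota> n X y) \<in> fi_boundaries R Q n X"
    and agree_\<beta>\<Phi>: "y \<in> fi_cycles R P n X \<Longrightarrow>
      \<beta> n X (\<Phi> n X y) \<ominus>\<^bsub>obj (res_term S n) X\<^esub> \<iota> n X y \<in> fi_boundaries R S n X"
    and agree_\<alpha>\<beta>: "q \<in> fi_cycles R Q n X \<Longrightarrow>
      \<alpha> n X (\<beta> n X q) \<ominus>\<^bsub>obj (res_term Q n) X\<^esub> q \<in> fi_boundaries R Q n X"
    and agree_\<beta>\<alpha>: "p \<in> fi_cycles R S n X \<Longrightarrow>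
      \<beta> n X (\<alpha> n X p) \<ominus>\<^bsub>obj (res_term S n) X\<^esub> p \<in> fi_boundaries R S n X"
  by (rule lifts_agree[OF P Q \<Phi> is_lift_comp[OF \<iota> \<alpha> P] X], assumption)
    (rule lifts_agree[OF P SP is_lift_comp[OF \<Phi> \<beta> P] \<iota> X], assumption,
     rule lifts_agree[OF Q Q is_lift_comp[OF \<beta> \<alpha> Q] is_lift_id[OF Q] X], assumption,
     rule lifts_agree[OF SP SP is_lift_comp[OF \<alpha> \<beta> SP] is_lift_id[OF SP] X], assumption)

text \<open>\<theta> is \<beta> followed by the map \<open>F (S P) \<rightarrow> S (F P)\<close>,
  which does not change representatives.\<close>

lemma theta_exists: "\<exists>\<theta>. fi_hom R (HQ a) (shift e (HP a)) \<theta> \<and>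
    (\<forall>X. finite X \<longrightarrow> (\<forall>q \<in> fi_cycles R Q a X.
      \<theta> X (fi_class R Q a X q) = fi_class R P a (add_point e X) (\<beta> a X q)))"
proof -
  let ?A = "fi_sub (res_term Q a) (fi_cycles R Q a)"
  note cP = fi_epi_class[OF P, of a] and cQ = fi_epi_class[OF Q, of a]
  have bc: "\<beta> a X q \<in> fi_cycles R P a (add_point e X)" if "finite X" "q \<in> fi_cycles R Q a X" for X q
    by (rule S_cycles[OF that(1) lift_cycles[OF Q \<beta> that]])
  have "fi_hom R ?A (fi_sub (shift e (res_term P a)) (\<lambda>X. fi_cycles R P a (add_point e X))) (\<beta> a)"
  proof (rule fi_hom_to_sub)
    show "fi_hom R ?A (shift e (res_term P a)) (\<beta> a)"
      by (rule fi_hom_from_sub[OF lift_hom[OF \<beta>, unfolded shift_resolution_simps(1)] fi_submodule_cycles[OF Q]])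
    show "fi_submodule R (shift e (res_term P a)) (\<lambda>X. fi_cycles R P a (add_point e X))"
      by (rule fi_submodule_shift[OF fi_submodule_cycles[OF P] e])
  qed (use bc in simp)
  from fi_hom_comp[OF this[unfolded fi_sub_shift] fi_hom_shift[OF fi_epi_hom[OF cP] e]]
  have h: "fi_hom R ?A (shift e (HP a)) (\<lambda>X q. fi_class R P a (add_point e X) (\<beta> a X q))" .
  have "fi_class R P a (add_point e X) (\<beta> a X q) = \<zero>\<^bsub>obj (shift e (HP a)) X\<^esub>"
    if X: "finite X" and q: "q \<in> carrier (obj ?A X)" and z: "fi_class R Q a X q = \<zero>\<^bsub>obj (HQ a) X\<^esub>" for X q
  proof -
    have q': "q \<in> fi_cycles R Q a X" using q by simp
    have "q \<in> fi_boundaries R Q a X" using fi_class_zero_iff[OF Q X q'] z by simp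
    from S_boundaries[OF X lift_boundaries[OF Q \<beta> X this]]
    show ?thesis using fi_class_zero_iff[OF P finite_add_point[OF X] bc[OF X q']] by simp
  qed
  from fi_hom_factor[OF cQ h this] show ?thesis by (simp only: fi_sub_simps)
qed

text \<open>A boundary is \<open>q = j + d w\<close>, and \<open>j = j' + \<iota> u\<close> with
  \<open>j'\<close> in \<open>J (S P)\<close>. Hence \<open>d q = d j' + \<iota> (d u)\<close>, and
  \<rho> sends it to \<open>\<rho> (d j') + d u\<close>, which is again a boundary.\<close>

lemma delta_exists: "\<exists>\<delta>. fi_hom R (shift e (HP (Suc a))) (HP a) \<delta> \<and>
    (\<forall>X. finite X \<longrightarrow> (\<forall>q \<in> fi_cycles R P (Suc a) (add_point e X).
      \<delta> X (fi_class R P (Suc a) (add_point e X) q) = fi_class R P a X (conn a X q)))"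
proof -
  let ?A = "fi_sub (res_term P (Suc a)) (fi_cycles R P (Suc a))"
  note c0 = fi_epi_class[OF P, of a] and c1 = fi_epi_class[OF P, of "Suc a"]
  have "fi_hom R (shift e ?A) (fi_sub (res_term P a) (fi_cycles R P a)) (conn a)"
  proof (rule fi_hom_to_sub[OF _ fi_submodule_cycles[OF P]])
    show "fi_hom R (shift e ?A) (res_term P a) (conn a)"
      unfolding conn_def[abs_def]
      by (rule fi_hom_comp[OF fi_hom_shift[OF fi_hom_from_sub[OF res_hom[OF P] fi_submodule_cycles[OF P]] e] \<rho>])
  qed (use conn_cycle in simp)
  from fi_hom_comp[OF this fi_epi_hom[OF c0]]
  have h: "fi_hom R (shift e ?A) (HP a) (\<lambda>X q. fi_class R P a X (conn a X q))" .
  have "fi_class R P a X (conn a X q) = \<zero>\<^bsub>obj (HP a) X\<^esub>"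
    if X: "finite X" and q: "q \<in> carrier (obj (shift e ?A) X)"
      and z: "fi_class R P (Suc a) (add_point e X) q = \<zero>\<^bsub>obj (shift e (HP (Suc a))) X\<^esub>" for X q
  proof -
    note X' = finite_add_point[OF X, of e]
    interpret M0: module R "obj (res_term P a) X" by (rule P_obj[OF X])
    interpret M0': module R "obj (res_term P a) (add_point e X)" by (rule P_obj[OF X'])
    have q': "q \<in> fi_cycles R P (Suc a) (add_point e X)" using q by simp
    have "q \<in> fi_boundaries R P (Suc a) (add_point e X)" using fi_class_zero_iff[OF P X' q'] z by simp
    then obtain j w where qj: "q = j \<oplus>\<^bsub>obj (res_term P (Suc a)) (add_point e X)\<^esub> res_diff P (Suc a) (add_point e X) w"
      and j: "j \<in> fi_J R (res_term P (Suc a)) (add_point e X)"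
      and w: "w \<in> carrier (obj (res_term P (Suc (Suc a))) (add_point e X))"
      unfolding fi_boundaries_iff[OF P X'] by blast
    obtain j' u where j': "j' \<in> fi_J R (shift e (res_term P (Suc a))) X"
      and u: "u \<in> carrier (obj (res_term P (Suc a)) X)"
      and jj': "j = j' \<oplus>\<^bsub>obj (res_term P (Suc a)) (add_point e X)\<^esub> \<iota> (Suc a) X u"
      using fi_J_add_point[OF res_module[OF P] e X j] by blast
    note d = res_hom[OF P, of a]
    have jc: "j \<in> carrier (obj (res_term P (Suc a)) (add_point e X))" by (rule fi_J_closed[OF res_module[OF P] X' j])
    have jc': "j' \<in> carrier (obj (res_term P (Suc a)) (add_point e X))"
      using fi_J_closed[OF fi_module_shift[OF res_module[OF P] e] X j'] by simp
    note iu = \<iota>_closed[OF X u]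
    have "res_diff P a (add_point e X) q = res_diff P a (add_point e X) j"
      using fi_hom_add[OF d X' jc fi_hom_closed[OF res_hom[OF P] X' w]] res_diff_diff[OF P X' w]
        fi_hom_closed[OF d X' jc] by (simp add: qj)
    also have "\<dots> = res_diff P a (add_point e X) j' \<oplus>\<^bsub>obj (res_term P a) (add_point e X)\<^esub> \<iota> a X (res_diff P a X u)"
      using fi_hom_add[OF d X' jc' iu] lift_diff[OF \<iota> X u] by (simp add: jj')
    finally have dq: "res_diff P a (add_point e X) q = \<dots>" .
    have dj': "res_diff P a (add_point e X) j' \<in> fi_J R (shift e (res_term P a)) X"
      using fi_J_hom[OF res_hom[OF SP, of a] X, of j'] j' by simp
    have djc': "res_diff P a (add_point e X) j' \<in> carrier (obj (shift e (res_term P a)) X)"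
      using fi_hom_closed[OF d X' jc'] by simp
    note du = fi_hom_closed[OF d X u]
    have idu: "\<iota> a X (res_diff P a X u) \<in> carrier (obj (shift e (res_term P a)) X)" using \<iota>_closed[OF X du] by simp
    have "conn a X q = \<rho> a X (res_diff P a (add_point e X) j') \<oplus>\<^bsub>obj (res_term P a) X\<^esub> res_diff P a X u"
      using fi_hom_add[OF \<rho> X djc' idu] \<rho>_incl[OF X du] by (simp add: conn_def dq)
    then have "conn a X q \<in> fi_boundaries R P a X"
      unfolding fi_boundaries_iff[OF P X] using fi_J_hom[OF \<rho> X dj'] u by blast
    then show ?thesis using fi_class_zero_iff[OF P X conn_cycle[OF X q']] by simp
  qed
  from fi_hom_factor[OF fi_epi_shift[OF c1 e] h this] show ?thesis by (simp only: fi_sub_simps shift_simps)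
qed

section \<open>Exactness\<close>

definition \<theta> :: "nat \<Rightarrow> 'x set \<Rightarrow> 'u set set \<Rightarrow> 'u set set" where
  "\<theta> a = (SOME \<theta>. fi_hom R (HQ a) (shift e (HP a)) \<theta> \<and>
    (\<forall>X. finite X \<longrightarrow> (\<forall>q \<in> fi_cycles R Q a X.
      \<theta> X (fi_class R Q a X q) = fi_class R P a (add_point e X) (\<beta> a X q))))"

definition \<delta> :: "nat \<Rightarrow> 'x set \<Rightarrow> 'u set set \<Rightarrow> 'u set set" where
  "\<delta> a = (SOME \<delta>. fi_hom R (shift e (HP (Suc a))) (HP a) \<delta> \<and>
    (\<forall>X. finite X \<longrightarrow> (\<forall>q \<in> fi_cycles R P (Suc a) (add_point e X).
      \<delta> X (fi_class R P (Suc a) (add_point e X) q) = fi_class R P a X (conn a X q))))"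

lemma \<theta>: "fi_hom R (HQ a) (shift e (HP a)) (\<theta> a)"
  "finite X \<Longrightarrow> q \<in> fi_cycles R Q a X \<Longrightarrow>
    \<theta> a X (fi_class R Q a X q) = fi_class R P a (add_point e X) (\<beta> a X q)"
  using someI_ex[OF theta_exists[of a], folded \<theta>_def] by simp_all

lemma \<delta>: "fi_hom R (shift e (HP (Suc a))) (HP a) (\<delta> a)"
  "finite X \<Longrightarrow> q \<in> fi_cycles R P (Suc a) (add_point e X) \<Longrightarrow>
    \<delta> a X (fi_class R P (Suc a) (add_point e X) q) = fi_class R P a X (conn a X q)"
  using someI_ex[OF delta_exists[of a], folded \<delta>_def] by simp_all

lemma H\<Phi>: "fi_hom R (HP a) (HQ a) (H\<Phi> a)"
  "finite X \<Longrightarrow> y \<in> fi_cycles R P a X \<Longrightarrow> H\<Phi> a X (fi_class R P a X y) = fi_class R Q a X (\<Phi> a X y)"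
  by (rule fi_hom_homology_map[OF P Q \<Phi>], rule homology_map_fi_class[OF P Q \<Phi>])

lemma S_lift_closed:
  assumes "finite X"
  shows "p \<in> carrier (obj (res_term P n) (add_point e X)) \<Longrightarrow> \<alpha> n X p \<in> carrier (obj (res_term Q n) X)"
    and "q \<in> carrier (obj (res_term Q n) X) \<Longrightarrow> \<beta> n X q \<in> carrier (obj (res_term P n) (add_point e X))"
  using fi_hom_closed[OF lift_hom[OF \<alpha>] assms] fi_hom_closed[OF lift_hom[OF \<beta>] assms] by simp_all

lemma cyc_closed: "v \<in> fi_cycles R T n X \<Longrightarrow> v \<in> carrier (obj (res_term T n) X)"
  by (simp add: fi_cycles_def)

text \<open>For \<open>y = conn q\<close> the element \<open>\<iota> y\<close> is a boundary, hence
  so are \<open>\<alpha> (\<iota> y)\<close> and \<open>\<Phi> y\<close>. Conversely, if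
  \<open>\<Phi> y\<close> is a boundary, \<beta> shows that \<open>\<iota> y\<close> is one; writing
  it as \<open>d p\<close> modulo \<open>J (S P)\<close> and applying \<rho>, the class of
  \<open>y\<close> is the connecting image of that of \<open>p\<close>.\<close>

lemma exact_delta: "fi_exact R (shift e (HP (Suc a))) (HP a) (HQ a) (\<delta> a) (H\<Phi> a)"
  unfolding fi_exact_def fi_image_def fi_kernel_def shift_simps
proof (intro conjI allI impI equalityI subsetI)
  fix X :: "'x set" and c assume X: "finite X"
  note X' = finite_add_point[OF X, of e]
  note bQ = submodule_diff_cancel[OF Q_obj[OF X] submodule_boundaries[OF Q X]]
  note bS = submodule_diff_cancel[OF S_obj[OF X] submodule_boundaries[OF SP X]]
  {
    assume "c \<in> \<delta> a X ` carrier (obj (HP (Suc a)) (add_point e X))"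
    then obtain q where q: "q \<in> fi_cycles R P (Suc a) (add_point e X)" and c: "c = fi_class R P a X (conn a X q)"
      unfolding fi_class_surj[OF P X'] using \<delta>(2)[OF X] by auto
    note y = conn_cycle[OF X q]
    note yc = cyc_closed[OF y]
    have "\<Phi> a X (conn a X q) \<in> fi_boundaries R Q a X"
      using bQ[OF _ _ agree_\<Phi>[OF X y]] lift_boundaries[OF SP \<alpha> X conn_incl[OF X q]]
        S_lift_closed(1)[OF X \<iota>_closed[OF X yc]] fi_hom_closed[OF lift_hom[OF \<Phi>] X yc] by simp
    then show "c \<in> {v \<in> carrier (obj (HP a) X). H\<Phi> a X v = \<zero>\<^bsub>obj (HQ a) X\<^esub>}"
      using y fi_class_zero_iff[OF Q X lift_cycles[OF P \<Phi> X y]]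
      by (simp add: fi_class_surj[OF P X] c H\<Phi>(2)[OF X])
  next
    assume c: "c \<in> {v \<in> carrier (obj (HP a) X). H\<Phi> a X v = \<zero>\<^bsub>obj (HQ a) X\<^esub>}"
    then obtain y where y: "y \<in> fi_cycles R P a X" and cy: "c = fi_class R P a X y"
      by (auto simp: fi_class_surj[OF P X])
    note yc = cyc_closed[OF y] and iyc = \<iota>_closed[OF X cyc_closed[OF y]]
    have "\<Phi> a X y \<in> fi_boundaries R Q a X"
      using c cy H\<Phi>(2)[OF X y] fi_class_zero_iff[OF Q X lift_cycles[OF P \<Phi> X y]] by simp
    from lift_boundaries[OF Q \<beta> X this] have "\<iota> a X y \<in> fi_boundaries R S a X"
      using bS[OF _ _ agree_\<beta>\<Phi>[OF X y]] iyc
        S_lift_closed(2)[OF X fi_hom_closed[OF lift_hom[OF \<Phi>] X yc]] by simp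
    then obtain p where pc: "p \<in> carrier (obj (res_term P (Suc a)) (add_point e X))"
      and p: "\<iota> a X y \<ominus>\<^bsub>obj (res_term P a) (add_point e X)\<^esub> res_diff P a (add_point e X) p
        \<in> fi_J R (shift e (res_term P a)) X" (is "?z \<in> _")
      by (auto simp: fi_boundaries_def)
    note dp = fi_hom_closed[OF res_hom[OF P] X' pc]
    \<comment> \<open>\<open>\<iota> y\<close> lies in the shift of \<open>J P\<^sub>a\<close>, and
      so does its difference from \<open>d p\<close>; hence \<open>p\<close> is a cycle of
      \<open>S (F P)\<close>.\<close>
    have "res_diff P a (add_point e X) p \<in> fi_J R (res_term P a) (add_point e X)"
      using submodule_diff_cancel[OF P_obj[OF X'] fi_J_submodule_obj[OF res_module[OF P] X'] iyc dp
          fi_J_shift_subset[OF res_module[OF P] e X p]] shift_incl_in_J[where R = R, OF e X yc] by simp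
    then have pcy: "p \<in> fi_cycles R P (Suc a) (add_point e X)" using pc by (simp add: fi_cycles_def)
    have "y \<ominus>\<^bsub>obj (res_term P a) X\<^esub> conn a X p = \<rho> a X ?z"
      using fi_hom_minus[OF \<rho> X, of "\<iota> a X y" a "res_diff P a (add_point e X) p"] iyc dp
      by (simp add: conn_def \<rho>_incl[OF X yc])
    then have "y \<ominus>\<^bsub>obj (res_term P a) X\<^esub> conn a X p \<in> fi_boundaries R P a X"
      using J_boundaries[OF P X fi_J_hom[OF \<rho> X p]] by simp
    from fi_class_eqI[OF P X y conn_cycle[OF X pcy] this]
    have "c = \<delta> a X (fi_class R P (Suc a) (add_point e X) p)" by (simp add: cy \<delta>(2)[OF X pcy])
    then show "c \<in> \<delta> a X ` carrier (obj (HP (Suc a)) (add_point e X))"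
      unfolding fi_class_surj[OF P X'] using pcy by blast
  }
qed (rule \<delta>(1) H\<Phi>(1))+

text \<open>If \<theta> kills the class of \<open>q\<close>, then \<open>\<beta> q = z + d p\<close>
  with \<open>z\<close> in the shift of \<open>J\<close>, and by \<open>J_shift_diff\<close>
  \<open>z\<close> is \<open>\<iota> (\<rho> z)\<close> modulo \<open>J (S P)\<close>. So
  \<open>\<beta> q\<close> is homologous to \<open>\<iota> y\<close> for
  \<open>y = \<rho> z\<close>, and \<alpha> turns this into \<open>q\<close> homologous to
  \<open>\<Phi> y\<close>.\<close>

lemma exact_incl: "fi_exact R (HP a) (HQ a) (shift e (HP a)) (H\<Phi> a) (\<theta> a)"
  unfolding fi_exact_def fi_image_def fi_kernel_def shift_simps
proof (intro conjI allI impI equalityI subsetI)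
  fix X :: "'x set" and c assume X: "finite X"
  note X' = finite_add_point[OF X, of e]
  note bP = submodule_diff_cancel[OF P_obj[OF X'] submodule_boundaries[OF P X']]
  note bS = submodule_diff_cancel[OF S_obj[OF X] submodule_boundaries[OF SP X]]
  {
    assume "c \<in> H\<Phi> a X ` carrier (obj (HP a) X)"
    then obtain y where y: "y \<in> fi_cycles R P a X" and c: "c = fi_class R Q a X (\<Phi> a X y)"
      unfolding fi_class_surj[OF P X] using H\<Phi>(2)[OF X] by auto
    note yc = cyc_closed[OF y] and iyc = \<iota>_closed[OF X cyc_closed[OF y]]
    note fy = lift_cycles[OF P \<Phi> X y]
    have "\<beta> a X (\<Phi> a X y) \<in> fi_boundaries R P a (add_point e X)"
      using bP[OF _ iyc S_boundaries[OF X agree_\<beta>\<Phi>[OF X y], simplified]]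
        S_lift_closed(2)[OF X cyc_closed[OF fy]] J_boundaries[OF P X' shift_incl_in_J[OF e X yc]] by simp
    then show "c \<in> {v \<in> carrier (obj (HQ a) X). \<theta> a X v = \<zero>\<^bsub>obj (HP a) (add_point e X)\<^esub>}"
      using fy fi_class_zero_iff[OF P X' S_cycles[OF X lift_cycles[OF Q \<beta> X fy]]]
      by (simp add: fi_class_surj[OF Q X] c \<theta>(2)[OF X])
  next
    assume c: "c \<in> {v \<in> carrier (obj (HQ a) X). \<theta> a X v = \<zero>\<^bsub>obj (HP a) (add_point e X)\<^esub>}"
    then obtain q where q: "q \<in> fi_cycles R Q a X" and cq: "c = fi_class R Q a X q"
      by (auto simp: fi_class_surj[OF Q X])
    let ?M = "obj (res_term P a) (add_point e X)"
    interpret M: module R ?M by (rule P_obj[OF X'])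
    note bq = lift_cycles[OF Q \<beta> X q]
    have bqc: "\<beta> a X q \<in> carrier ?M" by (rule S_lift_closed(2)[OF X cyc_closed[OF q]])
    have "\<beta> a X q \<in> fi_boundaries R P a (add_point e X)"
      using c cq \<theta>(2)[OF X q] fi_class_zero_iff[OF P X' S_cycles[OF X bq]] by simp
    then obtain p where p: "p \<in> carrier (obj (res_term P (Suc a)) (add_point e X))"
      and z: "\<beta> a X q \<ominus>\<^bsub>?M\<^esub> res_diff P a (add_point e X) p \<in> fi_J R (res_term P a) (add_point e X)" (is "?z \<in> _")
      by (auto simp: fi_boundaries_def)
    note dp = fi_hom_closed[OF res_hom[OF P] X' p]
    have zc: "?z \<in> carrier ?M" using bqc dp by simp
    define y where "y = \<rho> a X ?z"
    have yc: "y \<in> carrier (obj (res_term P a) X)"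
      unfolding y_def by (rule fi_hom_closed[OF \<rho> X]) (use zc in simp)
    note iyc = \<iota>_closed[OF X yc]
    have 1: "?z \<ominus>\<^bsub>?M\<^esub> \<iota> a X y \<in> fi_boundaries R S a X"
      using J_boundaries[OF SP X, of "?z \<ominus>\<^bsub>?M\<^esub> \<iota> a X y" a] J_shift_diff[OF X z] by (simp add: y_def)
    have 2: "res_diff P a (add_point e X) p \<in> fi_boundaries R S a X"
      using diff_boundaries[OF SP X, of p a] p by simp
    have "\<beta> a X q \<ominus>\<^bsub>?M\<^esub> \<iota> a X y = (?z \<ominus>\<^bsub>?M\<^esub> \<iota> a X y) \<oplus>\<^bsub>?M\<^esub> res_diff P a (add_point e X) p"
      using bqc dp iyc by (simp add: a_minus_def M.a_ac M.r_neg1 M.r_neg2 M.r_neg)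
    then have b: "\<beta> a X q \<ominus>\<^bsub>obj (res_term S a) X\<^esub> \<iota> a X y \<in> fi_boundaries R S a X"
      using submodule_add[OF submodule_boundaries[OF SP X] 1 2] by simp
    have "\<iota> a X y \<in> fi_cycles R S a X"
      using submodule_diff_cancel[OF S_obj[OF X] fi_submodule_obj[OF fi_submodule_cycles[OF SP] X] _ _
          boundaries_cycles[OF SP X b]] bqc iyc bq by simp
    note iy = this
    have y: "y \<in> fi_cycles R P a X" by (rule incl_cycle[OF X yc iy])
    have ab: "\<alpha> a X (\<beta> a X q) \<ominus>\<^bsub>obj (res_term Q a) X\<^esub> \<alpha> a X (\<iota> a X y) \<in> fi_boundaries R Q a X"
      using lift_boundaries[OF SP \<alpha> X b] fi_hom_minus[OF lift_hom[OF \<alpha>] X, of "\<beta> a X q" a "\<iota> a X y"] bqc iyc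
      by simp
    have "c = fi_class R Q a X (\<alpha> a X (\<beta> a X q))"
      unfolding cq by (rule fi_class_eqI[OF Q X lift_cycles[OF SP \<alpha> X bq] q agree_\<alpha>\<beta>[OF X q], symmetric])
    also have "\<dots> = fi_class R Q a X (\<alpha> a X (\<iota> a X y))"
      by (rule fi_class_eqI[OF Q X lift_cycles[OF SP \<alpha> X bq] lift_cycles[OF SP \<alpha> X iy] ab])
    also have "\<dots> = fi_class R Q a X (\<Phi> a X y)"
      by (rule fi_class_eqI[OF Q X lift_cycles[OF P \<Phi> X y] lift_cycles[OF SP \<alpha> X iy] agree_\<Phi>[OF X y], symmetric])
    also have "\<dots> = H\<Phi> a X (fi_class R P a X y)" by (rule H\<Phi>(2)[OF X y, symmetric])
    finally show "c \<in> H\<Phi> a X ` carrier (obj (HP a) X)"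
      unfolding fi_class_surj[OF P X] using y by blast
  }
qed (rule \<theta>(1) H\<Phi>(1))+

text \<open>For a cycle \<open>q\<close> of \<open>F Q\<close> the differential of
  \<open>\<beta> q\<close> lies in \<open>J (S P)\<close>, and \<rho> takes it into
  \<open>J P\<close>. Conversely, if \<open>conn p\<close> is \<open>d w\<close> modulo
  \<open>J\<close>, correct \<open>p\<close> to \<open>p' = p - \<iota> w\<close>: the class is
  unchanged since \<open>\<iota> w\<close> lies in the shift of \<open>J\<close>, and now
  \<open>d p'\<close> lies in \<open>J (S P)\<close>, so that \<alpha> can be applied to
  \<open>p'\<close>.\<close>

lemma exact_theta: "fi_exact R (HQ (Suc a)) (shift e (HP (Suc a))) (HP a) (\<theta> (Suc a)) (\<delta> a)"
  unfolding fi_exact_def fi_image_def fi_kernel_def shift_simps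
proof (intro conjI allI impI equalityI subsetI)
  fix X :: "'x set" and c assume X: "finite X"
  note X' = finite_add_point[OF X, of e]
  {
    assume "c \<in> \<theta> (Suc a) X ` carrier (obj (HQ (Suc a)) X)"
    then obtain q where q: "q \<in> fi_cycles R Q (Suc a) X"
      and c: "c = fi_class R P (Suc a) (add_point e X) (\<beta> (Suc a) X q)"
      unfolding fi_class_surj[OF Q X] using \<theta>(2)[OF X] by auto
    note bq = lift_cycles[OF Q \<beta> X q]
    note bq' = S_cycles[OF X bq]
    have "res_diff P a (add_point e X) (\<beta> (Suc a) X q) \<in> fi_J R (shift e (res_term P a)) X"
      using bq by (simp add: fi_cycles_def)
    from fi_J_hom[OF \<rho> X this] have "conn a X (\<beta> (Suc a) X q) \<in> fi_boundaries R P a X"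
      unfolding conn_def by (rule J_boundaries[OF P X])
    then show "c \<in> {v \<in> carrier (obj (HP (Suc a)) (add_point e X)). \<delta> a X v = \<zero>\<^bsub>obj (HP a) X\<^esub>}"
      using bq' fi_class_zero_iff[OF P X conn_cycle[OF X bq']]
      by (simp add: fi_class_surj[OF P X'] c \<delta>(2)[OF X])
  next
    assume c: "c \<in> {v \<in> carrier (obj (HP (Suc a)) (add_point e X)). \<delta> a X v = \<zero>\<^bsub>obj (HP a) X\<^esub>}"
    then obtain p where p: "p \<in> fi_cycles R P (Suc a) (add_point e X)"
      and cp: "c = fi_class R P (Suc a) (add_point e X) p"
      by (auto simp: fi_class_surj[OF P X'])
    let ?M = "obj (res_term P a) (add_point e X)" and ?N = "obj (res_term P (Suc a)) (add_point e X)"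
    interpret M: module R ?M by (rule P_obj[OF X'])
    interpret N: module R ?N by (rule P_obj[OF X'])
    note pc = cyc_closed[OF p] and yc = conn_closed[OF X p]
    let ?y = "conn a X p" and ?dp = "res_diff P a (add_point e X) p"
    have "?y \<in> fi_boundaries R P a X"
      using c cp \<delta>(2)[OF X p] fi_class_zero_iff[OF P X conn_cycle[OF X p]] by simp
    then obtain w where w: "w \<in> carrier (obj (res_term P (Suc a)) X)"
      and yw: "?y \<ominus>\<^bsub>obj (res_term P a) X\<^esub> res_diff P a X w \<in> fi_J R (res_term P a) X"
      by (auto simp: fi_boundaries_def)
    note dw = fi_hom_closed[OF res_hom[OF P] X w]
    note iw = \<iota>_closed[OF X w] and idw = \<iota>_closed[OF X dw] and iy = \<iota>_closed[OF X yc]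
    note dpc = fi_hom_closed[OF res_hom[OF P] X' pc]
    define p' where "p' = p \<ominus>\<^bsub>?N\<^esub> \<iota> (Suc a) X w"
    have pc': "p' \<in> carrier ?N" using pc iw by (simp add: p'_def)
    have "\<iota> a X (?y \<ominus>\<^bsub>obj (res_term P a) X\<^esub> res_diff P a X w) \<in> fi_J R (shift e (res_term P a)) X"
      using fi_J_hom[OF lift_hom[OF \<iota>] X yw] by simp
    then have 1: "\<iota> a X ?y \<ominus>\<^bsub>?M\<^esub> \<iota> a X (res_diff P a X w) \<in> fi_J R (shift e (res_term P a)) X"
      using fi_hom_minus[OF lift_hom[OF \<iota>, of a] X yc dw] by simp
    have "res_diff P a (add_point e X) p' = ?dp \<ominus>\<^bsub>?M\<^esub> \<iota> a X (res_diff P a X w)"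
      using fi_hom_minus[OF res_hom[OF P] X' pc iw] lift_diff[OF \<iota> X w] by (simp add: p'_def)
    also have "\<dots> = (?dp \<ominus>\<^bsub>?M\<^esub> \<iota> a X ?y) \<oplus>\<^bsub>?M\<^esub> (\<iota> a X ?y \<ominus>\<^bsub>?M\<^esub> \<iota> a X (res_diff P a X w))"
      using dpc iy idw by (simp add: a_minus_def M.a_assoc M.r_neg1 M.r_neg2)
    finally have "res_diff P a (add_point e X) p' \<in> fi_J R (shift e (res_term P a)) X"
      using submodule_add[OF fi_J_submodule_obj[OF res_module[OF SP, of a] X], simplified, OF conn_diff[OF X p] 1]
      by simp
    then have p': "p' \<in> fi_cycles R S (Suc a) X" using pc' by (simp add: fi_cycles_def)
    note ap = lift_cycles[OF SP \<alpha> X p']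
    have "p \<ominus>\<^bsub>?N\<^esub> p' = \<iota> (Suc a) X w"
      using pc iw by (simp add: p'_def a_minus_def N.minus_add N.r_neg1 N.r_neg2)
    then have "p \<ominus>\<^bsub>?N\<^esub> p' \<in> fi_boundaries R P (Suc a) (add_point e X)"
      using J_boundaries[OF P X' shift_incl_in_J[OF e X w]] by simp
    from fi_class_eqI[OF P X' p S_cycles[OF X p'] this]
    have "c = fi_class R P (Suc a) (add_point e X) p'" by (simp add: cp)
    also have "\<dots> = fi_class R P (Suc a) (add_point e X) (\<beta> (Suc a) X (\<alpha> (Suc a) X p'))"
      by (rule fi_class_eqI[OF P X' S_cycles[OF X lift_cycles[OF Q \<beta> X ap]] S_cycles[OF X p'], symmetric])
        (use S_boundaries[OF X agree_\<beta>\<alpha>[OF X p']] in simp)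
    also have "\<dots> = \<theta> (Suc a) X (fi_class R Q (Suc a) X (\<alpha> (Suc a) X p'))"
      by (rule \<theta>(2)[OF X ap, symmetric])
    finally show "c \<in> \<theta> (Suc a) X ` carrier (obj (HQ (Suc a)) X)"
      unfolding fi_class_surj[OF Q X] using ap by blast
  }
qed (rule \<theta>(1) \<delta>(1))+

text \<open>In degree 0 every element is a cycle, for \<open>F (S P)\<close> as for
  \<open>S (F P)\<close>, and the map between them keeps representatives.\<close>

lemma epi_theta: "fi_epi R (HQ 0) (shift e (HP 0)) (\<theta> 0)"
  unfolding fi_epi_def shift_simps
proof (intro conjI allI impI equalityI subsetI)
  fix X :: "'x set" and c assume X: "finite X"
  note X' = finite_add_point[OF X, of e]
  show "c \<in> carrier (obj (HP 0) (add_point e X))" if "c \<in> \<theta> 0 X ` carrier (obj (HQ 0) X)"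
    using that fi_hom_closed[OF \<theta>(1) X] by auto
  assume "c \<in> carrier (obj (HP 0) (add_point e X))"
  then obtain p where pP: "p \<in> fi_cycles R P 0 (add_point e X)" and c: "c = fi_class R P 0 (add_point e X) p"
    unfolding fi_class_surj[OF P X'] by blast
  have p: "p \<in> fi_cycles R S 0 X" using pP by (simp add: fi_cycles_def)
  note ap = lift_cycles[OF SP \<alpha> X p]
  have "c = fi_class R P 0 (add_point e X) (\<beta> 0 X (\<alpha> 0 X p))"
    unfolding c
    by (rule fi_class_eqI[OF P X' S_cycles[OF X lift_cycles[OF Q \<beta> X ap]] pP, symmetric])
      (use S_boundaries[OF X agree_\<beta>\<alpha>[OF X p]] in simp)
  also have "\<dots> = \<theta> 0 X (fi_class R Q 0 X (\<alpha> 0 X p))" by (rule \<theta>(2)[OF X ap, symmetric])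
  finally show "c \<in> \<theta> 0 X ` carrier (obj (HQ 0) X)"
    unfolding fi_class_surj[OF Q X] using ap by blast
qed (rule \<theta>(1))

end

theorem theorem1:
  fixes R :: "('k, 'r) ring_scheme"
    and V :: "('x, 'k, 'm) fi_mod"
    and e :: "'x option \<Rightarrow> 'x"
  assumes "cring R"
    and "inj e"
    and "fi_module R V"
  shows "\<exists>\<delta> \<theta>.
    (\<forall>a. fi_exact R
           (shift e (FI_homology R (Suc a) V))
           (FI_homology R a V)
           (FI_homology R a (shift e V))
           (\<delta> a)
           (FI_homology_map R a V (shift e V) (shift_incl e V))) \<and>
    (\<forall>a. fi_exact R
           (FI_homology R a V)
           (FI_homology R a (shift e V))
           (shift e (FI_homology R a V))
           (FI_homology_map R a V (shift e V) (shift_incl e V))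
           (\<theta> a)) \<and>
    (\<forall>a. fi_exact R
           (FI_homology R (Suc a) (shift e V))
           (shift e (FI_homology R (Suc a) V))
           (FI_homology R a V)
           (\<theta> (Suc a))
           (\<delta> a)) \<and>
    fi_epi R (FI_homology R 0 (shift e V)) (shift e (FI_homology R 0 V)) (\<theta> 0)"
proof -
  note e = assms(2) and V = assms(3)
  note SV = fi_module_shift[OF V e]
  define P where "P = chosen_resolution R V"
  define Q where "Q = chosen_resolution R (shift e V)"
  have P: "projective_resolution R V P"
    unfolding P_def chosen_resolution_def by (rule someI_ex[OF projective_resolution_exists[OF V e]])
  have Q: "projective_resolution R (shift e V) Q"
    unfolding Q_def chosen_resolution_def by (rule someI_ex[OF projective_resolution_exists[OF SV e]])
  obtain c :: "('x option \<Rightarrow> ('x + 'k + 'm) list) \<Rightarrow> ('x + 'k + 'm) list" where c: "coind_code c"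
    using coind_code_exists by blast
  note SP = projective_resolution_shift[OF P e c]
  have "\<exists>\<rho>. fi_hom R (shift e (res_term P n)) (res_term P n) \<rho> \<and>
      (\<forall>X v. finite X \<longrightarrow> v \<in> carrier (obj (res_term P n) X) \<longrightarrow> \<rho> X (shift_incl e (res_term P n) X v) = v)" for n
    by (rule projective_shift_retraction[OF res_projective[OF P, of n] e c]) blast
  then obtain \<rho> where \<rho>: "\<And>n. fi_hom R (shift e (res_term P n)) (res_term P n) (\<rho> n)"
    "\<And>n X v. finite X \<Longrightarrow> v \<in> carrier (obj (res_term P n) X) \<Longrightarrow> \<rho> n X (shift_incl e (res_term P n) X v) = v"
    by metis
  obtain \<alpha> where \<alpha>: "is_lift R (shift_resolution e P) Q (\<lambda>X v. v) \<alpha>"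
    using lift_exists[OF SP Q fi_hom_id[OF SV]] by blast
  obtain \<beta> where \<beta>: "is_lift R Q (shift_resolution e P) (\<lambda>X v. v) \<beta>"
    using lift_exists[OF Q SP fi_hom_id[OF SV]] by blast
  \<comment> \<open>The locale is entered with the chosen lift itself, so that
    \<open>H\<Phi>\<close> is the prescribed map on FI-homology.\<close>
  define \<Phi> where "\<Phi> = chosen_lift R V (shift e V) (shift_incl e V)"
  have \<Phi>: "is_lift R P Q (shift_incl e V) \<Phi>"
    unfolding \<Phi>_def chosen_lift_def P_def[symmetric] Q_def[symmetric]
    by (rule someI_ex[OF lift_exists[OF P Q fi_hom_shift_incl[OF V e]]])
  interpret shifted_resolution R V e P Q \<rho> \<alpha> \<beta> \<Phi>
    by unfold_locales (fact e P Q SP \<rho> \<alpha> \<beta> \<Phi>)+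
  have H: "FI_homology R a V = HP a" "FI_homology R a (shift e V) = HQ a"
    "FI_homology_map R a V (shift e V) (shift_incl e V) = H\<Phi> a" for a
    by (simp_all add: FI_homology_def FI_homology_map_def P_def Q_def \<Phi>_def)
  show ?thesis
    unfolding H using exact_delta exact_incl exact_theta epi_theta
    by (intro exI[where x = \<delta>] exI[where x = \<theta>]) simp
qed

end
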